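(* For every binary sequence $\mathsf d$ of length $2n$, the algebra $\mathfrak w=\mathfrak w_q^{\mathsf d}(\mathfrak g)$, with comultiplication $\Delta$ and counit $\varepsilon$, is a non-commutative and non-cocommutative weak Hopf algebra with weak antipode $T$, but $(\mathfrak w,\Delta,\varepsilon)$ is not a Hopf algebra.
   Context: Setting. $k$ is a field of characteristic $0$; $\mathfrak g$ is a finite-dimensional simple Lie algebra with root system $R$, simple roots $\alpha_1,\dots,\alpha_n$, Cartan matrix $(a_{ij})_{n\times n}$; $(\,,\,)$ is the Weyl-group-invariant scalar product with $(\alpha,\alpha)=2$ for all short roots; $d_i=(\alpha_i,\alpha_i)/2$, so $(\alpha_i,\alpha_j)=d_ia_{ij}=d_ja_{ji}$. $q\in k$, $q_i=q^{d_i}$, and $q_i\neq 0,\pm1$ for all $i$. $[m]_x=\frac{x^m-x^{-m}}{x-x^{-1}}$, $[m]!_x=[m]_x\cdots[1]_x$, $[0]!_x=1$, $\left[{m\atop s}\right]_x=\frac{[m]!_x}{[s]!_x[m-s]!_x}$ (a Laurent polynomial in $x$, evaluated at $x=q_i$ below). The algebra. Fix a binary sequence $\mathsf d=(\kappa_1,\dots,\kappa_n\,|\,\bar\kappa_1,\dots,\bar\kappa_n)\in\{0,1\}^{2n}$. $E_i$ is called type 1 if $\kappa_i=1$ and type 2 if $\kappa_i=0$; $F_i$ is type 1 if $\bar\kappa_i=1$ and type 2 if $\bar\kappa_i=0$. $\mathfrak w=\mathfrak w_q^{\mathsf d}(\mathfrak g)$ is the unital $k$-algebra generated by $E_i,F_i,K_i,\overline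 K_i$ ($1\le i\le n$) and $J$ with relations, for all $1\le i,j\le n$: $J=K_i\overline K_i$; $K_i\overline K_j=\overline K_jK_i$, $K_iK_j=K_jK_i$, $\overline K_i\overline K_j=\overline K_j\overline K_i$; $JK_i=K_i$, $J\overline K_i=\overline K_i$; if $E_i$ is type 1: $K_jE_i=q_i^{a_{ij}}E_iK_j$ and $E_i\overline K_j=q_i^{a_{ij}}\overline K_jE_i$; if $E_i$ is type 2: $K_jE_i\overline K_j=q_i^{a_{ij}}E_i$; the same for $F_i$ with $a_{ij}$ replaced by $-a_{ij}$; $E_iF_j-F_jE_i=\delta_{ij}\frac{K_i-\overline K_i}{q_i-q_i^{-1}}$; for $i\ne j$: $\sum_{s=0}^{1-a_{ij}}(-1)^s\left[{1-a_{ij}\atop s}\right]_{q_i}E_i^{1-a_{ij}-s}E_jE_i^s=0$ and the same relation with $F$ in place of $E$. The maps. $\Delta:\mathfrak w\to\mathfrak w\otimes\mathfrak w$ and $\varepsilon:\mathfrak w\to k$ are extended as unital algebra homomorphisms, $T:\mathfrak w\to\mathfrak w$ as an algebra anti-homomorphism, from: $\Delta(K_i)=K_i\otimes K_i$, $\Delta(\overline K_i)=\overline K_i\otimes\overline K_i$, $\Delta(J)=J\otimes J$; $\Delta(E_i)=1\otimes E_i+E_i\otimes K_i$ if $E_i$ is type 1, $\Delta(E_i)=J\otimes E_i+E_i\otimes K_i$ if type 2; $\Delta(F_i)=F_i\otimes1+\overline K_i\otimes F_i$ if $F_i$ is type 1, $\Delta(F_i)=F_i\otimes J+\overline K_i\otimes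 F_i$ if type 2; $\varepsilon(E_i)=\varepsilon(F_i)=0$, $\varepsilon(K_i)=\varepsilon(\overline K_i)=\varepsilon(J)=1$; $T(1)=1$, $T(E_i)=-E_i\overline K_i$, $T(F_i)=-K_iF_i$, $T(K_i)=\overline K_i$, $T(\overline K_i)=K_i$, $T(J)=J$. Weak Hopf algebra (in the sense of Li): a bialgebra $A$ over $k$ for which there is $T\in\mathrm{Hom}_k(A,A)$ (a weak antipode) with $\mathrm{id}*T*\mathrm{id}=\mathrm{id}$ and $T*\mathrm{id}*T=T$, where $*$ is the convolution product. *)

theory Defs
  imports
    "HOL-Analysis.Analysis"
    "HOL-Library.Poly_Mapping"
    "HOL-Computational_Algebra.Polynomial_Factorial"
    "HOL-Algebra.QuotRing"
    "HOL-Algebra.Module"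
    "HOL-Algebra.Algebraic_Closure_Type"
begin

section \<open>Root systems\<close>

text \<open>The ambient inner product plays the role of the Weyl-group-invariant scalar product: the
  reflections are orthogonal for it, so it is invariant.\<close>

locale root_system =
  fixes R :: "'v::euclidean_space set"
  assumes finite_roots: "finite R"
    and span_roots: "span R = UNIV"
    and zero_notin_roots: "0 \<notin> R"
    and reduced: "\<lbrakk>\<beta> \<in> R; c *\<^sub>R \<beta> \<in> R\<rbrakk> \<Longrightarrow> c = 1 \<or> c = - 1"
    and reflection_closed:
      "\<lbrakk>\<beta> \<in> R; \<gamma> \<in> R\<rbrakk> \<Longrightarrow> \<gamma> - (2 * (\<gamma> \<bullet> \<beta>) / (\<beta> \<bullet> \<beta>)) *\<^sub>R \<beta> \<in> R"
    and integrality: "\<lbrakk>\<beta> \<in> R; \<gamma> \<in> R\<rbrakk> \<Longrightarrow> 2 * (\<gamma> \<bullet> \<beta>) / (\<beta> \<bullet> \<beta>) \<in> \<int>"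

text \<open>The irreducible root systems are those of the finite-dimensional (split) simple Lie
  algebras.\<close>

locale irreducible_root_system = root_system +
  assumes roots_nonempty: "R \<noteq> {}"
    and irreducible:
      "\<lbrakk>R = S \<union> S'; \<And>\<beta> \<gamma>. \<lbrakk>\<beta> \<in> S; \<gamma> \<in> S'\<rbrakk> \<Longrightarrow> \<beta> \<bullet> \<gamma> = 0\<rbrakk> \<Longrightarrow> S = {} \<or> S' = {}"

text \<open>A base of simple roots, indexed by a finite type whose cardinality is the rank.\<close>

definition simple_roots :: "'v::euclidean_space set \<Rightarrow> ('n::finite \<Rightarrow> 'v) \<Rightarrow> bool" where
  "simple_roots R \<alpha> \<longleftrightarrow>
     inj \<alpha> \<and> range \<alpha> \<subseteq> R \<and> independent (range \<alpha>) \<and>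
     (\<forall>\<beta>\<in>R. \<exists>c :: 'n \<Rightarrow> nat.
        \<beta> = (\<Sum>i\<in>UNIV. real (c i) *\<^sub>R \<alpha> i) \<or> \<beta> = - (\<Sum>i\<in>UNIV. real (c i) *\<^sub>R \<alpha> i))"

text \<open>If all roots have the same length, all of them count as short.\<close>

definition short_roots :: "'v::euclidean_space set \<Rightarrow> 'v set" where
  "short_roots R = {\<beta> \<in> R. \<forall>\<gamma>\<in>R. \<beta> \<bullet> \<beta> \<le> \<gamma> \<bullet> \<gamma>}"

text \<open>For the simple roots of a root system whose short roots have square length 2 both arguments
  of the floor function are integers, so that
  \<open>\<alpha> i \<bullet> \<alpha> j = root_d \<alpha> i * cartan \<alpha> i j\<close>.\<close>

definition root_d :: "('n \<Rightarrow> 'v::euclidean_space) \<Rightarrow> 'n \<Rightarrow> nat" where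
  "root_d \<alpha> i = nat \<lfloor>(\<alpha> i \<bullet> \<alpha> i) / 2\<rfloor>"

definition cartan :: "('n \<Rightarrow> 'v::euclidean_space) \<Rightarrow> 'n \<Rightarrow> 'n \<Rightarrow> int" where
  "cartan \<alpha> i j = \<lfloor>2 * (\<alpha> i \<bullet> \<alpha> j) / (\<alpha> i \<bullet> \<alpha> i)\<rfloor>"


section \<open>Gaussian binomial coefficients\<close>

definition q_int :: "'a::field \<Rightarrow> nat \<Rightarrow> 'a" where
  "q_int x m = (x ^ m - inverse x ^ m) / (x - inverse x)"

definition q_fact :: "'a::field \<Rightarrow> nat \<Rightarrow> 'a" where
  "q_fact x m = (\<Prod>r = 1..m. q_int x r)"

definition q_binom :: "'a::field \<Rightarrow> nat \<Rightarrow> nat \<Rightarrow> 'a" where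
  "q_binom x m s = q_fact x m / (q_fact x s * q_fact x (m - s))"

definition indet :: "'k::field_char_0 poly fract" where
  "indet = to_fract [:0, 1:]"

text \<open>The value at a nonzero \<open>x\<close> of a Laurent polynomial, given as an element of the field of
  rational functions.\<close>

definition laurent_eval :: "'k::field_char_0 poly fract \<Rightarrow> 'k \<Rightarrow> 'k" where
  "laurent_eval f x = (THE c. \<exists>p N. f = to_fract p / indet ^ N \<and> c = poly p x / x ^ N)"

text \<open>If \<open>x\<close> is a root of unity, \<open>q_binom x m s\<close> may have a vanishing denominator. Hence the
  quotient is formed over the indeterminate and evaluated afterwards.\<close>

definition gauss_binom :: "'k::field_char_0 \<Rightarrow> nat \<Rightarrow> nat \<Rightarrow> 'k" where
  "gauss_binom x m s = laurent_eval (q_binom indet m s) x"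


section \<open>Algebras over a field and their quotients\<close>

abbreviation scalars :: "'k::field ring" where
  "scalars \<equiv> ring_of_type_algebra"

text \<open>The locale \<open>algebra\<close> of the library asks for a commutative ring.\<close>

definition unital_algebra :: "('k::field, 'a) module \<Rightarrow> bool" where
  "unital_algebra A \<longleftrightarrow> module scalars A \<and> ring A \<and>
     (\<forall>c. \<forall>x\<in>carrier A. \<forall>y\<in>carrier A.
        (c \<odot>\<^bsub>A\<^esub> x) \<otimes>\<^bsub>A\<^esub> y = c \<odot>\<^bsub>A\<^esub> (x \<otimes>\<^bsub>A\<^esub> y) \<and>
        x \<otimes>\<^bsub>A\<^esub> (c \<odot>\<^bsub>A\<^esub> y) = c \<odot>\<^bsub>A\<^esub> (x \<otimes>\<^bsub>A\<^esub> y))"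

definition field_algebra :: "('k::field, 'k) module" where
  "field_algebra =
     \<lparr>carrier = UNIV, mult = (*), one = 1, zero = 0, add = (+), smult = (*)\<rparr>"

definition linear_maps :: "('k::field, 'a) module \<Rightarrow> ('k, 'b) module \<Rightarrow> ('a \<Rightarrow> 'b) set" where
  "linear_maps A B = {f \<in> carrier A \<rightarrow> carrier B.
     (\<forall>x\<in>carrier A. \<forall>y\<in>carrier A. f (x \<oplus>\<^bsub>A\<^esub> y) = f x \<oplus>\<^bsub>B\<^esub> f y) \<and>
     (\<forall>c. \<forall>x\<in>carrier A. f (c \<odot>\<^bsub>A\<^esub> x) = c \<odot>\<^bsub>B\<^esub> f x)}"

definition algebra_homs :: "('k::field, 'a) module \<Rightarrow> ('k, 'b) module \<Rightarrow> ('a \<Rightarrow> 'b) set" where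
  "algebra_homs A B = linear_maps A B \<inter> ring_hom A B"

definition algebra_antihoms :: "('k::field, 'a) module \<Rightarrow> ('k, 'b) module \<Rightarrow> ('a \<Rightarrow> 'b) set" where
  "algebra_antihoms A B = {f \<in> linear_maps A B. f \<one>\<^bsub>A\<^esub> = \<one>\<^bsub>B\<^esub> \<and>
     (\<forall>x\<in>carrier A. \<forall>y\<in>carrier A. f (x \<otimes>\<^bsub>A\<^esub> y) = f y \<otimes>\<^bsub>B\<^esub> f x)}"

text \<open>The monoid algebra: finitely supported functions on a monoid with the convolution product.\<close>

definition monoid_algebra :: "('a, 'z) monoid_scheme \<Rightarrow> ('k::field, 'a \<Rightarrow>\<^sub>0 'k) module" where
  "monoid_algebra M =
     \<lparr>carrier = {f. Poly_Mapping.keys f \<subseteq> carrier M},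
      mult = (\<lambda>f g. \<Sum>u\<in>Poly_Mapping.keys f. \<Sum>v\<in>Poly_Mapping.keys g.
        Poly_Mapping.single (u \<otimes>\<^bsub>M\<^esub> v) (Poly_Mapping.lookup f u * Poly_Mapping.lookup g v)),
      one = Poly_Mapping.single \<one>\<^bsub>M\<^esub> 1,
      zero = 0,
      add = (+),
      smult = (\<lambda>c. Poly_Mapping.map ((*) c))\<rparr>"

definition word_monoid :: "'g list monoid" where
  "word_monoid = \<lparr>carrier = UNIV, mult = (@), one = []\<rparr>"

abbreviation free_algebra :: "('k::field, 'g list \<Rightarrow>\<^sub>0 'k) module" where
  "free_algebra \<equiv> monoid_algebra word_monoid"

text \<open>The quotient ring \<open>A Quot I\<close> of the library, equipped with the induced scalar
  multiplication.\<close>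

definition quotient_algebra :: "('k::field, 'a) module \<Rightarrow> 'a set \<Rightarrow> ('k, 'a set) module" where
  "quotient_algebra A I =
     \<lparr>carrier = carrier (A Quot I), mult = mult (A Quot I), one = one (A Quot I),
      zero = zero (A Quot I), add = add (A Quot I),
      smult = (\<lambda>c Y. \<Union>x\<in>Y. I +>\<^bsub>A\<^esub> (c \<odot>\<^bsub>A\<^esub> x))\<rparr>"

definition submodule_span :: "('k::field, 'a) module \<Rightarrow> 'a set \<Rightarrow> 'a set" where
  "submodule_span A S = \<Inter>{H. submodule H scalars A \<and> S \<subseteq> H}"


section \<open>Tensor products\<close>

text \<open>The tensor product is the free vector space on \<open>carrier A \<times> carrier B\<close> modulo the subspace
  that makes the pairs bilinear. The product \<open>(a \<otimes> b) (a' \<otimes> b') = a a' \<otimes> b b'\<close> is induced from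
  the monoid algebra of the direct product of the multiplicative monoids.\<close>

definition tensor_relators ::
  "('k::field, 'a) module \<Rightarrow> ('k, 'b) module \<Rightarrow> (('a \<times> 'b) \<Rightarrow>\<^sub>0 'k) set" where
  "tensor_relators A B =
     {Poly_Mapping.single (a \<oplus>\<^bsub>A\<^esub> a', b) 1 - Poly_Mapping.single (a, b) 1
        - Poly_Mapping.single (a', b) 1 | a a' b.
        a \<in> carrier A \<and> a' \<in> carrier A \<and> b \<in> carrier B} \<union>
     {Poly_Mapping.single (a, b \<oplus>\<^bsub>B\<^esub> b') 1 - Poly_Mapping.single (a, b) 1
        - Poly_Mapping.single (a, b') 1 | a b b'.
        a \<in> carrier A \<and> b \<in> carrier B \<and> b' \<in> carrier B} \<union>
     {Poly_Mapping.single (c \<odot>\<^bsub>A\<^esub> a, b) 1 - Poly_Mapping.single (a, b) c | c a b.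
        a \<in> carrier A \<and> b \<in> carrier B} \<union>
     {Poly_Mapping.single (a, c \<odot>\<^bsub>B\<^esub> b) 1 - Poly_Mapping.single (a, b) c | c a b.
        a \<in> carrier A \<and> b \<in> carrier B}"

definition tensor_kernel ::
  "('k::field, 'a) module \<Rightarrow> ('k, 'b) module \<Rightarrow> (('a \<times> 'b) \<Rightarrow>\<^sub>0 'k) set" where
  "tensor_kernel A B = submodule_span (monoid_algebra (A \<times>\<times> B)) (tensor_relators A B)"

definition tensor ::
  "('k::field, 'a) module \<Rightarrow> ('k, 'b) module \<Rightarrow> ('k, (('a \<times> 'b) \<Rightarrow>\<^sub>0 'k) set) module" where
  "tensor A B = quotient_algebra (monoid_algebra (A \<times>\<times> B)) (tensor_kernel A B)"

definition pure_tensor ::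
  "('k::field, 'a) module \<Rightarrow> ('k, 'b) module \<Rightarrow> 'a \<Rightarrow> 'b \<Rightarrow> (('a \<times> 'b) \<Rightarrow>\<^sub>0 'k) set" where
  "pure_tensor A B a b =
     tensor_kernel A B +>\<^bsub>monoid_algebra (A \<times>\<times> B)\<^esub> Poly_Mapping.single (a, b) 1"

text \<open>The linear map into \<open>C\<close> induced by a bilinear map \<open>\<beta>\<close>, which sends \<open>a \<otimes> b\<close> to \<open>\<beta> a b\<close>. It
  is evaluated on the representatives of a coset; the value does not depend on the representative
  when \<open>\<beta>\<close> is bilinear.\<close>

definition tensor_lift ::
  "('k::field, 'c) module \<Rightarrow> ('a \<Rightarrow> 'b \<Rightarrow> 'c) \<Rightarrow> (('a \<times> 'b) \<Rightarrow>\<^sub>0 'k) set \<Rightarrow> 'c" where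
  "tensor_lift C \<beta> Y = the_elem
     ((\<lambda>f. \<Oplus>\<^bsub>C\<^esub>p\<in>Poly_Mapping.keys f. Poly_Mapping.lookup f p \<odot>\<^bsub>C\<^esub> \<beta> (fst p) (snd p)) ` Y)"

definition tensor_map ::
  "('k::field, 'c) module \<Rightarrow> ('k, 'd) module \<Rightarrow> ('a \<Rightarrow> 'c) \<Rightarrow> ('b \<Rightarrow> 'd) \<Rightarrow>
     (('a \<times> 'b) \<Rightarrow>\<^sub>0 'k) set \<Rightarrow> (('c \<times> 'd) \<Rightarrow>\<^sub>0 'k) set" where
  "tensor_map C D f g = tensor_lift (tensor C D) (\<lambda>a b. pure_tensor C D (f a) (g b))"

text \<open>The canonical map \<open>(A \<otimes> A) \<otimes> A \<rightarrow> A \<otimes> (A \<otimes> A)\<close>.\<close>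

definition tensor_assoc ::
  "('k::field, 'a) module \<Rightarrow> (((('a \<times> 'a) \<Rightarrow>\<^sub>0 'k) set \<times> 'a) \<Rightarrow>\<^sub>0 'k) set \<Rightarrow>
     (('a \<times> (('a \<times> 'a) \<Rightarrow>\<^sub>0 'k) set) \<Rightarrow>\<^sub>0 'k) set" where
  "tensor_assoc A = tensor_lift (tensor A (tensor A A))
     (\<lambda>t c. tensor_lift (tensor A (tensor A A))
        (\<lambda>a b. pure_tensor A (tensor A A) a (pure_tensor A A b c)) t)"

definition tensor_flip ::
  "('k::field, 'a) module \<Rightarrow> (('a \<times> 'a) \<Rightarrow>\<^sub>0 'k) set \<Rightarrow> (('a \<times> 'a) \<Rightarrow>\<^sub>0 'k) set" where
  "tensor_flip A = tensor_lift (tensor A A) (\<lambda>a b. pure_tensor A A b a)"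


section \<open>Bialgebras, Hopf algebras and weak Hopf algebras\<close>

text \<open>In the counit laws \<open>k \<otimes> A\<close> and \<open>A \<otimes> k\<close> are identified with \<open>A\<close>.\<close>

definition coalgebra ::
  "('k::field, 'a) module \<Rightarrow> ('a \<Rightarrow> (('a \<times> 'a) \<Rightarrow>\<^sub>0 'k) set) \<Rightarrow> ('a \<Rightarrow> 'k) \<Rightarrow> bool" where
  "coalgebra A \<Delta> \<epsilon> \<longleftrightarrow>
     module scalars A \<and> \<Delta> \<in> linear_maps A (tensor A A) \<and> \<epsilon> \<in> linear_maps A field_algebra \<and>
     (\<forall>x\<in>carrier A.
        tensor_assoc A (tensor_map (tensor A A) A \<Delta> id (\<Delta> x)) =
          tensor_map A (tensor A A) id \<Delta> (\<Delta> x) \<and>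
        tensor_lift A (\<lambda>a b. \<epsilon> a \<odot>\<^bsub>A\<^esub> b) (\<Delta> x) = x \<and>
        tensor_lift A (\<lambda>a b. \<epsilon> b \<odot>\<^bsub>A\<^esub> a) (\<Delta> x) = x)"

definition bialgebra ::
  "('k::field, 'a) module \<Rightarrow> ('a \<Rightarrow> (('a \<times> 'a) \<Rightarrow>\<^sub>0 'k) set) \<Rightarrow> ('a \<Rightarrow> 'k) \<Rightarrow> bool" where
  "bialgebra A \<Delta> \<epsilon> \<longleftrightarrow>
     unital_algebra A \<and> coalgebra A \<Delta> \<epsilon> \<and>
     \<Delta> \<in> algebra_homs A (tensor A A) \<and> \<epsilon> \<in> algebra_homs A field_algebra"

definition convolution ::
  "('k::field, 'a) module \<Rightarrow> ('a \<Rightarrow> (('a \<times> 'a) \<Rightarrow>\<^sub>0 'k) set) \<Rightarrow>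
     ('a \<Rightarrow> 'a) \<Rightarrow> ('a \<Rightarrow> 'a) \<Rightarrow> 'a \<Rightarrow> 'a" where
  "convolution A \<Delta> f g x = tensor_lift A (mult A) (tensor_map A A f g (\<Delta> x))"

definition antipode ::
  "('k::field, 'a) module \<Rightarrow> ('a \<Rightarrow> (('a \<times> 'a) \<Rightarrow>\<^sub>0 'k) set) \<Rightarrow> ('a \<Rightarrow> 'k) \<Rightarrow>
     ('a \<Rightarrow> 'a) \<Rightarrow> bool" where
  "antipode A \<Delta> \<epsilon> S \<longleftrightarrow> S \<in> linear_maps A A \<and>
     (\<forall>x\<in>carrier A. convolution A \<Delta> id S x = \<epsilon> x \<odot>\<^bsub>A\<^esub> \<one>\<^bsub>A\<^esub> \<and>
        convolution A \<Delta> S id x = \<epsilon> x \<odot>\<^bsub>A\<^esub> \<one>\<^bsub>A\<^esub>)"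

definition hopf_algebra ::
  "('k::field, 'a) module \<Rightarrow> ('a \<Rightarrow> (('a \<times> 'a) \<Rightarrow>\<^sub>0 'k) set) \<Rightarrow> ('a \<Rightarrow> 'k) \<Rightarrow> bool" where
  "hopf_algebra A \<Delta> \<epsilon> \<longleftrightarrow> bialgebra A \<Delta> \<epsilon> \<and> (\<exists>S. antipode A \<Delta> \<epsilon> S)"

definition weak_antipode ::
  "('k::field, 'a) module \<Rightarrow> ('a \<Rightarrow> (('a \<times> 'a) \<Rightarrow>\<^sub>0 'k) set) \<Rightarrow> ('a \<Rightarrow> 'a) \<Rightarrow> bool" where
  "weak_antipode A \<Delta> T \<longleftrightarrow> T \<in> linear_maps A A \<and>
     (\<forall>x\<in>carrier A. convolution A \<Delta> (convolution A \<Delta> id T) id x = x \<and>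
        convolution A \<Delta> (convolution A \<Delta> T id) T x = T x)"

definition weak_hopf_algebra ::
  "('k::field, 'a) module \<Rightarrow> ('a \<Rightarrow> (('a \<times> 'a) \<Rightarrow>\<^sub>0 'k) set) \<Rightarrow> ('a \<Rightarrow> 'k) \<Rightarrow> bool" where
  "weak_hopf_algebra A \<Delta> \<epsilon> \<longleftrightarrow> bialgebra A \<Delta> \<epsilon> \<and> (\<exists>T. weak_antipode A \<Delta> T)"

definition commutative :: "('k::field, 'a) module \<Rightarrow> bool" where
  "commutative A \<longleftrightarrow> (\<forall>x\<in>carrier A. \<forall>y\<in>carrier A. x \<otimes>\<^bsub>A\<^esub> y = y \<otimes>\<^bsub>A\<^esub> x)"

definition cocommutative ::
  "('k::field, 'a) module \<Rightarrow> ('a \<Rightarrow> (('a \<times> 'a) \<Rightarrow>\<^sub>0 'k) set) \<Rightarrow> bool" where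
  "cocommutative A \<Delta> \<longleftrightarrow> (\<forall>x\<in>carrier A. tensor_flip A (\<Delta> x) = \<Delta> x)"


section \<open>The algebra defined by generators and relations\<close>

datatype 'n gen = E 'n | F 'n | K 'n | Kbar 'n | J

abbreviation word :: "'n gen list \<Rightarrow> 'n gen list \<Rightarrow>\<^sub>0 'k::field" where
  "word u \<equiv> Poly_Mapping.single u 1"

abbreviation scaled_word :: "'k \<Rightarrow> 'n gen list \<Rightarrow> 'n gen list \<Rightarrow>\<^sub>0 'k::field" where
  "scaled_word c u \<equiv> Poly_Mapping.single u c"

definition q_root :: "('n \<Rightarrow> 'v::euclidean_space) \<Rightarrow> 'k::field \<Rightarrow> 'n \<Rightarrow> 'k" where
  "q_root \<alpha> q i = q ^ root_d \<alpha> i"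

text \<open>The left-hand side of the quantum Serre relation between \<open>G i\<close> and \<open>G j\<close>, where \<open>G\<close> is \<open>E\<close>
  or \<open>F\<close>. For \<open>i \<noteq> j\<close> the Cartan integer is nonpositive, so \<open>nat\<close> does not truncate.\<close>

definition serre ::
  "('n \<Rightarrow> 'v::euclidean_space) \<Rightarrow> 'k::field_char_0 \<Rightarrow> ('n \<Rightarrow> 'n gen) \<Rightarrow> 'n \<Rightarrow> 'n \<Rightarrow>
     ('n gen list \<Rightarrow>\<^sub>0 'k)" where
  "serre \<alpha> q G i j =
     (let m = nat (1 - cartan \<alpha> i j) in
      \<Sum>s = 0..m. scaled_word ((- 1) ^ s * gauss_binom (q_root \<alpha> q i) m s)
        (replicate (m - s) (G i) @ [G j] @ replicate s (G i)))"

text \<open>Each relation \<open>l = r\<close> is represented by \<open>l - r\<close>. The binary sequence is given by its two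
  halves \<open>\<kappa>\<close> (for the \<open>E i\<close>) and \<open>\<kappa>'\<close> (for the \<open>F i\<close>), with \<open>True\<close> for the entry 1, that is, for
  type 1.\<close>

definition relators ::
  "('n \<Rightarrow> 'v::euclidean_space) \<Rightarrow> 'k::field_char_0 \<Rightarrow> ('n \<Rightarrow> bool) \<Rightarrow> ('n \<Rightarrow> bool) \<Rightarrow>
     ('n gen list \<Rightarrow>\<^sub>0 'k) set" where
  "relators \<alpha> q \<kappa> \<kappa>' =
     {word [J] - word [K i, Kbar i] | i. True} \<union>
     {word [K i, Kbar j] - word [Kbar j, K i] | i j. True} \<union>
     {word [K i, K j] - word [K j, K i] | i j. True} \<union>
     {word [Kbar i, Kbar j] - word [Kbar j, Kbar i] | i j. True} \<union>
     {word [J, K i] - word [K i] | i. True} \<union>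
     {word [J, Kbar i] - word [Kbar i] | i. True} \<union>
     {word [K j, E i] - scaled_word (q_root \<alpha> q i powi cartan \<alpha> i j) [E i, K j] | i j. \<kappa> i} \<union>
     {word [E i, Kbar j] - scaled_word (q_root \<alpha> q i powi cartan \<alpha> i j) [Kbar j, E i] | i j. \<kappa> i} \<union>
     {word [K j, E i, Kbar j] - scaled_word (q_root \<alpha> q i powi cartan \<alpha> i j) [E i] | i j. \<not> \<kappa> i} \<union>
     {word [K j, F i] - scaled_word (q_root \<alpha> q i powi (- cartan \<alpha> i j)) [F i, K j] | i j. \<kappa>' i} \<union>
     {word [F i, Kbar j] - scaled_word (q_root \<alpha> q i powi (- cartan \<alpha> i j)) [Kbar j, F i]
        | i j. \<kappa>' i} \<union>
     {word [K j, F i, Kbar j] - scaled_word (q_root \<alpha> q i powi (- cartan \<alpha> i j)) [F i]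
        | i j. \<not> \<kappa>' i} \<union>
     {word [E i, F j] - word [F j, E i] | i j. i \<noteq> j} \<union>
     {word [E i, F i] - word [F i, E i]
        - (scaled_word (1 / (q_root \<alpha> q i - inverse (q_root \<alpha> q i))) [K i]
           - scaled_word (1 / (q_root \<alpha> q i - inverse (q_root \<alpha> q i))) [Kbar i]) | i. True} \<union>
     {serre \<alpha> q E i j | i j. i \<noteq> j} \<union>
     {serre \<alpha> q F i j | i j. i \<noteq> j}"

definition relation_ideal ::
  "('n \<Rightarrow> 'v::euclidean_space) \<Rightarrow> 'k::field_char_0 \<Rightarrow> ('n \<Rightarrow> bool) \<Rightarrow> ('n \<Rightarrow> bool) \<Rightarrow>
     ('n gen list \<Rightarrow>\<^sub>0 'k) set" where
  "relation_ideal \<alpha> q \<kappa> \<kappa>' = Idl\<^bsub>free_algebra\<^esub> (relators \<alpha> q \<kappa> \<kappa>')"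

definition weak_quantum_algebra ::
  "('n \<Rightarrow> 'v::euclidean_space) \<Rightarrow> 'k::field_char_0 \<Rightarrow> ('n \<Rightarrow> bool) \<Rightarrow> ('n \<Rightarrow> bool) \<Rightarrow>
     ('k, ('n gen list \<Rightarrow>\<^sub>0 'k) set) module" where
  "weak_quantum_algebra \<alpha> q \<kappa> \<kappa>' = quotient_algebra free_algebra (relation_ideal \<alpha> q \<kappa> \<kappa>')"

definition generator ::
  "('n \<Rightarrow> 'v::euclidean_space) \<Rightarrow> 'k::field_char_0 \<Rightarrow> ('n \<Rightarrow> bool) \<Rightarrow> ('n \<Rightarrow> bool) \<Rightarrow>
     'n gen \<Rightarrow> ('n gen list \<Rightarrow>\<^sub>0 'k) set" where
  "generator \<alpha> q \<kappa> \<kappa>' x = relation_ideal \<alpha> q \<kappa> \<kappa>' +>\<^bsub>free_algebra\<^esub> word [x]"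


section \<open>The structure maps\<close>

text \<open>The following predicates describe the maps by their type of homomorphism and their values on
  the images \<open>g x\<close> of the generators in an algebra \<open>A\<close>.\<close>

definition is_comultiplication ::
  "('k::field, 'a) module \<Rightarrow> ('n gen \<Rightarrow> 'a) \<Rightarrow> ('n \<Rightarrow> bool) \<Rightarrow> ('n \<Rightarrow> bool) \<Rightarrow>
     ('a \<Rightarrow> (('a \<times> 'a) \<Rightarrow>\<^sub>0 'k) set) \<Rightarrow> bool" where
  "is_comultiplication A g \<kappa> \<kappa>' \<Delta> \<longleftrightarrow>
     \<Delta> \<in> algebra_homs A (tensor A A) \<and>
     \<Delta> (g J) = pure_tensor A A (g J) (g J) \<and>
     (\<forall>i. \<Delta> (g (K i)) = pure_tensor A A (g (K i)) (g (K i)) \<and>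
          \<Delta> (g (Kbar i)) = pure_tensor A A (g (Kbar i)) (g (Kbar i)) \<and>
          \<Delta> (g (E i)) =
            pure_tensor A A (if \<kappa> i then \<one>\<^bsub>A\<^esub> else g J) (g (E i))
              \<oplus>\<^bsub>tensor A A\<^esub> pure_tensor A A (g (E i)) (g (K i)) \<and>
          \<Delta> (g (F i)) =
            pure_tensor A A (g (F i)) (if \<kappa>' i then \<one>\<^bsub>A\<^esub> else g J)
              \<oplus>\<^bsub>tensor A A\<^esub> pure_tensor A A (g (Kbar i)) (g (F i)))"

definition is_counit :: "('k::field, 'a) module \<Rightarrow> ('n gen \<Rightarrow> 'a) \<Rightarrow> ('a \<Rightarrow> 'k) \<Rightarrow> bool" where
  "is_counit A g \<epsilon> \<longleftrightarrow>
     \<epsilon> \<in> algebra_homs A field_algebra \<and> \<epsilon> (g J) = 1 \<and>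
     (\<forall>i. \<epsilon> (g (E i)) = 0 \<and> \<epsilon> (g (F i)) = 0 \<and> \<epsilon> (g (K i)) = 1 \<and> \<epsilon> (g (Kbar i)) = 1)"

definition is_antipode_map ::
  "('k::field, 'a) module \<Rightarrow> ('n gen \<Rightarrow> 'a) \<Rightarrow> ('a \<Rightarrow> 'a) \<Rightarrow> bool" where
  "is_antipode_map A g T \<longleftrightarrow>
     T \<in> algebra_antihoms A A \<and> T (g J) = g J \<and>
     (\<forall>i. T (g (E i)) = \<ominus>\<^bsub>A\<^esub> (g (E i) \<otimes>\<^bsub>A\<^esub> g (Kbar i)) \<and>
          T (g (F i)) = \<ominus>\<^bsub>A\<^esub> (g (K i) \<otimes>\<^bsub>A\<^esub> g (F i)) \<and>
          T (g (K i)) = g (Kbar i) \<and> T (g (Kbar i)) = g (K i))"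

end

theory Submission
  imports Defs
begin

text \<open>
  Everything rests on the idempotent \<open>J\<close>. It is central: a generator of type 2 absorbs \<open>J\<close> on both
  sides, one of type 1 is multiplied by inverse scalars when it passes \<open>K i\<close> and \<open>Kbar i\<close>, and
  \<open>J = K i * Kbar i\<close>. On \<open>J \<ww>\<close> the \<open>K i\<close> are invertible with inverses \<open>Kbar i\<close>, and the relations
  are those of the quantum group; on \<open>(1 - J) \<ww>\<close> the \<open>K i\<close>, the \<open>Kbar i\<close> and the generators of
  type 2 vanish, and every \<open>E i\<close> commutes with every \<open>F j\<close>.

  \<^bold>\<open>The structure maps exist.\<close> By the universal property it suffices that the prescribed values on
  the generators satisfy the relations. The hard one is the Serre relation. By the two Pascal rules
  the Serre sum with \<open>x = q_root \<alpha> q i\<close> and \<open>m = 1 - cartan \<alpha> i j\<close> is a product of commuting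
  operators, \<open>\<Prod>t<m. (L - x ^ (m - 1 - 2 t) R)\<close>, applied to the second generator, where \<open>L\<close> and \<open>R\<close>
  are the left and right multiplications by the first. Now \<open>\<Delta> (E i) = A i + B i\<close> with
  \<open>B i * A i = x\<^sup>2 A i * B i\<close>, and \<open>B i\<close> and \<open>A j\<close> commute up to exactly the scalar of an extreme
  factor. When the factors are applied from that end, \<open>B i\<close> drops out of every one of them on
  \<open>A j\<close>, and from the other end \<open>A i\<close> drops out on \<open>B j\<close> (\<open>q_serre_sum\<close>). Hence the Serre element
  of the sums is the sum of two Serre elements, each of which has a Serre element of \<open>\<ww>\<close> in one of
  its tensor factors. The antipode is a homomorphism to the opposite algebra; there
  \<open>q_serre_twist\<close> removes the factors \<open>Kbar i\<close> and \<open>K i\<close>, and reversing products inverts the exponents of the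
  factors, which form a set symmetric about 0.

  \<^bold>\<open>Weak antipode.\<close> The bialgebra axioms compare algebra homomorphisms, so they only need the
  generators. The convolutions \<open>id * T\<close> and \<open>T * id\<close> are not homomorphisms, but if
  \<open>\<Delta> u = \<Sum> u1 \<otimes> u2\<close>, then \<open>(id * T) (u y) = \<Sum> u1 (id * T) (y) T u2\<close>. Hence \<open>id * T * id = id\<close>
  follows by attaching generators on the left, and \<open>T * id * T = T\<close> by attaching them on the right.
  The first induction needs that the values of \<open>id * T\<close> commute with \<open>E i\<close> on \<open>(1 - J) \<ww>\<close>
  (\<open>id_conv_T_commute_E\<close>): there, they are polynomials in the \<open>F j\<close>.

  \<^bold>\<open>Not a Hopf algebra.\<close> An antipode would give \<open>K i\<close> a right inverse, and then \<open>J K i = K i\<close> forces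
  \<open>J = 1\<close>. But the relators have no constant term, so there is a character that sends all
  generators to 0.

  \<^bold>\<open>Neither commutative nor cocommutative.\<close> This needs functionals on \<open>\<ww>\<close> that are visibly
  nonzero. They are the matrix coefficients of the dual of a Verma module, realised on
  functions on words in the letters \<open>F i\<close>. A Serre element in the \<open>F i\<close> commutes with all \<open>E k\<close>
  (\<open>q_serre_commute\<close>) and so annihilates everything generated by the \<open>E k\<close> from the vacuum
  functional, and for the dual reason a Serre element in the \<open>E i\<close> acts as zero. So the coefficients
  of this module respect all relations. The vacuum coefficient separates
  \<open>E i * F i\<close> from \<open>F i * E i\<close>, and a product of two coefficients separates \<open>\<Delta> (E i)\<close> from its flip.
\<close>

section \<open>Unital algebras and the ring of their families\<close>

lemma unital_algebraD:
  assumes "unital_algebra A"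
  shows "module scalars A" "ring A"
    "\<And>c x y. \<lbrakk>x \<in> carrier A; y \<in> carrier A\<rbrakk> \<Longrightarrow> (c \<odot>\<^bsub>A\<^esub> x) \<otimes>\<^bsub>A\<^esub> y = c \<odot>\<^bsub>A\<^esub> (x \<otimes>\<^bsub>A\<^esub> y)"
    "\<And>c x y. \<lbrakk>x \<in> carrier A; y \<in> carrier A\<rbrakk> \<Longrightarrow> x \<otimes>\<^bsub>A\<^esub> (c \<odot>\<^bsub>A\<^esub> y) = c \<odot>\<^bsub>A\<^esub> (x \<otimes>\<^bsub>A\<^esub> y)"
  using assms unfolding unital_algebra_def by auto

lemma scalars_simps [simp]:
  "carrier scalars = UNIV" "mult scalars = (*)" "one scalars = 1" "zero scalars = 0" "add scalars = (+)"
  by (auto simp: ring_of_type_algebra_def)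

lemma module_scalarsD:
  assumes "module scalars A"
  shows "abelian_group A"
    "\<And>c x. x \<in> carrier A \<Longrightarrow> c \<odot>\<^bsub>A\<^esub> x \<in> carrier A"
    "\<And>c d x. x \<in> carrier A \<Longrightarrow> (c + d) \<odot>\<^bsub>A\<^esub> x = c \<odot>\<^bsub>A\<^esub> x \<oplus>\<^bsub>A\<^esub> d \<odot>\<^bsub>A\<^esub> x"
    "\<And>c x y. \<lbrakk>x \<in> carrier A; y \<in> carrier A\<rbrakk> \<Longrightarrow> c \<odot>\<^bsub>A\<^esub> (x \<oplus>\<^bsub>A\<^esub> y) = c \<odot>\<^bsub>A\<^esub> x \<oplus>\<^bsub>A\<^esub> c \<odot>\<^bsub>A\<^esub> y"
    "\<And>c d x. x \<in> carrier A \<Longrightarrow> (c * d) \<odot>\<^bsub>A\<^esub> x = c \<odot>\<^bsub>A\<^esub> (d \<odot>\<^bsub>A\<^esub> x)"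
    "\<And>x. x \<in> carrier A \<Longrightarrow> 1 \<odot>\<^bsub>A\<^esub> x = x"
    "\<And>x. x \<in> carrier A \<Longrightarrow> 0 \<odot>\<^bsub>A\<^esub> x = \<zero>\<^bsub>A\<^esub>"
    "\<And>c. c \<odot>\<^bsub>A\<^esub> \<zero>\<^bsub>A\<^esub> = \<zero>\<^bsub>A\<^esub>"
proof -
  interpret module scalars A by fact
  show "abelian_group A" ..
  show "x \<in> carrier A \<Longrightarrow> c \<odot>\<^bsub>A\<^esub> x \<in> carrier A" for c x by simp
  show "x \<in> carrier A \<Longrightarrow> (c + d) \<odot>\<^bsub>A\<^esub> x = c \<odot>\<^bsub>A\<^esub> x \<oplus>\<^bsub>A\<^esub> d \<odot>\<^bsub>A\<^esub> x" for c d x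
    using smult_l_distr[of c d x] by simp
  show "\<lbrakk>x \<in> carrier A; y \<in> carrier A\<rbrakk> \<Longrightarrow> c \<odot>\<^bsub>A\<^esub> (x \<oplus>\<^bsub>A\<^esub> y) = c \<odot>\<^bsub>A\<^esub> x \<oplus>\<^bsub>A\<^esub> c \<odot>\<^bsub>A\<^esub> y" for c x y
    using smult_r_distr[of c x y] by simp
  show "x \<in> carrier A \<Longrightarrow> (c * d) \<odot>\<^bsub>A\<^esub> x = c \<odot>\<^bsub>A\<^esub> (d \<odot>\<^bsub>A\<^esub> x)" for c d x
    using smult_assoc1[of c d x] by simp
  show "x \<in> carrier A \<Longrightarrow> 1 \<odot>\<^bsub>A\<^esub> x = x" for x
    using smult_one[of x] by simp
  show "x \<in> carrier A \<Longrightarrow> 0 \<odot>\<^bsub>A\<^esub> x = \<zero>\<^bsub>A\<^esub>" for x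
    using smult_l_null[of x] by simp
  show "c \<odot>\<^bsub>A\<^esub> \<zero>\<^bsub>A\<^esub> = \<zero>\<^bsub>A\<^esub>" for c
    using smult_r_null[of c] by simp
qed

lemma cring_scalars: "cring (scalars :: 'k::field ring)"
  using cring_from_type_algebra by blast

lemma module_scalarsI:
  fixes A :: "('k::field, 'a) module"
  assumes "abelian_group A"
    "\<And>c x. x \<in> carrier A \<Longrightarrow> c \<odot>\<^bsub>A\<^esub> x \<in> carrier A"
    "\<And>c d x. x \<in> carrier A \<Longrightarrow> (c + d) \<odot>\<^bsub>A\<^esub> x = c \<odot>\<^bsub>A\<^esub> x \<oplus>\<^bsub>A\<^esub> d \<odot>\<^bsub>A\<^esub> x"
    "\<And>c x y. \<lbrakk>x \<in> carrier A; y \<in> carrier A\<rbrakk> \<Longrightarrow> c \<odot>\<^bsub>A\<^esub> (x \<oplus>\<^bsub>A\<^esub> y) = c \<odot>\<^bsub>A\<^esub> x \<oplus>\<^bsub>A\<^esub> c \<odot>\<^bsub>A\<^esub> y"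
    "\<And>c d x. x \<in> carrier A \<Longrightarrow> (c * d) \<odot>\<^bsub>A\<^esub> x = c \<odot>\<^bsub>A\<^esub> (d \<odot>\<^bsub>A\<^esub> x)"
    "\<And>x. x \<in> carrier A \<Longrightarrow> 1 \<odot>\<^bsub>A\<^esub> x = x"
  shows "module scalars A"
  by (rule moduleI) (use assms cring_scalars in auto)

definition trivial_algebra :: "('k::field, 'a) module" where
  "trivial_algebra = \<lparr>carrier = {undefined}, mult = (\<lambda>_ _. undefined), one = undefined,
     zero = undefined, add = (\<lambda>_ _. undefined), smult = (\<lambda>_ _. undefined)\<rparr>"

lemma unital_trivial: "unital_algebra (trivial_algebra :: ('k::field, 'a) module)"
proof -
  have "ring (trivial_algebra :: ('k::field, 'a) module)"
    by (rule ringI[OF abelian_groupI monoidI]) (auto simp: trivial_algebra_def)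
  moreover from this have "module scalars (trivial_algebra :: ('k::field, 'a) module)"
    by (intro module_scalarsI) (auto simp: trivial_algebra_def ring_def)
  ultimately show ?thesis
    by (auto simp: unital_algebra_def trivial_algebra_def)
qed

definition algebra_or_trivial :: "('k::field, 'a) module \<Rightarrow> ('k, 'a) module" where
  "algebra_or_trivial A = (if unital_algebra A then A else trivial_algebra)"

lemma unital_algebra_or_trivial: "unital_algebra (algebra_or_trivial A)"
  by (simp add: algebra_or_trivial_def unital_trivial)

lemma algebra_or_trivial_eq: "unital_algebra A \<Longrightarrow> algebra_or_trivial A = A"
  by (simp add: algebra_or_trivial_def)

text \<open>In an algebra given by a record every calculation carries membership conditions and the
  automation for rings does not apply. Families that assign to \<^emph>\<open>every\<close> algebra on a given type an
  element of it form one typed ring with a scalar multiplication, in which noncommutative identities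
  are proved without side conditions. Evaluation at one algebra is a unital homomorphism onto it, with
  a section that is multiplicative but not unital. Records that are not algebras are assigned the
  trivial algebra so that the pointwise operations satisfy the ring axioms.\<close>

typedef (overloaded) ('k, 'a) family =
  "{f :: ('k::field, 'a) module \<Rightarrow> 'a. \<forall>A. f A \<in> carrier (algebra_or_trivial A)}"
  morphisms value_in Family
  by (rule exI[of _ "\<lambda>A. \<one>\<^bsub>algebra_or_trivial A\<^esub>"])
    (simp add: ring.ring_simprules(6) unital_algebraD(2) unital_algebra_or_trivial)

setup_lifting type_definition_family

lemmas aot_ring = unital_algebraD(2)[OF unital_algebra_or_trivial]
lemmas aot_module = unital_algebraD(1)[OF unital_algebra_or_trivial]

instantiation family :: (field, type) "{ring, monoid_mult}"
begin

lift_definition zero_family :: "('a, 'b) family" is "\<lambda>A. \<zero>\<^bsub>algebra_or_trivial A\<^esub>"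
  by (intro ring.ring_simprules aot_ring)
lift_definition one_family :: "('a, 'b) family" is "\<lambda>A. \<one>\<^bsub>algebra_or_trivial A\<^esub>"
  by (intro ring.ring_simprules aot_ring)
lift_definition plus_family :: "('a, 'b) family \<Rightarrow> ('a, 'b) family \<Rightarrow> ('a, 'b) family"
  is "\<lambda>f g A. f A \<oplus>\<^bsub>algebra_or_trivial A\<^esub> g A"
  by (intro ring.ring_simprules aot_ring) auto
lift_definition times_family :: "('a, 'b) family \<Rightarrow> ('a, 'b) family \<Rightarrow> ('a, 'b) family"
  is "\<lambda>f g A. f A \<otimes>\<^bsub>algebra_or_trivial A\<^esub> g A"
  by (intro ring.ring_simprules aot_ring) auto
lift_definition uminus_family :: "('a, 'b) family \<Rightarrow> ('a, 'b) family"
  is "\<lambda>f A. \<ominus>\<^bsub>algebra_or_trivial A\<^esub> f A"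
  by (intro ring.ring_simprules aot_ring) auto
lift_definition minus_family :: "('a, 'b) family \<Rightarrow> ('a, 'b) family \<Rightarrow> ('a, 'b) family"
  is "\<lambda>f g A. f A \<ominus>\<^bsub>algebra_or_trivial A\<^esub> g A"
  by (intro ring.ring_simprules aot_ring) auto

instance
proof
  fix a b c :: "('a, 'b) family"
  note r = ring.ring_simprules[OF aot_ring]
  show "a * b * c = a * (b * c)"
    by transfer (simp add: r(11))
  show "1 * a = a"
    by transfer (simp add: r(12))
  show "a * 1 = a"
    by transfer (simp add: monoid.r_one[OF ring.is_monoid[OF aot_ring]])
  show "a + b + c = a + (b + c)"
    by transfer (simp add: r(7))
  show "a + b = b + a"
    by transfer (simp add: r(10))
  show "0 + a = a"
    by transfer (simp add: r(8))
  show "- a + a = 0"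
    by transfer (simp add: r(9))
  show "a - b = a + - b"
    by transfer (simp add: a_minus_def)
  show "(a + b) * c = a * c + b * c"
    by transfer (simp add: r(13))
  show "a * (b + c) = a * b + a * c"
    by transfer (simp add: r(23))
qed

end

lift_definition scale :: "'k \<Rightarrow> ('k::field, 'a) family \<Rightarrow> ('k, 'a) family"
  is "\<lambda>c f A. c \<odot>\<^bsub>algebra_or_trivial A\<^esub> f A"
  by (intro module_scalarsD aot_module) auto

lemma scale_simps:
  "scale c (x + y) = scale c x + scale c y"
  "scale (c + d) x = scale c x + scale d x"
  "scale c (scale d x) = scale (c * d) x"
  "scale 1 x = x"
  "scale c x * y = scale c (x * y)"
  "x * scale c y = scale c (x * y)"
  by (transfer; auto intro!: ext unital_algebraD(3,4) unital_algebra_or_trivial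
     module_scalarsD aot_module module_scalarsD(5)[symmetric])+

interpretation scale: Modules.module scale
  by unfold_locales (simp_all add: scale_simps)

lift_definition value_at :: "('k, 'a) module \<Rightarrow> ('k::field, 'a) family \<Rightarrow> 'a" is "\<lambda>A f. f A" .

text \<open>The section is zero at all algebras other than \<open>A\<close>.\<close>

lift_definition emb :: "('k, 'a) module \<Rightarrow> 'a \<Rightarrow> ('k::field, 'a) family" is
  "\<lambda>A a B. if B = A \<and> a \<in> carrier (algebra_or_trivial A) then a else \<zero>\<^bsub>algebra_or_trivial B\<^esub>"
  by (auto intro: ring.ring_simprules aot_ring)

lemma value_at_simps:
  assumes "unital_algebra A"
  shows value_at_closed: "value_at A x \<in> carrier A"
    and value_at_zero: "value_at A 0 = \<zero>\<^bsub>A\<^esub>" and value_at_one: "value_at A 1 = \<one>\<^bsub>A\<^esub>"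
    and value_at_add: "value_at A (x + y) = value_at A x \<oplus>\<^bsub>A\<^esub> value_at A y"
    and value_at_mult: "value_at A (x * y) = value_at A x \<otimes>\<^bsub>A\<^esub> value_at A y"
    and value_at_uminus: "value_at A (- x) = \<ominus>\<^bsub>A\<^esub> value_at A x"
    and value_at_diff: "value_at A (x - y) = value_at A x \<ominus>\<^bsub>A\<^esub> value_at A y"
    and value_at_scale: "value_at A (scale c x) = c \<odot>\<^bsub>A\<^esub> value_at A x"
  by (transfer fixing: A; auto simp: algebra_or_trivial_eq[OF assms] dest: spec[of _ A])+

lemma value_at_emb: "unital_algebra A \<Longrightarrow> a \<in> carrier A \<Longrightarrow> value_at A (emb A a) = a"
  by (transfer fixing: A) (auto simp: algebra_or_trivial_eq)

lemma emb_simps: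
  assumes A: "unital_algebra A"
  shows emb_zero: "emb A \<zero>\<^bsub>A\<^esub> = 0"
    and emb_add: "\<lbrakk>x \<in> carrier A; y \<in> carrier A\<rbrakk> \<Longrightarrow> emb A (x \<oplus>\<^bsub>A\<^esub> y) = emb A x + emb A y"
    and emb_mult: "\<lbrakk>x \<in> carrier A; y \<in> carrier A\<rbrakk> \<Longrightarrow> emb A (x \<otimes>\<^bsub>A\<^esub> y) = emb A x * emb A y"
    and emb_uminus: "x \<in> carrier A \<Longrightarrow> emb A (\<ominus>\<^bsub>A\<^esub> x) = - emb A x"
    and emb_scale: "x \<in> carrier A \<Longrightarrow> emb A (c \<odot>\<^bsub>A\<^esub> x) = scale c (emb A x)"
proof -
  interpret ring A by (rule unital_algebraD[OF A])
  note r = ring.ring_simprules[OF aot_ring]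
  note [simp] = algebra_or_trivial_eq[OF A] module_scalarsD(2)[OF unital_algebraD(1)[OF A]]
    module_scalarsD(8)[OF aot_module] r(2,21) r(8,24)[OF r(2)]
  show "emb A \<zero>\<^bsub>A\<^esub> = 0" by (transfer fixing: A) (auto intro!: ext)
  show "\<lbrakk>x \<in> carrier A; y \<in> carrier A\<rbrakk> \<Longrightarrow> emb A (x \<oplus>\<^bsub>A\<^esub> y) = emb A x + emb A y"
    by (transfer fixing: A) (auto intro!: ext)
  show "\<lbrakk>x \<in> carrier A; y \<in> carrier A\<rbrakk> \<Longrightarrow> emb A (x \<otimes>\<^bsub>A\<^esub> y) = emb A x * emb A y"
    by (transfer fixing: A) (auto intro!: ext)
  show "x \<in> carrier A \<Longrightarrow> emb A (\<ominus>\<^bsub>A\<^esub> x) = - emb A x"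
    by (transfer fixing: A) (auto intro!: ext)
  show "x \<in> carrier A \<Longrightarrow> emb A (c \<odot>\<^bsub>A\<^esub> x) = scale c (emb A x)"
    by (transfer fixing: A) (auto intro!: ext)
qed

text \<open>The image of the section is the ideal generated by the central idempotent \<open>emb A \<one>\<^bsub>A\<^esub>\<close>. Hence an
  element that this idempotent fixes is determined by its value at \<open>A\<close>.\<close>

lemma emb_value_at:
  fixes A :: "('k::field, 'a) module"
  assumes A: "unital_algebra A"
  shows "emb A (value_at A x) = emb A \<one>\<^bsub>A\<^esub> * x" "emb A (value_at A x) = x * emb A \<one>\<^bsub>A\<^esub>"
proof -
  interpret ring A by (rule unital_algebraD[OF A])
  note r = ring.ring_simprules[OF aot_ring]
  note [simp] = algebra_or_trivial_eq[OF A] r(2,6)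
  have n: "\<zero>\<^bsub>algebra_or_trivial B\<^esub> \<otimes>\<^bsub>algebra_or_trivial B\<^esub> y = \<zero>\<^bsub>algebra_or_trivial B\<^esub>"
    "y \<otimes>\<^bsub>algebra_or_trivial B\<^esub> \<zero>\<^bsub>algebra_or_trivial B\<^esub> = \<zero>\<^bsub>algebra_or_trivial B\<^esub>"
    if "y \<in> carrier (algebra_or_trivial B)" for y and B :: "('k, 'a) module"
    using that by (simp_all add: r(24,25))
  have c: "f A \<in> carrier A" if "\<forall>B. f B \<in> carrier (algebra_or_trivial B)" for f
    using that[rule_format, of A] by simp
  show "emb A (value_at A x) = emb A \<one>\<^bsub>A\<^esub> * x"
    by (transfer fixing: A) (auto intro!: ext simp: n c)
  show "emb A (value_at A x) = x * emb A \<one>\<^bsub>A\<^esub>"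
    by (transfer fixing: A) (auto intro!: ext simp: n c)
qed

lemma value_at_sum:
  assumes "unital_algebra A" "finite S"
  shows "value_at A (\<Sum>s\<in>S. f s) = (\<Oplus>\<^bsub>A\<^esub>s\<in>S. value_at A (f s))"
proof -
  interpret ring A by (rule unital_algebraD[OF assms(1)])
  show ?thesis using assms(2)
    by induction (auto simp: value_at_simps[OF assms(1)])
qed

section \<open>Finitely supported functions\<close>

lemma poly_mapping_sum_single: "f = (\<Sum>u\<in>Poly_Mapping.keys f. Poly_Mapping.single u (Poly_Mapping.lookup f u))"
  by (rule poly_mapping_eqI) (simp add: lookup_sum lookup_single when_def in_keys_iff)

lemma poly_mapping_single_induct [consumes 1, case_names zero single add]:
  fixes f :: "'a \<Rightarrow>\<^sub>0 'b::comm_monoid_add"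
  assumes keys: "Poly_Mapping.keys f \<subseteq> S"
    and "P 0" "\<And>u c. u \<in> S \<Longrightarrow> P (Poly_Mapping.single u c)"
    and "\<And>f g. \<lbrakk>Poly_Mapping.keys f \<subseteq> S; Poly_Mapping.keys g \<subseteq> S; P f; P g\<rbrakk> \<Longrightarrow> P (f + g)"
  shows "P f"
proof -
  have "P (\<Sum>u\<in>K. Poly_Mapping.single u (c u)) \<and>
      Poly_Mapping.keys (\<Sum>u\<in>K. Poly_Mapping.single u (c u)) \<subseteq> S" if "finite K" "K \<subseteq> S" for K c
    using that
  proof (induction K)
    case (insert u K)
    have "Poly_Mapping.keys (Poly_Mapping.single u (c u)) \<subseteq> S"
      using insert.prems by simp
    then show ?case using insert assms(3)[of u "c u"] keys_add[of "Poly_Mapping.single u (c u)"]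
      by (auto intro!: assms(4))
  qed (simp add: assms)
  then show ?thesis using keys poly_mapping_sum_single[of f] by (metis finite_keys)
qed

lemma pm_scale_simps:
  fixes f g :: "'a \<Rightarrow>\<^sub>0 'k::field"
  shows "Poly_Mapping.lookup (Poly_Mapping.map ((*) c) f) u = c * Poly_Mapping.lookup f u"
    "Poly_Mapping.keys (Poly_Mapping.map ((*) c) f) \<subseteq> Poly_Mapping.keys f"
    "Poly_Mapping.map ((*) c) (f + g) = Poly_Mapping.map ((*) c) f + Poly_Mapping.map ((*) c) g"
    "Poly_Mapping.map ((*) (c + d)) f = Poly_Mapping.map ((*) c) f + Poly_Mapping.map ((*) d) f"
    "Poly_Mapping.map ((*) (c * d)) f = Poly_Mapping.map ((*) c) (Poly_Mapping.map ((*) d) f)"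
    "Poly_Mapping.map ((*) 1) f = f"
    "Poly_Mapping.map ((*) c) 0 = (0 :: 'a \<Rightarrow>\<^sub>0 'k)"
    "Poly_Mapping.map ((*) c) (Poly_Mapping.single u d) = Poly_Mapping.single u (c * d)"
    "Poly_Mapping.map ((*) (- 1)) f = - f"
proof -
  have l: "Poly_Mapping.lookup (Poly_Mapping.map ((*) c) f) u = c * Poly_Mapping.lookup f u"
    for c and f :: "'a \<Rightarrow>\<^sub>0 'k" and u
    by (simp add: Poly_Mapping.map.rep_eq when_def)
  note [simp] = l lookup_add
  show "Poly_Mapping.lookup (Poly_Mapping.map ((*) c) f) u = c * Poly_Mapping.lookup f u" by simp
  show "Poly_Mapping.keys (Poly_Mapping.map ((*) c) f) \<subseteq> Poly_Mapping.keys f"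
    by (auto simp: in_keys_iff)
  show "Poly_Mapping.map ((*) c) (f + g) = Poly_Mapping.map ((*) c) f + Poly_Mapping.map ((*) c) g"
    "Poly_Mapping.map ((*) (c + d)) f = Poly_Mapping.map ((*) c) f + Poly_Mapping.map ((*) d) f"
    "Poly_Mapping.map ((*) (c * d)) f = Poly_Mapping.map ((*) c) (Poly_Mapping.map ((*) d) f)"
    "Poly_Mapping.map ((*) 1) f = f"
    "Poly_Mapping.map ((*) c) 0 = (0 :: 'a \<Rightarrow>\<^sub>0 'k)"
    "Poly_Mapping.map ((*) (- 1)) f = - f"
    by (rule poly_mapping_eqI; simp add: algebra_simps)+
  show "Poly_Mapping.map ((*) c) (Poly_Mapping.single u d) = Poly_Mapping.single u (c * d)"
    by (rule poly_mapping_eqI) (simp add: lookup_single when_def)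
qed

text \<open>The extension of a map on basis vectors to their combinations. The coefficient is an argument of
  the map, so that no scalar multiplication on the target is presupposed.\<close>

definition lin_ext :: "('a \<Rightarrow> 'b::zero \<Rightarrow> 'c::comm_monoid_add) \<Rightarrow> ('a \<Rightarrow>\<^sub>0 'b) \<Rightarrow> 'c" where
  "lin_ext h f = (\<Sum>u\<in>Poly_Mapping.keys f. h u (Poly_Mapping.lookup f u))"

lemma lin_ext_add:
  assumes "\<And>u. h u 0 = 0" "\<And>u a b. h u (a + b) = h u a + h u b"
  shows "lin_ext h (f + g) = lin_ext h f + lin_ext h g"
  unfolding lin_ext_def by (rule setsum_keys_plus_distrib) (use assms in auto)

lemma lin_ext_single:
  assumes "h u 0 = 0"
  shows "lin_ext h (Poly_Mapping.single u a) = h u a"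
  using assms by (simp add: lin_ext_def)

lemma lin_ext_zero [simp]: "lin_ext h 0 = 0"
  by (simp add: lin_ext_def)

lemma lin_ext_map:
  fixes f :: "'a \<Rightarrow>\<^sub>0 'k::field"
  assumes "\<And>u. h u 0 = 0"
  shows "lin_ext h (Poly_Mapping.map ((*) c) f) = lin_ext (\<lambda>u a. h u (c * a)) f"
  unfolding lin_ext_def
  by (rule sum.mono_neutral_cong_left) (auto simp: pm_scale_simps assms in_keys_iff)

section \<open>Monoid algebras\<close>

lemma monoid_algebra_simps [simp]:
  "carrier (monoid_algebra M) = {f. Poly_Mapping.keys f \<subseteq> carrier M}"
  "\<one>\<^bsub>monoid_algebra M\<^esub> = Poly_Mapping.single \<one>\<^bsub>M\<^esub> 1"
  "\<zero>\<^bsub>monoid_algebra M\<^esub> = 0"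
  "f \<oplus>\<^bsub>monoid_algebra M\<^esub> g = f + g"
  "c \<odot>\<^bsub>monoid_algebra M\<^esub> f = Poly_Mapping.map ((*) c) f"
  by (simp_all add: monoid_algebra_def)

lemma monoid_algebra_mult:
  "f \<otimes>\<^bsub>monoid_algebra M\<^esub> g =
     lin_ext (\<lambda>u a. lin_ext (\<lambda>v b. Poly_Mapping.single (u \<otimes>\<^bsub>M\<^esub> v) (a * b)) g) f"
  by (simp add: monoid_algebra_def lin_ext_def)

lemma pm_scale_sum:
  "Poly_Mapping.map ((*) (c :: 'k::field)) (sum H S) = (\<Sum>s\<in>S. Poly_Mapping.map ((*) c) (H s))"
  by (induction S rule: infinite_finite_induct) (auto simp: pm_scale_simps)

lemma monoid_algebra_mult_simps:
  fixes f g h :: "'a \<Rightarrow>\<^sub>0 'k::field"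
  shows
  "(f + g) \<otimes>\<^bsub>monoid_algebra M\<^esub> h = f \<otimes>\<^bsub>monoid_algebra M\<^esub> h + g \<otimes>\<^bsub>monoid_algebra M\<^esub> h"
  "h \<otimes>\<^bsub>monoid_algebra M\<^esub> (f + g) = h \<otimes>\<^bsub>monoid_algebra M\<^esub> f + h \<otimes>\<^bsub>monoid_algebra M\<^esub> g"
  "0 \<otimes>\<^bsub>monoid_algebra M\<^esub> h = 0"
  "h \<otimes>\<^bsub>monoid_algebra M\<^esub> 0 = 0"
  "Poly_Mapping.single u a \<otimes>\<^bsub>monoid_algebra M\<^esub> Poly_Mapping.single v b = Poly_Mapping.single (u \<otimes>\<^bsub>M\<^esub> v) (a * b)"
  "Poly_Mapping.map ((*) c) f \<otimes>\<^bsub>monoid_algebra M\<^esub> h = Poly_Mapping.map ((*) c) (f \<otimes>\<^bsub>monoid_algebra M\<^esub> h)"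
  "f \<otimes>\<^bsub>monoid_algebra M\<^esub> Poly_Mapping.map ((*) c) h = Poly_Mapping.map ((*) c) (f \<otimes>\<^bsub>monoid_algebra M\<^esub> h)"
proof -
  show "(f + g) \<otimes>\<^bsub>monoid_algebra M\<^esub> h = f \<otimes>\<^bsub>monoid_algebra M\<^esub> h + g \<otimes>\<^bsub>monoid_algebra M\<^esub> h"
    unfolding monoid_algebra_mult
    by (rule lin_ext_add) (simp_all add: lin_ext_def single_add ring_distribs sum.distrib)
  show "h \<otimes>\<^bsub>monoid_algebra M\<^esub> (f + g) = h \<otimes>\<^bsub>monoid_algebra M\<^esub> f + h \<otimes>\<^bsub>monoid_algebra M\<^esub> g"
    unfolding monoid_algebra_mult
    by (subst lin_ext_add) (simp_all add: lin_ext_def single_add ring_distribs sum.distrib)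
  show "0 \<otimes>\<^bsub>monoid_algebra M\<^esub> h = 0" "h \<otimes>\<^bsub>monoid_algebra M\<^esub> 0 = 0"
    by (simp_all add: monoid_algebra_mult lin_ext_def)
  show "Poly_Mapping.single u a \<otimes>\<^bsub>monoid_algebra M\<^esub> Poly_Mapping.single v b = Poly_Mapping.single (u \<otimes>\<^bsub>M\<^esub> v) (a * b)"
    by (simp add: monoid_algebra_mult lin_ext_def)
  show "Poly_Mapping.map ((*) c) f \<otimes>\<^bsub>monoid_algebra M\<^esub> h = Poly_Mapping.map ((*) c) (f \<otimes>\<^bsub>monoid_algebra M\<^esub> h)"
    unfolding monoid_algebra_mult
    by (subst lin_ext_map) (simp_all add: lin_ext_def pm_scale_sum pm_scale_simps mult.assoc)
  show "f \<otimes>\<^bsub>monoid_algebra M\<^esub> Poly_Mapping.map ((*) c) h = Poly_Mapping.map ((*) c) (f \<otimes>\<^bsub>monoid_algebra M\<^esub> h)"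
    unfolding monoid_algebra_mult
    by (subst lin_ext_map) (simp_all add: lin_ext_def pm_scale_sum pm_scale_simps mult.left_commute)
qed

lemma monoid_algebra_mult_closed:
  assumes "monoid M" "Poly_Mapping.keys f \<subseteq> carrier M" "Poly_Mapping.keys g \<subseteq> carrier M"
  shows "Poly_Mapping.keys (f \<otimes>\<^bsub>monoid_algebra M\<^esub> g) \<subseteq> carrier M"
  using assms(2)
proof (induction rule: poly_mapping_single_induct)
  case (single u c)
  show ?case using assms(3)
  proof (induction rule: poly_mapping_single_induct)
    case (single v d)
    then show ?case using \<open>u \<in> carrier M\<close> assms(1)
      by (simp add: monoid_algebra_mult_simps monoid.m_closed)
  next
    case (add f g) then show ?case
      by (simp add: monoid_algebra_mult_simps) (meson keys_add order.trans Un_least)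
  qed (simp add: monoid_algebra_mult_simps)
next
  case (add f g) then show ?case
    by (simp add: monoid_algebra_mult_simps) (meson keys_add order.trans Un_least)
qed (simp add: monoid_algebra_mult_simps)

lemma monoid_algebra_assoc:
  assumes "monoid M" "Poly_Mapping.keys f \<subseteq> carrier M" "Poly_Mapping.keys g \<subseteq> carrier M"
    "Poly_Mapping.keys h \<subseteq> carrier M"
  shows "(f \<otimes>\<^bsub>monoid_algebra M\<^esub> g) \<otimes>\<^bsub>monoid_algebra M\<^esub> h = f \<otimes>\<^bsub>monoid_algebra M\<^esub> (g \<otimes>\<^bsub>monoid_algebra M\<^esub> h)"
  using assms(2)
proof (induction rule: poly_mapping_single_induct)
  case (single u c)
  show ?case using assms(3)
  proof (induction rule: poly_mapping_single_induct)
    case (single v d)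
    show ?case using assms(4)
      by (induction rule: poly_mapping_single_induct)
        (use \<open>u \<in> carrier M\<close> \<open>v \<in> carrier M\<close> assms(1) in
          \<open>simp_all add: monoid_algebra_mult_simps monoid.m_assoc mult.assoc\<close>)
  qed (simp_all add: monoid_algebra_mult_simps)
qed (simp_all add: monoid_algebra_mult_simps)

lemma monoid_algebra_unit:
  assumes "monoid M" "Poly_Mapping.keys f \<subseteq> carrier M"
  shows "Poly_Mapping.single \<one>\<^bsub>M\<^esub> 1 \<otimes>\<^bsub>monoid_algebra M\<^esub> f = f"
    "f \<otimes>\<^bsub>monoid_algebra M\<^esub> Poly_Mapping.single \<one>\<^bsub>M\<^esub> 1 = f"
  using assms(2)
  by (induction rule: poly_mapping_single_induct)
    (simp_all add: monoid_algebra_mult_simps monoid.l_one[OF assms(1)] monoid.r_one[OF assms(1)])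

lemma keys_uminus_field: "Poly_Mapping.keys (- f) = Poly_Mapping.keys (f :: 'a \<Rightarrow>\<^sub>0 'k::field)"
  by (auto simp: in_keys_iff)

lemma unital_monoid_algebra:
  fixes M :: "('a, 'z) monoid_scheme"
  assumes "monoid M"
  shows "unital_algebra (monoid_algebra M :: ('k::field, 'a \<Rightarrow>\<^sub>0 'k) module)"
proof -
  have ab: "abelian_group (monoid_algebra M :: ('k::field, 'a \<Rightarrow>\<^sub>0 'k) module)"
  proof (rule abelian_groupI)
    fix f g :: "'a \<Rightarrow>\<^sub>0 'k"
    assume "f \<in> carrier (monoid_algebra M)" "g \<in> carrier (monoid_algebra M)"
    then show "f \<oplus>\<^bsub>monoid_algebra M\<^esub> g \<in> carrier (monoid_algebra M)"
      using keys_add[of f g] by auto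
  next
    fix f :: "'a \<Rightarrow>\<^sub>0 'k"
    assume "f \<in> carrier (monoid_algebra M)"
    then show "\<exists>g\<in>carrier (monoid_algebra M). g \<oplus>\<^bsub>monoid_algebra M\<^esub> f = \<zero>\<^bsub>monoid_algebra M\<^esub>"
      by (intro bexI[of _ "- f"]) (auto simp: keys_uminus_field)
  qed (auto simp: add_ac)
  have mon: "Group.monoid (monoid_algebra M :: ('k::field, 'a \<Rightarrow>\<^sub>0 'k) module)"
    by (rule monoidI)
      (use monoid_algebra_mult_closed[OF assms] in \<open>simp_all add: monoid.one_closed[OF assms] monoid_algebra_unit[OF assms] monoid_algebra_assoc[OF assms]\<close>)
  have "ring (monoid_algebra M :: ('k::field, 'a \<Rightarrow>\<^sub>0 'k) module)"
    by (rule ringI[OF ab mon]) (simp_all add: monoid_algebra_mult_simps)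
  moreover have "Module.module scalars (monoid_algebra M :: ('k::field, 'a \<Rightarrow>\<^sub>0 'k) module)"
    by (rule module_scalarsI[OF ab])
      (simp_all add: pm_scale_simps(3-) order.trans[OF pm_scale_simps(2)])
  ultimately show ?thesis by (simp add: unital_algebra_def monoid_algebra_mult_simps)
qed

lemma monoid_algebra_uminus:
  assumes "monoid M" "f \<in> carrier (monoid_algebra M)"
  shows "\<ominus>\<^bsub>monoid_algebra M\<^esub> f = - (f :: 'a \<Rightarrow>\<^sub>0 'k::field)"
proof -
  interpret ring "monoid_algebra M :: ('k, 'a \<Rightarrow>\<^sub>0 'k) module"
    by (rule unital_algebraD unital_monoid_algebra assms)+
  show ?thesis
    by (rule minus_equality) (use assms(2) in \<open>auto simp: keys_uminus_field\<close>)
qed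

section \<open>Quotients\<close>

text \<open>With this, the axioms for a quotient need no calculation with cosets.\<close>

lemma unital_algebra_image:
  assumes A: "unital_algebra A" and surj: "\<pi> ` carrier A = carrier B"
    and "\<pi> \<zero>\<^bsub>A\<^esub> = \<zero>\<^bsub>B\<^esub>" "\<pi> \<one>\<^bsub>A\<^esub> = \<one>\<^bsub>B\<^esub>"
    and "\<And>x y. \<lbrakk>x \<in> carrier A; y \<in> carrier A\<rbrakk> \<Longrightarrow> \<pi> x \<oplus>\<^bsub>B\<^esub> \<pi> y = \<pi> (x \<oplus>\<^bsub>A\<^esub> y)"
    and "\<And>x y. \<lbrakk>x \<in> carrier A; y \<in> carrier A\<rbrakk> \<Longrightarrow> \<pi> x \<otimes>\<^bsub>B\<^esub> \<pi> y = \<pi> (x \<otimes>\<^bsub>A\<^esub> y)"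
    and "\<And>c x. x \<in> carrier A \<Longrightarrow> c \<odot>\<^bsub>B\<^esub> \<pi> x = \<pi> (c \<odot>\<^bsub>A\<^esub> x)"
  shows "unital_algebra B"
proof -
  interpret A: ring A by (rule unital_algebraD[OF A])
  note m = module_scalarsD[OF unital_algebraD(1)[OF A]]
  note [simp] = assms(5-7) assms(3,4)[symmetric] surj[symmetric] m(2)
  have ab: "abelian_group B"
  proof (rule abelian_groupI)
    fix y assume "y \<in> carrier B"
    then obtain x where "x \<in> carrier A" "y = \<pi> x" by auto
    then show "\<exists>z\<in>carrier B. z \<oplus>\<^bsub>B\<^esub> y = \<zero>\<^bsub>B\<^esub>"
      by (intro bexI[of _ "\<pi> (\<ominus>\<^bsub>A\<^esub> x)"]) (simp_all add: A.l_neg)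
  qed (auto simp: A.a_ac)
  have mon: "Group.monoid B"
    by (rule monoidI) (auto simp: A.m_assoc)
  have "ring B"
    by (rule ringI[OF ab mon]) (auto simp: A.l_distr A.r_distr)
  moreover have "Module.module scalars B"
    by (rule module_scalarsI[OF ab]) (auto simp: m)
  ultimately show ?thesis
    by (auto simp: unital_algebra_def unital_algebraD[OF A])
qed

lemma quotient_algebra_simps:
  assumes "ideal I A"
  shows "carrier (quotient_algebra A I) = (\<lambda>x. I +>\<^bsub>A\<^esub> x) ` carrier A"
    "\<one>\<^bsub>quotient_algebra A I\<^esub> = I +>\<^bsub>A\<^esub> \<one>\<^bsub>A\<^esub>"
    "\<zero>\<^bsub>quotient_algebra A I\<^esub> = I +>\<^bsub>A\<^esub> \<zero>\<^bsub>A\<^esub>"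
    "\<lbrakk>x \<in> carrier A; y \<in> carrier A\<rbrakk> \<Longrightarrow> (I +>\<^bsub>A\<^esub> x) \<oplus>\<^bsub>quotient_algebra A I\<^esub> (I +>\<^bsub>A\<^esub> y) = I +>\<^bsub>A\<^esub> (x \<oplus>\<^bsub>A\<^esub> y)"
    "\<lbrakk>x \<in> carrier A; y \<in> carrier A\<rbrakk> \<Longrightarrow> (I +>\<^bsub>A\<^esub> x) \<otimes>\<^bsub>quotient_algebra A I\<^esub> (I +>\<^bsub>A\<^esub> y) = I +>\<^bsub>A\<^esub> (x \<otimes>\<^bsub>A\<^esub> y)"
proof -
  interpret ideal I A by fact
  show "carrier (quotient_algebra A I) = (\<lambda>x. I +>\<^bsub>A\<^esub> x) ` carrier A"
    by (auto simp: quotient_algebra_def FactRing_simps)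
  show "\<one>\<^bsub>quotient_algebra A I\<^esub> = I +>\<^bsub>A\<^esub> \<one>\<^bsub>A\<^esub>"
    by (simp add: quotient_algebra_def FactRing_def)
  show "\<zero>\<^bsub>quotient_algebra A I\<^esub> = I +>\<^bsub>A\<^esub> \<zero>\<^bsub>A\<^esub>"
    using a_coset_add_zero[OF a_subset] by (simp add: quotient_algebra_def FactRing_def)
  show "\<lbrakk>x \<in> carrier A; y \<in> carrier A\<rbrakk> \<Longrightarrow> (I +>\<^bsub>A\<^esub> x) \<oplus>\<^bsub>quotient_algebra A I\<^esub> (I +>\<^bsub>A\<^esub> y) = I +>\<^bsub>A\<^esub> (x \<oplus>\<^bsub>A\<^esub> y)"
    by (simp add: quotient_algebra_def FactRing_def a_rcos_sum)
  show "\<lbrakk>x \<in> carrier A; y \<in> carrier A\<rbrakk> \<Longrightarrow> (I +>\<^bsub>A\<^esub> x) \<otimes>\<^bsub>quotient_algebra A I\<^esub> (I +>\<^bsub>A\<^esub> y) = I +>\<^bsub>A\<^esub> (x \<otimes>\<^bsub>A\<^esub> y)"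
    by (simp add: quotient_algebra_def FactRing_def rcoset_mult_add)
qed

lemma ideal_smult_closed:
  assumes A: "unital_algebra A" and I: "ideal I A" and x: "x \<in> I"
  shows "c \<odot>\<^bsub>A\<^esub> x \<in> I"
proof -
  interpret ideal I A by fact
  have x': "x \<in> carrier A" using x a_subset by blast
  have "c \<odot>\<^bsub>A\<^esub> x = (c \<odot>\<^bsub>A\<^esub> \<one>\<^bsub>A\<^esub>) \<otimes>\<^bsub>A\<^esub> x"
    using unital_algebraD(3)[OF A one_closed x', of c] x' by simp
  then show ?thesis
    using I_l_closed[OF x] module_scalarsD(2)[OF unital_algebraD(1)[OF A]] by simp
qed

lemma quotient_eq_iff:
  assumes "ideal I A" "x \<in> carrier A" "y \<in> carrier A"
  shows "I +>\<^bsub>A\<^esub> x = I +>\<^bsub>A\<^esub> y \<longleftrightarrow> x \<ominus>\<^bsub>A\<^esub> y \<in> I"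
  using ring.quotient_eq_iff_same_a_r_cos[OF ideal.axioms(2)[OF assms(1)] assms] by blast

text \<open>The scalar multiplication of the quotient is a union over representatives; all of them give the
  same coset because an ideal of a unital algebra is a subspace.\<close>

lemma quotient_algebra_smult:
  assumes A: "unital_algebra A" and I: "ideal I A" and x: "x \<in> carrier A"
  shows "c \<odot>\<^bsub>quotient_algebra A I\<^esub> (I +>\<^bsub>A\<^esub> x) = I +>\<^bsub>A\<^esub> (c \<odot>\<^bsub>A\<^esub> x)"
proof -
  interpret ideal I A by fact
  note m = module_scalarsD[OF unital_algebraD(1)[OF A]]
  have "I +>\<^bsub>A\<^esub> (c \<odot>\<^bsub>A\<^esub> y) = I +>\<^bsub>A\<^esub> (c \<odot>\<^bsub>A\<^esub> x)" if y: "y \<in> I +>\<^bsub>A\<^esub> x" for y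
  proof -
    obtain h where h: "h \<in> I" "y = h \<oplus>\<^bsub>A\<^esub> x"
      using y by (auto simp: a_r_coset_def')
    have h': "h \<in> carrier A" using h a_subset by blast
    have "c \<odot>\<^bsub>A\<^esub> y \<ominus>\<^bsub>A\<^esub> c \<odot>\<^bsub>A\<^esub> x = c \<odot>\<^bsub>A\<^esub> h"
      using h h' x m(2)[of _ c] by (simp add: m(4) minus_eq a_assoc r_neg)
    then show ?thesis
      using quotient_eq_iff[OF I, of "c \<odot>\<^bsub>A\<^esub> y" "c \<odot>\<^bsub>A\<^esub> x"] h h' x ideal_smult_closed[OF A I]
      by (simp add: m(2))
  qed
  then have "(\<Union>y\<in>I +>\<^bsub>A\<^esub> x. I +>\<^bsub>A\<^esub> (c \<odot>\<^bsub>A\<^esub> y)) = I +>\<^bsub>A\<^esub> (c \<odot>\<^bsub>A\<^esub> x)"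
    by (intro UN_constant_eq[OF a_rcos_self[OF x]]) blast
  then show ?thesis by (simp add: quotient_algebra_def)
qed

lemma unital_quotient_algebra:
  assumes A: "unital_algebra A" and I: "ideal I A"
  shows "unital_algebra (quotient_algebra A I)"
  by (rule unital_algebra_image[OF A, where \<pi> = "\<lambda>x. I +>\<^bsub>A\<^esub> x"])
    (simp_all add: quotient_algebra_simps[OF I] quotient_algebra_smult[OF A I])

section \<open>Tensor products\<close>

lemma module_uminus:
  assumes "Module.module scalars A" "x \<in> carrier A"
  shows "\<ominus>\<^bsub>A\<^esub> x = (- 1) \<odot>\<^bsub>A\<^esub> x"
proof -
  interpret module scalars A by fact
  show ?thesis
  proof (rule M.minus_equality)
    have "(- 1) \<odot>\<^bsub>A\<^esub> x \<oplus>\<^bsub>A\<^esub> 1 \<odot>\<^bsub>A\<^esub> x = (- 1 + 1) \<odot>\<^bsub>A\<^esub> x"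
      by (rule module_scalarsD(3)[symmetric]) (use assms in auto)
    then show "(- 1) \<odot>\<^bsub>A\<^esub> x \<oplus>\<^bsub>A\<^esub> x = \<zero>\<^bsub>A\<^esub>"
      using assms by (simp add: module_scalarsD)
  qed (use assms in \<open>auto simp: module_scalarsD\<close>)
qed

lemma submodule_scalarsI:
  assumes A: "Module.module scalars A" and "H \<subseteq> carrier A" "\<zero>\<^bsub>A\<^esub> \<in> H"
    "\<And>x y. \<lbrakk>x \<in> H; y \<in> H\<rbrakk> \<Longrightarrow> x \<oplus>\<^bsub>A\<^esub> y \<in> H" "\<And>c x. x \<in> H \<Longrightarrow> c \<odot>\<^bsub>A\<^esub> x \<in> H"
  shows "submodule H scalars A"
proof -
  interpret module scalars A by fact
  show ?thesis
    by (rule submoduleI) (use assms in \<open>auto simp: module_uminus[OF A] subsetD\<close>)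
qed

lemma submodule_scalarsD:
  assumes A: "Module.module scalars A" and H: "submodule H scalars A"
  shows "H \<subseteq> carrier A" "\<zero>\<^bsub>A\<^esub> \<in> H" "\<lbrakk>x \<in> H; y \<in> H\<rbrakk> \<Longrightarrow> x \<oplus>\<^bsub>A\<^esub> y \<in> H" "x \<in> H \<Longrightarrow> c \<odot>\<^bsub>A\<^esub> x \<in> H"
proof -
  interpret module scalars A by fact
  note s = submoduleE[OF H]
  show 1: "H \<subseteq> carrier A" "\<lbrakk>x \<in> H; y \<in> H\<rbrakk> \<Longrightarrow> x \<oplus>\<^bsub>A\<^esub> y \<in> H" "x \<in> H \<Longrightarrow> c \<odot>\<^bsub>A\<^esub> x \<in> H"
    using s by auto
  obtain x where "x \<in> H" using s(2) by auto
  then have "(0 :: 'a) \<odot>\<^bsub>A\<^esub> x \<in> H" "x \<in> carrier A" using s(4)[of 0 x] s(1) by auto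
  then show "\<zero>\<^bsub>A\<^esub> \<in> H" by (simp add: module_scalarsD[OF A])
qed

lemma submodule_span_submodule:
  assumes A: "Module.module scalars A" and S: "S \<subseteq> carrier A"
  shows "submodule (submodule_span A S) scalars A"
proof -
  have c: "submodule (carrier A) scalars A"
    by (rule module.carrier_is_submodule[OF A])
  note d = submodule_scalarsD[OF A]
  show ?thesis
    unfolding submodule_span_def
  proof (rule submodule_scalarsI[OF A])
    show "\<Inter> {H. submodule H scalars A \<and> S \<subseteq> H} \<subseteq> carrier A"
      using c S by (intro Inter_lower) simp
  qed (simp_all add: d)
qed

lemma submodule_span_superset: "S \<subseteq> submodule_span A S"
  unfolding submodule_span_def by blast

lemma submodule_span_induct [consumes 3, case_names base zero add smult]:
  assumes A: "Module.module scalars A" and S: "S \<subseteq> carrier A" and x: "x \<in> submodule_span A S"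
    and base: "\<And>x. x \<in> S \<Longrightarrow> P x" and P_zero: "P \<zero>\<^bsub>A\<^esub>"
    and P_add: "\<And>x y. \<lbrakk>x \<in> carrier A; y \<in> carrier A; P x; P y\<rbrakk> \<Longrightarrow> P (x \<oplus>\<^bsub>A\<^esub> y)"
    and P_smult: "\<And>c x. \<lbrakk>x \<in> carrier A; P x\<rbrakk> \<Longrightarrow> P (c \<odot>\<^bsub>A\<^esub> x)"
  shows "P x"
proof -
  interpret module scalars A by fact
  have "submodule {x \<in> carrier A. P x} scalars A"
    by (rule submodule_scalarsI[OF A]) (use P_zero P_add P_smult in \<open>auto simp: module_scalarsD[OF A]\<close>)
  moreover have "S \<subseteq> {x \<in> carrier A. P x}" using S base by blast
  ultimately show ?thesis using x unfolding submodule_span_def by blast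
qed

lemma monoid_algebra_mult_diff:
  fixes f g h :: "'a \<Rightarrow>\<^sub>0 'k::field"
  shows "(f - g) \<otimes>\<^bsub>monoid_algebra M\<^esub> h = f \<otimes>\<^bsub>monoid_algebra M\<^esub> h - g \<otimes>\<^bsub>monoid_algebra M\<^esub> h"
    "h \<otimes>\<^bsub>monoid_algebra M\<^esub> (f - g) = h \<otimes>\<^bsub>monoid_algebra M\<^esub> f - h \<otimes>\<^bsub>monoid_algebra M\<^esub> g"
  using monoid_algebra_mult_simps(1)[of M "f - g" g h] monoid_algebra_mult_simps(2)[of M h "f - g" g]
  by (auto simp: algebra_simps)

lemma pm_scale_diff: "Poly_Mapping.map ((*) (c :: 'k::field)) (f - g) = Poly_Mapping.map ((*) c) f - Poly_Mapping.map ((*) c) g"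
  using pm_scale_simps(3)[of c "f - g" g] by (auto simp: algebra_simps)

lemma keys_diff_field: "Poly_Mapping.keys (f - g :: 'a \<Rightarrow>\<^sub>0 'k::field) \<subseteq> Poly_Mapping.keys f \<union> Poly_Mapping.keys g"
  by (auto simp: in_keys_iff lookup_minus)

lemma keys_diff3:
  assumes "Poly_Mapping.keys f \<subseteq> S" "Poly_Mapping.keys g \<subseteq> S"
  shows "Poly_Mapping.keys (f - g :: 'a \<Rightarrow>\<^sub>0 'k::field) \<subseteq> S"
  using assms keys_diff_field[of f g] by blast

definition bilinear_map ::
  "('k::field, 'a) module \<Rightarrow> ('k, 'b) module \<Rightarrow> ('k, 'c) module \<Rightarrow> ('a \<Rightarrow> 'b \<Rightarrow> 'c) \<Rightarrow> bool" where
  "bilinear_map A B C \<beta> \<longleftrightarrow>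
     (\<forall>a\<in>carrier A. \<forall>b\<in>carrier B. \<beta> a b \<in> carrier C) \<and>
     (\<forall>a\<in>carrier A. \<forall>a'\<in>carrier A. \<forall>b\<in>carrier B. \<beta> (a \<oplus>\<^bsub>A\<^esub> a') b = \<beta> a b \<oplus>\<^bsub>C\<^esub> \<beta> a' b) \<and>
     (\<forall>a\<in>carrier A. \<forall>b\<in>carrier B. \<forall>b'\<in>carrier B. \<beta> a (b \<oplus>\<^bsub>B\<^esub> b') = \<beta> a b \<oplus>\<^bsub>C\<^esub> \<beta> a b') \<and>
     (\<forall>c. \<forall>a\<in>carrier A. \<forall>b\<in>carrier B. \<beta> (c \<odot>\<^bsub>A\<^esub> a) b = c \<odot>\<^bsub>C\<^esub> \<beta> a b) \<and>
     (\<forall>c. \<forall>a\<in>carrier A. \<forall>b\<in>carrier B. \<beta> a (c \<odot>\<^bsub>B\<^esub> b) = c \<odot>\<^bsub>C\<^esub> \<beta> a b)"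

lemma linear_mapsD:
  assumes "f \<in> linear_maps A B"
  shows "x \<in> carrier A \<Longrightarrow> f x \<in> carrier B"
    "\<lbrakk>x \<in> carrier A; y \<in> carrier A\<rbrakk> \<Longrightarrow> f (x \<oplus>\<^bsub>A\<^esub> y) = f x \<oplus>\<^bsub>B\<^esub> f y"
    "x \<in> carrier A \<Longrightarrow> f (c \<odot>\<^bsub>A\<^esub> x) = c \<odot>\<^bsub>B\<^esub> f x"
  using assms by (auto simp: linear_maps_def)

lemma linear_maps_comp:
  "f \<in> linear_maps A B \<Longrightarrow> g \<in> linear_maps B C \<Longrightarrow> (\<lambda>x. g (f x)) \<in> linear_maps A C"
  by (auto simp: linear_maps_def Pi_iff)

locale two_algebras =
  fixes A :: "('k::field, 'a) module" and B :: "('k, 'b) module"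
  assumes A: "unital_algebra A" and B: "unital_algebra B"
begin

abbreviation MA :: "('k, ('a \<times> 'b) \<Rightarrow>\<^sub>0 'k) module" where
  "MA \<equiv> monoid_algebra (A \<times>\<times> B)"

sublocale A: ring A by (rule unital_algebraD[OF A])
sublocale B: ring B by (rule unital_algebraD[OF B])

lemma monoid_DirProd: "monoid (A \<times>\<times> B)"
  by (intro DirProd_monoid A.is_monoid B.is_monoid)

lemma unital_MA: "unital_algebra MA"
  by (rule unital_monoid_algebra[OF monoid_DirProd])

lemma module_MA: "Module.module scalars MA"
  by (rule unital_algebraD[OF unital_MA])

lemma MA_minus: "f \<in> carrier MA \<Longrightarrow> g \<in> carrier MA \<Longrightarrow> f \<ominus>\<^bsub>MA\<^esub> g = f - g"
  by (simp only: a_minus_def monoid_algebra_uminus[OF monoid_DirProd]) simp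

lemmas mA = module_scalarsD[OF unital_algebraD(1)[OF A]]
lemmas mB = module_scalarsD[OF unital_algebraD(1)[OF B]]

lemma relators_cases [consumes 1]:
  assumes "r \<in> tensor_relators A B"
  obtains (addl) a a' b where "r = Poly_Mapping.single (a \<oplus>\<^bsub>A\<^esub> a', b) 1 - Poly_Mapping.single (a, b) 1 - Poly_Mapping.single (a', b) 1"
      "a \<in> carrier A" "a' \<in> carrier A" "b \<in> carrier B"
  | (addr) a b b' where "r = Poly_Mapping.single (a, b \<oplus>\<^bsub>B\<^esub> b') 1 - Poly_Mapping.single (a, b) 1 - Poly_Mapping.single (a, b') 1"
      "a \<in> carrier A" "b \<in> carrier B" "b' \<in> carrier B"
  | (smultl) c a b where "r = Poly_Mapping.single (c \<odot>\<^bsub>A\<^esub> a, b) 1 - Poly_Mapping.single (a, b) c"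
      "a \<in> carrier A" "b \<in> carrier B"
  | (smultr) c a b where "r = Poly_Mapping.single (a, c \<odot>\<^bsub>B\<^esub> b) 1 - Poly_Mapping.single (a, b) c"
      "a \<in> carrier A" "b \<in> carrier B"
  using assms unfolding tensor_relators_def by (elim UnE CollectE exE conjE) assumption+

lemma relators_intros:
  "\<lbrakk>a \<in> carrier A; a' \<in> carrier A; b \<in> carrier B\<rbrakk> \<Longrightarrow> Poly_Mapping.single (a \<oplus>\<^bsub>A\<^esub> a', b) 1 - Poly_Mapping.single (a, b) 1 - Poly_Mapping.single (a', b) 1 \<in> tensor_relators A B"
  "\<lbrakk>a \<in> carrier A; b \<in> carrier B; b' \<in> carrier B\<rbrakk> \<Longrightarrow> Poly_Mapping.single (a, b \<oplus>\<^bsub>B\<^esub> b') 1 - Poly_Mapping.single (a, b) 1 - Poly_Mapping.single (a, b') 1 \<in> tensor_relators A B"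
  "\<lbrakk>a \<in> carrier A; b \<in> carrier B\<rbrakk> \<Longrightarrow> Poly_Mapping.single (c \<odot>\<^bsub>A\<^esub> a, b) 1 - Poly_Mapping.single (a, b) c \<in> tensor_relators A B"
  "\<lbrakk>a \<in> carrier A; b \<in> carrier B\<rbrakk> \<Longrightarrow> Poly_Mapping.single (a, c \<odot>\<^bsub>B\<^esub> b) 1 - Poly_Mapping.single (a, b) c \<in> tensor_relators A B"
  unfolding tensor_relators_def
  subgoal by (rule UnI1, rule UnI1, rule UnI1, rule CollectI, intro exI conjI, rule refl)
  subgoal by (rule UnI1, rule UnI1, rule UnI2, rule CollectI, intro exI conjI, rule refl)
  subgoal by (rule UnI1, rule UnI2, rule CollectI, intro exI conjI, rule refl)
  subgoal by (rule UnI2, rule CollectI, intro exI conjI, rule refl)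
  done

lemma single_closed: "a \<in> carrier A \<Longrightarrow> b \<in> carrier B \<Longrightarrow> Poly_Mapping.single (a, b) c \<in> carrier MA"
  by simp

lemma MA_diff_closed: "f \<in> carrier MA \<Longrightarrow> g \<in> carrier MA \<Longrightarrow> f - g \<in> carrier MA"
  by (simp add: keys_diff3)

lemma relators_subset: "tensor_relators A B \<subseteq> carrier MA"
proof
  fix r assume "r \<in> tensor_relators A B"
  then show "r \<in> carrier MA"
  proof (cases rule: relators_cases)
    case (addl a a' b)
    show ?thesis unfolding addl(1) by (intro MA_diff_closed single_closed A.a_closed addl)
  next
    case (addr a b b')
    show ?thesis unfolding addr(1) by (intro MA_diff_closed single_closed B.a_closed addr)
  next
    case (smultl c a b)
    show ?thesis unfolding smultl(1) by (intro MA_diff_closed single_closed mA(2) smultl)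
  next
    case (smultr c a b)
    show ?thesis unfolding smultr(1) by (intro MA_diff_closed single_closed mB(2) smultr)
  qed
qed

lemmas kernel_submodule = submodule_span_submodule[OF module_MA relators_subset, folded tensor_kernel_def]
lemmas kernelD = submodule_scalarsD[OF module_MA kernel_submodule]
lemmas kernel_induct = submodule_span_induct[OF module_MA relators_subset, folded tensor_kernel_def,
    consumes 1, case_names base zero add smult]

lemma relators_in_kernel: "r \<in> tensor_relators A B \<Longrightarrow> r \<in> tensor_kernel A B"
  unfolding tensor_kernel_def by (rule subsetD[OF submodule_span_superset])

lemma kernel_single_mult:
  assumes "r \<in> tensor_relators A B" and u: "u \<in> carrier A" and v: "v \<in> carrier B"
  shows "Poly_Mapping.single (u, v) d \<otimes>\<^bsub>MA\<^esub> r \<in> tensor_kernel A B"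
    "r \<otimes>\<^bsub>MA\<^esub> Poly_Mapping.single (u, v) d \<in> tensor_kernel A B"
proof -
  note simps = monoid_algebra_mult_diff monoid_algebra_mult_simps(5) pm_scale_simps(8) pm_scale_diff
    A.l_distr A.r_distr B.l_distr B.r_distr A.m_closed B.m_closed unital_algebraD(3,4)[OF A] unital_algebraD(3,4)[OF B] u v mult.commute
  have k: "Poly_Mapping.map ((*) d) r \<in> tensor_kernel A B" if "r \<in> tensor_relators A B" for r
    using kernelD(4)[OF relators_in_kernel[OF that]] by simp
  from assms(1) show "Poly_Mapping.single (u, v) d \<otimes>\<^bsub>MA\<^esub> r \<in> tensor_kernel A B"
  proof (cases rule: relators_cases)
    case (addl a a' b)
    show ?thesis using k[OF relators_intros(1)[of "u \<otimes>\<^bsub>A\<^esub> a" "u \<otimes>\<^bsub>A\<^esub> a'" "v \<otimes>\<^bsub>B\<^esub> b"]] addl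
      by (simp add: simps)
  next
    case (addr a b b')
    show ?thesis using k[OF relators_intros(2)[of "u \<otimes>\<^bsub>A\<^esub> a" "v \<otimes>\<^bsub>B\<^esub> b" "v \<otimes>\<^bsub>B\<^esub> b'"]] addr
      by (simp add: simps)
  next
    case (smultl c a b)
    show ?thesis using k[OF relators_intros(3)[of "u \<otimes>\<^bsub>A\<^esub> a" "v \<otimes>\<^bsub>B\<^esub> b" c]] smultl
      by (simp add: simps)
  next
    case (smultr c a b)
    show ?thesis using k[OF relators_intros(4)[of "u \<otimes>\<^bsub>A\<^esub> a" "v \<otimes>\<^bsub>B\<^esub> b" c]] smultr
      by (simp add: simps)
  qed
  from assms(1) show "r \<otimes>\<^bsub>MA\<^esub> Poly_Mapping.single (u, v) d \<in> tensor_kernel A B"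
  proof (cases rule: relators_cases)
    case (addl a a' b)
    show ?thesis using k[OF relators_intros(1)[of "a \<otimes>\<^bsub>A\<^esub> u" "a' \<otimes>\<^bsub>A\<^esub> u" "b \<otimes>\<^bsub>B\<^esub> v"]] addl
      by (simp add: simps)
  next
    case (addr a b b')
    show ?thesis using k[OF relators_intros(2)[of "a \<otimes>\<^bsub>A\<^esub> u" "b \<otimes>\<^bsub>B\<^esub> v" "b' \<otimes>\<^bsub>B\<^esub> v"]] addr
      by (simp add: simps)
  next
    case (smultl c a b)
    show ?thesis using k[OF relators_intros(3)[of "a \<otimes>\<^bsub>A\<^esub> u" "b \<otimes>\<^bsub>B\<^esub> v" c]] smultl
      by (simp add: simps)
  next
    case (smultr c a b)
    show ?thesis using k[OF relators_intros(4)[of "a \<otimes>\<^bsub>A\<^esub> u" "b \<otimes>\<^bsub>B\<^esub> v" c]] smultr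
      by (simp add: simps)
  qed
qed

text \<open>A basis pair times a relator is again a relator, up to a scalar. So the subspace that
  makes the pairs bilinear is an ideal, although it is defined as a span.\<close>

lemma kernel_ideal: "ideal (tensor_kernel A B) MA"
proof (rule idealI)
  interpret MA: ring MA by (rule unital_algebraD[OF unital_MA])
  note k_zero = kernelD(2)[unfolded monoid_algebra_simps]
  note k_add = kernelD(3)[unfolded monoid_algebra_simps]
  note k_smult = kernelD(4)[unfolded monoid_algebra_simps]
  show "ring MA" by (rule MA.ring_axioms)
  show "subgroup (tensor_kernel A B) (add_monoid MA)"
    by (rule submodule.axioms(1)[OF kernel_submodule])
  fix r f assume r: "r \<in> tensor_kernel A B" and f: "f \<in> carrier MA"
  have f': "Poly_Mapping.keys f \<subseteq> carrier A \<times> carrier B" using f by simp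
  show "f \<otimes>\<^bsub>MA\<^esub> r \<in> tensor_kernel A B"
    using r
  proof (induction rule: kernel_induct)
    case (base r)
    show ?case using f'
    proof (induction rule: poly_mapping_single_induct)
      case (single u c)
      then show ?case using kernel_single_mult(1)[OF base, of "fst u" "snd u" c] by (simp add: mem_Times_iff)
    next
      case (add f g)
      then show ?case by (simp add: monoid_algebra_mult_simps k_add)
    qed (simp add: monoid_algebra_mult_simps k_zero)
  next
    case (add x y)
    then show ?case by (simp add: monoid_algebra_mult_simps k_add)
  next
    case (smult c x)
    then show ?case by (simp add: monoid_algebra_mult_simps k_smult)
  qed (simp add: monoid_algebra_mult_simps k_zero)
  show "r \<otimes>\<^bsub>MA\<^esub> f \<in> tensor_kernel A B"
    using r
  proof (induction rule: kernel_induct)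
    case (base r)
    show ?case using f'
    proof (induction rule: poly_mapping_single_induct)
      case (single u c)
      then show ?case using kernel_single_mult(2)[OF base, of "fst u" "snd u" c] by (simp add: mem_Times_iff)
    next
      case (add f g)
      then show ?case by (simp add: monoid_algebra_mult_simps k_add)
    qed (simp add: monoid_algebra_mult_simps k_zero)
  next
    case (add x y)
    then show ?case by (simp add: monoid_algebra_mult_simps k_add)
  next
    case (smult c x)
    then show ?case by (simp add: monoid_algebra_mult_simps k_smult)
  qed (simp add: monoid_algebra_mult_simps k_zero)
qed

lemma unital_tensor: "unital_algebra (tensor A B)"
  unfolding tensor_def by (rule unital_quotient_algebra[OF unital_MA kernel_ideal])

lemmas tensor_simps = quotient_algebra_simps[OF kernel_ideal, folded tensor_def]
  quotient_algebra_smult[OF unital_MA kernel_ideal, folded tensor_def]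

lemma pure_closed [simp]: "a \<in> carrier A \<Longrightarrow> b \<in> carrier B \<Longrightarrow> pure_tensor A B a b \<in> carrier (tensor A B)"
  unfolding pure_tensor_def tensor_simps(1) by (intro imageI single_closed)

lemma one_tensor: "\<one>\<^bsub>tensor A B\<^esub> = pure_tensor A B \<one>\<^bsub>A\<^esub> \<one>\<^bsub>B\<^esub>"
  unfolding tensor_simps(2) pure_tensor_def by simp

lemma pure_mult:
  assumes "a \<in> carrier A" "b \<in> carrier B" "a' \<in> carrier A" "b' \<in> carrier B"
  shows "pure_tensor A B a b \<otimes>\<^bsub>tensor A B\<^esub> pure_tensor A B a' b' = pure_tensor A B (a \<otimes>\<^bsub>A\<^esub> a') (b \<otimes>\<^bsub>B\<^esub> b')"
  unfolding pure_tensor_def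
  by (subst tensor_simps(5)) (use assms in \<open>simp_all add: monoid_algebra_mult_simps\<close>)

lemma pure_smult:
  assumes "a \<in> carrier A" "b \<in> carrier B"
  shows "c \<odot>\<^bsub>tensor A B\<^esub> pure_tensor A B a b = tensor_kernel A B +>\<^bsub>MA\<^esub> Poly_Mapping.single (a, b) c"
  unfolding pure_tensor_def
  by (subst tensor_simps(6)) (use assms in \<open>simp_all add: pm_scale_simps\<close>)

lemma MA_add_closed: "f \<in> carrier MA \<Longrightarrow> g \<in> carrier MA \<Longrightarrow> f + g \<in> carrier MA"
  using keys_add[of f g] by auto

lemma coset_eqI:
  assumes "f \<in> carrier MA" "g \<in> carrier MA" "f - g \<in> tensor_kernel A B"
  shows "tensor_kernel A B +>\<^bsub>MA\<^esub> f = tensor_kernel A B +>\<^bsub>MA\<^esub> g"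
  using quotient_eq_iff[OF kernel_ideal assms(1,2)] MA_minus[OF assms(1,2)] assms(3) by simp

lemma bilinear_pure: "bilinear_map A B (tensor A B) (pure_tensor A B)"
proof -
  have "pure_tensor A B (a \<oplus>\<^bsub>A\<^esub> a') b = pure_tensor A B a b \<oplus>\<^bsub>tensor A B\<^esub> pure_tensor A B a' b"
    if "a \<in> carrier A" "a' \<in> carrier A" "b \<in> carrier B" for a a' b
    unfolding pure_tensor_def
    using relators_in_kernel[OF relators_intros(1)[OF that]]
    by (subst tensor_simps(4); (intro coset_eqI)?)
      (use that in \<open>simp_all add: diff_diff_add MA_add_closed single_closed del: monoid_algebra_simps(1)\<close>)
  moreover have "pure_tensor A B a (b \<oplus>\<^bsub>B\<^esub> b') = pure_tensor A B a b \<oplus>\<^bsub>tensor A B\<^esub> pure_tensor A B a b'"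
    if "a \<in> carrier A" "b \<in> carrier B" "b' \<in> carrier B" for a b b'
    unfolding pure_tensor_def
    using relators_in_kernel[OF relators_intros(2)[OF that]]
    by (subst tensor_simps(4); (intro coset_eqI)?)
      (use that in \<open>simp_all add: diff_diff_add MA_add_closed single_closed del: monoid_algebra_simps(1)\<close>)
  moreover have "pure_tensor A B (c \<odot>\<^bsub>A\<^esub> a) b = c \<odot>\<^bsub>tensor A B\<^esub> pure_tensor A B a b"
    if "a \<in> carrier A" "b \<in> carrier B" for c a b
    unfolding pure_smult[OF that] unfolding pure_tensor_def
    by (rule coset_eqI) (use that relators_in_kernel[OF relators_intros(3)[OF that]] mA(2) in auto)
  moreover have "pure_tensor A B a (c \<odot>\<^bsub>B\<^esub> b) = c \<odot>\<^bsub>tensor A B\<^esub> pure_tensor A B a b"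
    if "a \<in> carrier A" "b \<in> carrier B" for c a b
    unfolding pure_smult[OF that] unfolding pure_tensor_def
    by (rule coset_eqI) (use that relators_in_kernel[OF relators_intros(4)[OF that]] mB(2) in auto)
  ultimately show ?thesis unfolding bilinear_map_def by simp
qed

text \<open>Sums of pure tensors exhaust the tensor product, since a scalar can be moved into the first
  factor.\<close>

lemma tensor_induct [consumes 1, case_names pure add]:
  assumes t: "t \<in> carrier (tensor A B)"
    and pure: "\<And>a b. \<lbrakk>a \<in> carrier A; b \<in> carrier B\<rbrakk> \<Longrightarrow> P (pure_tensor A B a b)"
    and add: "\<And>s t. \<lbrakk>s \<in> carrier (tensor A B); t \<in> carrier (tensor A B); P s; P t\<rbrakk> \<Longrightarrow> P (s \<oplus>\<^bsub>tensor A B\<^esub> t)"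
  shows "P t"
proof -
  let ?I = "tensor_kernel A B"
  have coset_single: "?I +>\<^bsub>MA\<^esub> Poly_Mapping.single u c = pure_tensor A B (c \<odot>\<^bsub>A\<^esub> fst u) (snd u)"
    if "u \<in> carrier A \<times> carrier B" for u c
    using that bilinear_pure pure_smult[of "fst u" "snd u" c] unfolding bilinear_map_def by auto
  obtain f where f: "f \<in> carrier MA" "t = ?I +>\<^bsub>MA\<^esub> f"
    using t by (auto simp: tensor_simps)
  have "Poly_Mapping.keys f \<subseteq> carrier A \<times> carrier B" using f by simp
  then have "P (?I +>\<^bsub>MA\<^esub> f)"
  proof (induction rule: poly_mapping_single_induct)
    case zero
    show ?case using coset_single[of "(\<zero>\<^bsub>A\<^esub>, \<zero>\<^bsub>B\<^esub>)" 0] pure[of "0 \<odot>\<^bsub>A\<^esub> \<zero>\<^bsub>A\<^esub>" "\<zero>\<^bsub>B\<^esub>"] mA(2) by simp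
  next
    case (single u c)
    show ?case unfolding coset_single[OF single] using single mA(2) by (auto intro!: pure)
  next
    case (add f g)
    have "(?I +>\<^bsub>MA\<^esub> f) \<oplus>\<^bsub>tensor A B\<^esub> (?I +>\<^bsub>MA\<^esub> g) = ?I +>\<^bsub>MA\<^esub> (f + g)"
      by (subst tensor_simps(4)) (use add in simp_all)
    then show ?case
      using assms(3)[of "?I +>\<^bsub>MA\<^esub> f" "?I +>\<^bsub>MA\<^esub> g"] add by (simp add: tensor_simps)
  qed
  then show ?thesis using f by simp
qed

lemma tensor_linear_eqI:
  assumes "\<phi> \<in> linear_maps (tensor A B) C" "\<psi> \<in> linear_maps (tensor A B) C"
    and "\<And>a b. \<lbrakk>a \<in> carrier A; b \<in> carrier B\<rbrakk> \<Longrightarrow> \<phi> (pure_tensor A B a b) = \<psi> (pure_tensor A B a b)"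
    and "t \<in> carrier (tensor A B)"
  shows "\<phi> t = \<psi> t"
  using assms(4)
  by (induction rule: tensor_induct)
    (use assms(1-3) in \<open>auto simp: linear_mapsD\<close>)

text \<open>The map induced by \<open>\<beta>\<close> on representatives. Taking the sum in the ring of families makes its
  linearity an instance of the general facts on linear extensions.\<close>

definition lift_rep :: "('k, 'c) module \<Rightarrow> ('a \<Rightarrow> 'b \<Rightarrow> 'c) \<Rightarrow> (('a \<times> 'b) \<Rightarrow>\<^sub>0 'k) \<Rightarrow> 'c" where
  "lift_rep C \<beta> f = value_at C (lin_ext (\<lambda>p c. scale c (emb C (\<beta> (fst p) (snd p)))) f)"

lemma lift_rep_simps:
  assumes C: "unital_algebra C"
  shows "lift_rep C \<beta> f \<in> carrier C" "lift_rep C \<beta> 0 = \<zero>\<^bsub>C\<^esub>"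
    "lift_rep C \<beta> (f + g) = lift_rep C \<beta> f \<oplus>\<^bsub>C\<^esub> lift_rep C \<beta> g"
    "lift_rep C \<beta> (Poly_Mapping.map ((*) c) f) = c \<odot>\<^bsub>C\<^esub> lift_rep C \<beta> f"
    "\<beta> a b \<in> carrier C \<Longrightarrow> lift_rep C \<beta> (Poly_Mapping.single (a, b) c) = c \<odot>\<^bsub>C\<^esub> \<beta> a b"
proof -
  note s = value_at_simps[OF C]
  show "lift_rep C \<beta> f \<in> carrier C" "lift_rep C \<beta> 0 = \<zero>\<^bsub>C\<^esub>"
    by (simp_all add: lift_rep_def s)
  show "lift_rep C \<beta> (f + g) = lift_rep C \<beta> f \<oplus>\<^bsub>C\<^esub> lift_rep C \<beta> g"
    unfolding lift_rep_def s(4)[symmetric]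
    by (rule arg_cong[where f = "value_at C"], rule lin_ext_add) (simp_all add: scale_simps)
  show "lift_rep C \<beta> (Poly_Mapping.map ((*) c) f) = c \<odot>\<^bsub>C\<^esub> lift_rep C \<beta> f"
    unfolding lift_rep_def s(8)[symmetric]
    by (subst lin_ext_map) (simp_all add: lin_ext_def scale.scale_sum_right)
  show "\<beta> a b \<in> carrier C \<Longrightarrow> lift_rep C \<beta> (Poly_Mapping.single (a, b) c) = c \<odot>\<^bsub>C\<^esub> \<beta> a b"
    by (simp add: lift_rep_def lin_ext_single s value_at_emb[OF C])
qed

lemma lift_rep_diff:
  assumes C: "unital_algebra C"
  shows "lift_rep C \<beta> (f - g) = lift_rep C \<beta> f \<ominus>\<^bsub>C\<^esub> lift_rep C \<beta> g"
proof -
  have "f - g = f + Poly_Mapping.map ((*) (- 1)) g" by (simp add: pm_scale_simps)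
  then show ?thesis
    by (simp only: lift_rep_simps[OF C] a_minus_def module_uminus[OF unital_algebraD(1)[OF C]])
qed

lemma lift_rep_kernel:
  assumes C: "unital_algebra C" and \<beta>: "bilinear_map A B C \<beta>" and "r \<in> tensor_kernel A B"
  shows "lift_rep C \<beta> r = \<zero>\<^bsub>C\<^esub>"
proof -
  interpret C: ring C by (rule unital_algebraD[OF C])
  note mC = module_scalarsD[OF unital_algebraD(1)[OF C]]
  from \<beta> have b: "\<And>a b. \<lbrakk>a \<in> carrier A; b \<in> carrier B\<rbrakk> \<Longrightarrow> \<beta> a b \<in> carrier C"
    unfolding bilinear_map_def by blast
  note [simp] = lift_rep_simps[OF C] lift_rep_diff[OF C] b
  show ?thesis
    using assms(3)
  proof (induction rule: kernel_induct)
    case (base r)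
    then show ?case
    proof (cases rule: relators_cases)
      case (addl a a' b)
      moreover from this \<beta> have "\<beta> (a \<oplus>\<^bsub>A\<^esub> a') b = \<beta> a b \<oplus>\<^bsub>C\<^esub> \<beta> a' b"
        unfolding bilinear_map_def by blast
      ultimately show ?thesis
        by (simp add: mC C.minus_eq C.minus_add C.a_ac C.r_neg C.r_neg1 C.r_neg2)
    next
      case (addr a b b')
      moreover from this \<beta> have "\<beta> a (b \<oplus>\<^bsub>B\<^esub> b') = \<beta> a b \<oplus>\<^bsub>C\<^esub> \<beta> a b'"
        unfolding bilinear_map_def by blast
      ultimately show ?thesis
        by (simp add: mC C.minus_eq C.minus_add C.a_ac C.r_neg C.r_neg1 C.r_neg2)
    next
      case (smultl c a b)
      moreover from this \<beta> have "\<beta> (c \<odot>\<^bsub>A\<^esub> a) b = c \<odot>\<^bsub>C\<^esub> \<beta> a b"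
        unfolding bilinear_map_def by blast
      ultimately show ?thesis by (simp add: mC C.minus_eq C.r_neg)
    next
      case (smultr c a b)
      moreover from this \<beta> have "\<beta> a (c \<odot>\<^bsub>B\<^esub> b) = c \<odot>\<^bsub>C\<^esub> \<beta> a b"
        unfolding bilinear_map_def by blast
      ultimately show ?thesis by (simp add: mC C.minus_eq C.r_neg)
    qed
  qed (simp_all add: mC)
qed

lemma tensor_lift_coset:
  assumes C: "unital_algebra C" and \<beta>: "bilinear_map A B C \<beta>" and f: "f \<in> carrier MA"
  shows "tensor_lift C \<beta> (tensor_kernel A B +>\<^bsub>MA\<^esub> f) = lift_rep C \<beta> f"
proof -
  interpret C: ring C by (rule unital_algebraD[OF C])
  interpret I: ideal "tensor_kernel A B" MA by (rule kernel_ideal)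
  let ?Y = "tensor_kernel A B +>\<^bsub>MA\<^esub> f"
  let ?\<Phi> = "\<lambda>f. \<Oplus>\<^bsub>C\<^esub>p\<in>Poly_Mapping.keys f. Poly_Mapping.lookup f p \<odot>\<^bsub>C\<^esub> \<beta> (fst p) (snd p)"
  have b: "\<And>a b. \<lbrakk>a \<in> carrier A; b \<in> carrier B\<rbrakk> \<Longrightarrow> \<beta> a b \<in> carrier C"
    using \<beta> unfolding bilinear_map_def by blast
  have eq: "?\<Phi> h = lift_rep C \<beta> h" if "h \<in> carrier MA" for h
    unfolding lift_rep_def lin_ext_def
    apply (subst value_at_sum[OF C finite_keys])
    apply (rule C.finsum_cong')
    using that b module_scalarsD(2)[OF unital_algebraD(1)[OF C]]
    by (auto simp: value_at_simps[OF C] value_at_emb[OF C] subset_iff)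
  have "?\<Phi> h = lift_rep C \<beta> f" if h: "h \<in> ?Y" for h
  proof -
    obtain r where r: "r \<in> tensor_kernel A B" "h = r + f"
      using h by (auto simp: a_r_coset_def')
    have "h \<in> carrier MA" using h I.a_rcosetsI[OF I.a_subset f] r f kernelD(1)
      keys_add[of r f] by auto
    then show ?thesis
      using r lift_rep_kernel[OF C \<beta> r(1)] lift_rep_simps[OF C] eq by simp
  qed
  then have "?\<Phi> ` ?Y = (\<lambda>_. lift_rep C \<beta> f) ` ?Y" by (intro image_cong refl)
  also have "\<dots> = {lift_rep C \<beta> f}" by (rule image_constant[OF I.a_rcos_self[OF f]])
  finally have "?\<Phi> ` ?Y = {lift_rep C \<beta> f}" .
  then show ?thesis unfolding tensor_lift_def by simp
qed

lemma tensor_lift_pure: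
  assumes C: "unital_algebra C" and \<beta>: "bilinear_map A B C \<beta>" and "a \<in> carrier A" "b \<in> carrier B"
  shows "tensor_lift C \<beta> (pure_tensor A B a b) = \<beta> a b"
proof -
  have "\<beta> a b \<in> carrier C" using assms unfolding bilinear_map_def by blast
  then show ?thesis
    unfolding pure_tensor_def
    by (subst tensor_lift_coset[OF C \<beta>])
      (use assms in \<open>simp_all add: lift_rep_simps[OF C] module_scalarsD[OF unital_algebraD(1)[OF C]]\<close>)
qed

lemma tensor_lift_linear:
  assumes C: "unital_algebra C" and \<beta>: "bilinear_map A B C \<beta>"
  shows "tensor_lift C \<beta> \<in> linear_maps (tensor A B) C"
proof -
  interpret MA: ring MA by (rule unital_algebraD[OF unital_MA])
  note l = tensor_lift_coset[OF C \<beta>]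
  have *: "f + g \<in> carrier MA" "Poly_Mapping.map ((*) c) f \<in> carrier MA"
    if "f \<in> carrier MA" "g \<in> carrier MA" for f g c
    using MA.a_closed[OF that] module_scalarsD(2)[OF module_MA that(1), of c] by auto
  show ?thesis
    unfolding linear_maps_def tensor_simps(1)
    by (auto simp: Pi_iff tensor_simps l lift_rep_simps[OF C] * simp del: monoid_algebra_simps(1))
qed

text \<open>Multiplicativity on a tensor product can be tested on pure tensors, one factor at a time.\<close>

lemma tensor_linear_mult:
  assumes C: "unital_algebra C" and \<phi>: "\<phi> \<in> linear_maps (tensor A B) C"
    and m: "\<And>a b a' b'. \<lbrakk>a \<in> carrier A; b \<in> carrier B; a' \<in> carrier A; b' \<in> carrier B\<rbrakk> \<Longrightarrow>
      \<phi> (pure_tensor A B (a \<otimes>\<^bsub>A\<^esub> a') (b \<otimes>\<^bsub>B\<^esub> b')) = \<phi> (pure_tensor A B a b) \<otimes>\<^bsub>C\<^esub> \<phi> (pure_tensor A B a' b')"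
    and s: "s \<in> carrier (tensor A B)" and t: "t \<in> carrier (tensor A B)"
  shows "\<phi> (s \<otimes>\<^bsub>tensor A B\<^esub> t) = \<phi> s \<otimes>\<^bsub>C\<^esub> \<phi> t"
proof -
  interpret C: ring C by (rule unital_algebraD[OF C])
  interpret T: ring "tensor A B" by (rule unital_algebraD[OF unital_tensor])
  note [simp] = linear_mapsD[OF \<phi>]
  show ?thesis using s
  proof (induction rule: tensor_induct)
    case (pure a b)
    show ?case using t
      by (induction rule: tensor_induct)
        (use pure in \<open>simp_all add: pure_mult m T.r_distr C.r_distr\<close>)
  next
    case (add s s') then show ?case using t by (simp add: T.l_distr C.l_distr)
  qed
qed

lemma tensor_lift_mult:
  assumes C: "unital_algebra C" and b: "bilinear_map A B C \<beta>"
    and m: "\<And>a a' b b'. \<lbrakk>a \<in> carrier A; a' \<in> carrier A; b \<in> carrier B; b' \<in> carrier B\<rbrakk> \<Longrightarrow>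
      \<beta> (a \<otimes>\<^bsub>A\<^esub> a') (b \<otimes>\<^bsub>B\<^esub> b') = \<beta> a b \<otimes>\<^bsub>C\<^esub> \<beta> a' b'"
    and "s \<in> carrier (tensor A B)" "t \<in> carrier (tensor A B)"
  shows "tensor_lift C \<beta> (s \<otimes>\<^bsub>tensor A B\<^esub> t) = tensor_lift C \<beta> s \<otimes>\<^bsub>C\<^esub> tensor_lift C \<beta> t"
  by (rule tensor_linear_mult[OF C tensor_lift_linear[OF C b] _ assms(4,5)])
    (simp add: tensor_lift_pure[OF C b] m)

end

lemma bilinear_mapI:
  assumes "\<And>a b. \<lbrakk>a \<in> carrier A; b \<in> carrier B\<rbrakk> \<Longrightarrow> \<beta> a b \<in> carrier C"
     "\<And>a a' b. \<lbrakk>a \<in> carrier A; a' \<in> carrier A; b \<in> carrier B\<rbrakk> \<Longrightarrow> \<beta> (a \<oplus>\<^bsub>A\<^esub> a') b = \<beta> a b \<oplus>\<^bsub>C\<^esub> \<beta> a' b"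
     "\<And>a b b'. \<lbrakk>a \<in> carrier A; b \<in> carrier B; b' \<in> carrier B\<rbrakk> \<Longrightarrow> \<beta> a (b \<oplus>\<^bsub>B\<^esub> b') = \<beta> a b \<oplus>\<^bsub>C\<^esub> \<beta> a b'"
     "\<And>c a b. \<lbrakk>a \<in> carrier A; b \<in> carrier B\<rbrakk> \<Longrightarrow> \<beta> (c \<odot>\<^bsub>A\<^esub> a) b = c \<odot>\<^bsub>C\<^esub> \<beta> a b"
     "\<And>c a b. \<lbrakk>a \<in> carrier A; b \<in> carrier B\<rbrakk> \<Longrightarrow> \<beta> a (c \<odot>\<^bsub>B\<^esub> b) = c \<odot>\<^bsub>C\<^esub> \<beta> a b"
  shows "bilinear_map A B C \<beta>"
  using assms unfolding bilinear_map_def by blast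

lemma bilinear_mapD:
  assumes "bilinear_map A B C \<beta>"
  shows "\<And>a b. \<lbrakk>a \<in> carrier A; b \<in> carrier B\<rbrakk> \<Longrightarrow> \<beta> a b \<in> carrier C"
     "\<And>a a' b. \<lbrakk>a \<in> carrier A; a' \<in> carrier A; b \<in> carrier B\<rbrakk> \<Longrightarrow> \<beta> (a \<oplus>\<^bsub>A\<^esub> a') b = \<beta> a b \<oplus>\<^bsub>C\<^esub> \<beta> a' b"
     "\<And>a b b'. \<lbrakk>a \<in> carrier A; b \<in> carrier B; b' \<in> carrier B\<rbrakk> \<Longrightarrow> \<beta> a (b \<oplus>\<^bsub>B\<^esub> b') = \<beta> a b \<oplus>\<^bsub>C\<^esub> \<beta> a b'"
     "\<And>c a b. \<lbrakk>a \<in> carrier A; b \<in> carrier B\<rbrakk> \<Longrightarrow> \<beta> (c \<odot>\<^bsub>A\<^esub> a) b = c \<odot>\<^bsub>C\<^esub> \<beta> a b"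
     "\<And>c a b. \<lbrakk>a \<in> carrier A; b \<in> carrier B\<rbrakk> \<Longrightarrow> \<beta> a (c \<odot>\<^bsub>B\<^esub> b) = c \<odot>\<^bsub>C\<^esub> \<beta> a b"
  using assms unfolding bilinear_map_def by blast+

lemma bilinear_comp:
  assumes "bilinear_map A' B' C \<beta>" "f \<in> linear_maps A A'" "g \<in> linear_maps B B'"
  shows "bilinear_map A B C (\<lambda>a b. \<beta> (f a) (g b))"
  by (rule bilinear_mapI)
    (simp_all add: bilinear_mapD[OF assms(1)] linear_mapsD[OF assms(2)] linear_mapsD[OF assms(3)])

section \<open>Gaussian binomial coefficients\<close>

text \<open>The Gaussian binomials are evaluated through their representation as Laurent polynomials because
  a direct quotient of \<open>q\<close>-factorials is meaningless at a root of unity. Evaluation is a ring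
  homomorphism on the Laurent polynomials, which carries the Pascal rules from the field of fractions
  to every point.\<close>

definition is_laurent :: "'k::field_char_0 poly fract \<Rightarrow> bool" where
  "is_laurent f \<longleftrightarrow> (\<exists>p N. f = to_fract p / indet ^ N)"

lemma indet_power: "indet ^ N = to_fract ([:0, 1:] ^ N :: 'k::field_char_0 poly)"
  unfolding indet_def by (induction N) (simp_all add: to_fract_mult[symmetric] del: to_fract_mult)

lemma indet_nonzero [simp]: "(indet :: 'k::field_char_0 poly fract) \<noteq> 0"
  by (simp add: indet_def)

lemma laurent_eval_quotient:
  fixes x :: "'k::field_char_0"
  assumes "x \<noteq> 0"
  shows "laurent_eval (to_fract p / indet ^ N) x = poly p x / x ^ N"
  unfolding laurent_eval_def
proof (rule the_equality)
  show "\<exists>p' N'. to_fract p / indet ^ N = to_fract p' / indet ^ N' \<and> poly p x / x ^ N = poly p' x / x ^ N'"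
    by blast
  fix c assume "\<exists>p' N'. to_fract p / indet ^ N = to_fract p' / indet ^ N' \<and> c = poly p' x / x ^ N'"
  then obtain p' N' where eq: "to_fract p / indet ^ N = to_fract p' / indet ^ N'" and c: "c = poly p' x / x ^ N'"
    by blast
  from eq have "to_fract p * indet ^ N' = to_fract p' * indet ^ N"
    by (simp add: frac_eq_eq)
  then have "p * [:0, 1:] ^ N' = p' * [:0, 1:] ^ N"
    by (simp add: indet_power flip: to_fract_mult)
  then have "poly (p * [:0, 1:] ^ N') x = poly (p' * [:0, 1:] ^ N) x" by simp
  then show "c = poly p x / x ^ N"
    using assms by (simp add: c poly_power frac_eq_eq)
qed

lemma laurent_eval_add:
  fixes x :: "'k::field_char_0"
  assumes "x \<noteq> 0" "is_laurent f" "is_laurent g"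
  shows "is_laurent (f + g) \<and> laurent_eval (f + g) x = laurent_eval f x + laurent_eval g x"
proof -
  obtain p N p' N' where f: "f = to_fract p / indet ^ N" and g: "g = to_fract p' / indet ^ N'"
    using assms unfolding is_laurent_def by blast
  have eq: "f + g = to_fract (p * [:0, 1:] ^ N' + p' * [:0, 1:] ^ N) / indet ^ (N + N')"
    unfolding f g by (simp add: to_fract_add to_fract_mult flip: indet_power)
      (simp add: field_simps power_add)
  then have "is_laurent (f + g)" unfolding is_laurent_def by blast
  moreover have "laurent_eval (f + g) x = laurent_eval f x + laurent_eval g x"
    unfolding eq unfolding f g laurent_eval_quotient[OF assms(1)] using assms(1)
    by (simp add: poly_power field_simps power_add)
  ultimately show ?thesis ..
qed

lemma laurent_eval_mult:
  fixes x :: "'k::field_char_0"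
  assumes "x \<noteq> 0" "is_laurent f" "is_laurent g"
  shows "is_laurent (f * g) \<and> laurent_eval (f * g) x = laurent_eval f x * laurent_eval g x"
proof -
  obtain p N p' N' where f: "f = to_fract p / indet ^ N" and g: "g = to_fract p' / indet ^ N'"
    using assms unfolding is_laurent_def by blast
  have eq: "f * g = to_fract (p * p') / indet ^ (N + N')"
    unfolding f g by (simp add: to_fract_mult field_simps power_add)
  then have "is_laurent (f * g)" unfolding is_laurent_def by blast
  moreover have "laurent_eval (f * g) x = laurent_eval f x * laurent_eval g x"
    unfolding eq unfolding f g laurent_eval_quotient[OF assms(1)] using assms(1)
    by (simp add: field_simps power_add)
  ultimately show ?thesis ..
qed

lemma laurent_eval_power:
  fixes x :: "'k::field_char_0"
  assumes "x \<noteq> 0"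
  shows "is_laurent (indet ^ n :: 'k poly fract)" "laurent_eval (indet ^ n) x = x ^ n"
    "is_laurent (inverse indet ^ n :: 'k poly fract)" "laurent_eval (inverse indet ^ n) x = inverse x ^ n"
proof -
  have 1: "indet ^ n = (to_fract ([:0, 1:] ^ n) / indet ^ 0 :: 'k poly fract)"
    by (simp add: indet_power)
  have 2: "inverse indet ^ n = (to_fract 1 / indet ^ n :: 'k poly fract)"
    by (simp add: power_inverse divide_inverse)
  show "is_laurent (indet ^ n :: 'k poly fract)" "is_laurent (inverse indet ^ n :: 'k poly fract)"
    unfolding is_laurent_def using 1 2 by blast+
  show "laurent_eval (indet ^ n) x = x ^ n"
    using laurent_eval_quotient[OF assms, of "[:0, 1:] ^ n" 0] by (simp add: 1 poly_power)
  show "laurent_eval (inverse indet ^ n) x = inverse x ^ n"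
    using laurent_eval_quotient[OF assms, of 1 n] by (simp add: 2 power_inverse divide_inverse)
qed

text \<open>The two ways of splitting a \<open>q\<close>-integer are the source of the two Pascal rules; they are exchanged
  by \<open>x \<mapsto> inverse x\<close>, under which \<open>q_int x\<close> is invariant.\<close>

lemma q_int_add:
  fixes x :: "'a::field"
  assumes "x \<noteq> 0"
  shows "q_int x (s + t) = x ^ s * q_int x t + inverse x ^ t * q_int x s"
    "q_int x (s + t) = inverse x ^ s * q_int x t + x ^ t * q_int x s"
proof -
  have *: "x ^ s * inverse x ^ s = 1" "x ^ t * inverse x ^ t = 1"
    using assms by (simp_all flip: power_mult_distrib)
  show "q_int x (s + t) = x ^ s * q_int x t + inverse x ^ t * q_int x s"
    "q_int x (s + t) = inverse x ^ s * q_int x t + x ^ t * q_int x s"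
    unfolding q_int_def times_divide_eq_right add_divide_distrib[symmetric]
    by (rule arg_cong2[where f = "(/)"]; simp add: right_diff_distrib power_add mult.commute)+
qed

lemma q_fact_Suc: "q_fact x (Suc m) = q_int x (Suc m) * q_fact x m"
  by (simp add: q_fact_def prod.nat_ivl_Suc' mult.commute)

lemma q_fact_nonzero:
  assumes "\<And>r. r \<ge> 1 \<Longrightarrow> q_int x r \<noteq> 0"
  shows "q_fact x m \<noteq> 0"
  using assms by (simp add: q_fact_def)

lemma q_binom_pascal:
  fixes x :: "'a::field"
  assumes x: "x \<noteq> 0" and nz: "\<And>r. r \<ge> 1 \<Longrightarrow> q_int x r \<noteq> 0" and s: "s < m"
  shows "q_binom x (Suc m) (Suc s) = x ^ Suc s * q_binom x m (Suc s) + inverse x ^ (m - s) * q_binom x m s"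
    "q_binom x (Suc m) (Suc s) = inverse x ^ Suc s * q_binom x m (Suc s) + x ^ (m - s) * q_binom x m s"
proof -
  obtain t where t: "m = s + Suc t" using s less_imp_Suc_add by auto
  have nzf: "q_fact x r \<noteq> 0" for r by (rule q_fact_nonzero[OF nz])
  have e1: "q_binom x m (Suc s) = q_fact x m * q_int x (Suc t) / (q_fact x (Suc s) * q_fact x (Suc t))"
    using nz[of "Suc t"] unfolding q_binom_def t by (simp add: q_fact_Suc[of x t])
  have e2: "q_binom x m s = q_fact x m * q_int x (Suc s) / (q_fact x (Suc s) * q_fact x (Suc t))"
    using nz[of "Suc s"] unfolding q_binom_def t by (simp add: q_fact_Suc[of x s])
  have e3: "q_binom x (Suc m) (Suc s) = q_fact x m * q_int x (Suc s + Suc t) / (q_fact x (Suc s) * q_fact x (Suc t))"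
    unfolding q_binom_def t q_fact_Suc[of x "s + Suc t"] by (simp add: mult.commute)
  have "m - s = Suc t" using t by simp
  then show "q_binom x (Suc m) (Suc s) = x ^ Suc s * q_binom x m (Suc s) + inverse x ^ (m - s) * q_binom x m s"
    unfolding e1 e2 e3 q_int_add(1)[OF x] by (simp only: ring_distribs add_divide_distrib times_divide_eq_right mult.left_commute)
  show "q_binom x (Suc m) (Suc s) = inverse x ^ Suc s * q_binom x m (Suc s) + x ^ (m - s) * q_binom x m s"
    unfolding e1 e2 e3 q_int_add(2)[OF x] \<open>m - s = Suc t\<close>
    by (simp only: ring_distribs add_divide_distrib times_divide_eq_right mult.left_commute)
qed

lemma q_int_indet_nonzero:
  assumes "r \<ge> 1"
  shows "q_int (indet :: 'k::field_char_0 poly fract) r \<noteq> 0"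
proof -
  have *: "indet ^ n \<noteq> (inverse indet ^ n :: 'k poly fract)" if "n \<ge> 1" for n
  proof
    assume "indet ^ n = (inverse indet ^ n :: 'k poly fract)"
    then have "indet ^ n * indet ^ n = (inverse (indet ^ n) * indet ^ n :: 'k poly fract)"
      by (simp only: power_inverse)
    then have "indet ^ (n + n) = (1 :: 'k poly fract)"
      unfolding power_add by simp
    then have "to_fract ([:0, 1:] ^ (n + n) :: 'k poly) = to_fract 1" by (simp add: indet_power)
    then have "Polynomial.degree ([:0, 1:] ^ (n + n) :: 'k poly) = 0" by (simp only: to_fract_eq_iff) simp
    then show False using that by (simp add: degree_power_eq)
  qed
  show ?thesis using *[OF assms] *[of 1] by (simp add: q_int_def)
qed

lemmas indet_pascal = q_binom_pascal[OF indet_nonzero q_int_indet_nonzero]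

lemma q_binom_indet_ends:
  "q_binom (indet :: 'k::field_char_0 poly fract) m 0 = 1" "q_binom (indet :: 'k poly fract) m m = 1"
  using q_fact_nonzero[of "indet :: 'k poly fract", OF q_int_indet_nonzero]
  by (simp_all add: q_binom_def) (simp_all add: q_fact_def)

text \<open>By the Pascal rule, since the ends are 1.\<close>

lemma q_binom_laurent:
  assumes "s \<le> m"
  shows "is_laurent (q_binom (indet :: 'k::field_char_0 poly fract) m s)"
  using assms
proof (induction m arbitrary: s)
  case 0
  then show ?case using laurent_eval_power(1)[of 1 0] by (simp add: q_binom_indet_ends)
next
  case (Suc m)
  show ?case
  proof (cases s)
    case 0
    then show ?thesis using laurent_eval_power(1)[of 1 0] by (simp add: q_binom_indet_ends)
  next
    case (Suc s')
    show ?thesis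
    proof (cases "s' = m")
      case True
      then show ?thesis using Suc laurent_eval_power(1)[of 1 0] by (simp add: q_binom_indet_ends)
    next
      case False
      then have "s' < m" using Suc Suc.prems by simp
      then have "is_laurent (indet ^ Suc s' * q_binom indet m (Suc s') + inverse indet ^ (m - s') * q_binom (indet :: 'k poly fract) m s')"
        by (intro laurent_eval_add[of 1, THEN conjunct1] laurent_eval_mult[of 1, THEN conjunct1]
            laurent_eval_power(1,3)[of 1] Suc.IH) simp_all
      then show ?thesis
        unfolding Suc using indet_pascal(1)[OF _ \<open>s' < m\<close>] by metis
    qed
  qed
qed

lemma gauss_binom_simps:
  fixes x :: "'k::field_char_0"
  assumes x: "x \<noteq> 0"
  shows gauss_binom_0: "gauss_binom x m 0 = 1"
    and gauss_binom_self: "gauss_binom x m m = 1"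
    and gauss_binom_pascal:
      "s < m \<Longrightarrow> gauss_binom x (Suc m) (Suc s) = x ^ Suc s * gauss_binom x m (Suc s) + inverse x ^ (m - s) * gauss_binom x m s"
      "s < m \<Longrightarrow> gauss_binom x (Suc m) (Suc s) = inverse x ^ Suc s * gauss_binom x m (Suc s) + x ^ (m - s) * gauss_binom x m s"
proof -
  have 1: "laurent_eval 1 x = 1" using laurent_eval_power(2)[OF x, of 0] by simp
  show "gauss_binom x m 0 = 1" "gauss_binom x m m = 1"
    by (simp_all add: gauss_binom_def q_binom_indet_ends 1)
  assume s: "s < m"
  have l: "is_laurent (q_binom (indet :: 'k poly fract) m (Suc s))" "is_laurent (q_binom (indet :: 'k poly fract) m s)"
    using s by (simp_all add: q_binom_laurent)
  note e = laurent_eval_power[OF x] laurent_eval_mult[OF x] laurent_eval_add[OF x] l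
  show "gauss_binom x (Suc m) (Suc s) = x ^ Suc s * gauss_binom x m (Suc s) + inverse x ^ (m - s) * gauss_binom x m s"
    unfolding gauss_binom_def by (subst indet_pascal(1)[OF _ s]) (simp_all only: e)
  show "gauss_binom x (Suc m) (Suc s) = inverse x ^ Suc s * gauss_binom x m (Suc s) + x ^ (m - s) * gauss_binom x m s"
    unfolding gauss_binom_def by (subst indet_pascal(2)[OF _ s]) (simp_all only: e)
qed

section \<open>Quantum Serre elements\<close>

text \<open>With \<open>L\<close> and \<open>R\<close> the left and right multiplications by \<open>U\<close>, this is the \<open>q\<close>-binomial expansion of
  \<open>\<Prod>t<m. (L - z x ^ (m - 1 - 2 t) R) V\<close>. The Serre relation is the case \<open>z = 1\<close>. The parameter \<open>z\<close>
  makes the form stable under splitting off a factor at either end.\<close>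

definition q_serre :: "'k::field_char_0 \<Rightarrow> 'k \<Rightarrow> nat \<Rightarrow> ('k, 'a) family \<Rightarrow> ('k, 'a) family \<Rightarrow> ('k, 'a) family" where
  "q_serre x z m U V = (\<Sum>s = 0..m. scale ((- 1) ^ s * z ^ s * gauss_binom x m s) (U ^ (m - s) * V * U ^ s))"

lemma sum_pascal:
  fixes a f g :: "nat \<Rightarrow> 'a::ab_group_add"
  assumes "a 0 = f 0" "a (Suc m) = g m" "\<And>s. s < m \<Longrightarrow> a (Suc s) = f (Suc s) + g s"
  shows "(\<Sum>s = 0..Suc m. a s) = (\<Sum>s = 0..m. f s) + (\<Sum>s = 0..m. g s)"
proof -
  have l: "(\<Sum>s = 0..m. h s) = (\<Sum>s<m. h s) + h m" for h :: "nat \<Rightarrow> 'a"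
    by (simp add: atLeast0AtMost flip: lessThan_Suc_atMost)
  have "(\<Sum>s = 0..Suc m. a s) = a 0 + ((\<Sum>s<m. a (Suc s)) + a (Suc m))"
    unfolding sum.atLeast0_atMost_Suc_shift l by simp
  also have "(\<Sum>s<m. a (Suc s)) = (\<Sum>s<m. f (Suc s)) + (\<Sum>s<m. g s)"
    by (simp add: assms(3) sum.distrib)
  finally have "(\<Sum>s = 0..Suc m. a s) = (f 0 + (\<Sum>s<m. f (Suc s))) + ((\<Sum>s<m. g s) + g m)"
    by (simp add: assms(1,2) add_ac)
  then show ?thesis
    unfolding l[of g, symmetric] by (simp add: atLeast0AtMost sum.atMost_shift[of f])
qed

text \<open>The factor with the lowest exponent, or the one with the highest, is applied to \<open>V\<close> first. The
  remaining exponents are centred one step higher or lower, whence \<open>z x\<close> and \<open>z / x\<close>. The two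
  recursions are the two Pascal rules, and choosing between them is what makes the later proofs
  work.\<close>

lemma q_serre_rec:
  fixes U V :: "('k::field_char_0, 'a) family"
  assumes x: "x \<noteq> 0"
  shows "q_serre x z (Suc m) U V = q_serre x (z * x) m U (U * V - scale (z * inverse x ^ m) (V * U))"
    "q_serre x z (Suc m) U V = q_serre x (z * inverse x) m U (U * V - scale (z * x ^ m) (V * U))"
proof -
  have X1: "U ^ (m - s) * (U * V) * U ^ s = U ^ (Suc m - s) * V * U ^ s" if "s \<le> m" for s
    using that by (simp add: Suc_diff_le mult.assoc power_commutes flip: power_Suc2)
      (metis mult.assoc power_Suc2 power_commutes)
  have X2: "U ^ (m - s) * (V * U) * U ^ s = U ^ (m - s) * V * U ^ Suc s" for s
    by (simp add: mult.assoc)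
  have inv: "inverse x ^ (m - s) = x ^ s * inverse x ^ m" "x ^ (m - s) = inverse x ^ s * x ^ m" if "s \<le> m" for s
    using x that by (simp_all add: power_diff power_inverse field_simps)
  note gb = gauss_binom_0[OF x] gauss_binom_self[OF x]
  have split: "q_serre x w m U (U * V - scale v (V * U)) =
      (\<Sum>s = 0..m. scale ((- 1) ^ s * w ^ s * gauss_binom x m s) (U ^ (m - s) * (U * V) * U ^ s)) +
      (\<Sum>s = 0..m. scale (- ((- 1) ^ s * w ^ s * gauss_binom x m s * v)) (U ^ (m - s) * (V * U) * U ^ s))" for w v
    unfolding q_serre_def sum.distrib[symmetric]
    by (rule sum.cong) (simp_all add: right_diff_distrib left_diff_distrib scale_simps scale.scale_right_diff_distrib)
  show "q_serre x z (Suc m) U V = q_serre x (z * x) m U (U * V - scale (z * inverse x ^ m) (V * U))"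
    unfolding split unfolding q_serre_def
  proof (rule sum_pascal)
    fix s assume s: "s < m"
    show "scale ((- 1) ^ Suc s * z ^ Suc s * gauss_binom x (Suc m) (Suc s)) (U ^ (Suc m - Suc s) * V * U ^ Suc s) =
      scale ((- 1) ^ Suc s * (z * x) ^ Suc s * gauss_binom x m (Suc s)) (U ^ (m - Suc s) * (U * V) * U ^ Suc s) +
      scale (- ((- 1) ^ s * (z * x) ^ s * gauss_binom x m s * (z * inverse x ^ m))) (U ^ (m - s) * (V * U) * U ^ s)"
      using s X1[of "Suc s"] X2[of s] inv[of s]
      by (simp add: gauss_binom_pascal(1)[OF x s] power_mult_distrib algebra_simps flip: scale_simps(2))
  qed (use x X1[of 0] X2[of m] in \<open>simp_all add: gb power_mult_distrib power_inverse field_simps\<close>)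
  show "q_serre x z (Suc m) U V = q_serre x (z * inverse x) m U (U * V - scale (z * x ^ m) (V * U))"
    unfolding split unfolding q_serre_def
  proof (rule sum_pascal)
    fix s assume s: "s < m"
    show "scale ((- 1) ^ Suc s * z ^ Suc s * gauss_binom x (Suc m) (Suc s)) (U ^ (Suc m - Suc s) * V * U ^ Suc s) =
      scale ((- 1) ^ Suc s * (z * inverse x) ^ Suc s * gauss_binom x m (Suc s)) (U ^ (m - Suc s) * (U * V) * U ^ Suc s) +
      scale (- ((- 1) ^ s * (z * inverse x) ^ s * gauss_binom x m s * (z * x ^ m))) (U ^ (m - s) * (V * U) * U ^ s)"
      using s X1[of "Suc s"] X2[of s] inv[of s]
      by (simp add: gauss_binom_pascal(2)[OF x s] power_mult_distrib algebra_simps flip: scale_simps(2))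
  qed (use x X1[of 0] X2[of m] in \<open>simp_all add: gb power_mult_distrib power_inverse field_simps\<close>)
qed

lemma q_serre_0 [simp]: "x \<noteq> 0 \<Longrightarrow> q_serre x z 0 U V = V"
  by (simp add: q_serre_def gauss_binom_0 scale_simps)

lemma q_serre_add_right: "q_serre x z m U (V + V') = q_serre x z m U V + q_serre x z m U V'"
  by (simp add: q_serre_def distrib_left distrib_right scale_simps sum.distrib)

lemma q_serre_scale_right: "q_serre x z m U (scale c V) = scale c (q_serre x z m U V)"
  by (simp add: q_serre_def scale_simps scale.scale_sum_right mult.commute)

lemma q_serre_zero_right [simp]: "q_serre x z m U 0 = 0"
  by (simp add: q_serre_def)

lemma scale_move: "c \<noteq> 0 \<Longrightarrow> scale c U = V \<longleftrightarrow> U = scale (inverse c) V"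
  by (metis scale_simps(3,4) left_inverse right_inverse)

lemma scale_assoc_rule:
  "a * b = scale c (d * e) \<Longrightarrow> a * (b * w) = scale c (d * (e * w))"
  by (metis mult.assoc scale_simps(5))

lemmas twist_simps = mult.assoc right_diff_distrib left_diff_distrib scale_simps(3,5,6)
  scale.scale_right_diff_distrib

text \<open>If \<open>B\<close> commutes with \<open>V\<close> up to the scalar of the lowest factor, then \<open>B\<close> drops out of this factor.
  Since \<open>B\<close> passes \<open>A\<close> with the scalar \<open>x\<^sup>2\<close>, the result again commutes with \<open>B\<close> up to the scalar of the
  next factor, so \<open>B\<close> drops out everywhere.\<close>

lemma q_serre_sum_left:
  fixes A B V :: "('k::field_char_0, 'a) family"
  assumes x: "x \<noteq> 0" and BA: "B * A = scale (x ^ 2) (A * B)"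
    and BV: "scale (x ^ m) (B * V) = scale (z * x) (V * B)"
  shows "q_serre x z m (A + B) V = q_serre x z m A V"
  using BV
proof (induction m arbitrary: z V)
  case 0
  then show ?case by (simp add: x)
next
  case (Suc m)
  \<comment> \<open>the scalar of the factor with the lowest exponent\<close>
  define k where "k = z * inverse x ^ m"
  have BV: "B * V = scale k (V * B)"
    using Suc.prems x by (simp add: scale_move scale_simps k_def power_inverse field_simps)
  note BA' = scale_assoc_rule[OF BA] and BV' = scale_assoc_rule[OF BV]
  have 1: "(A + B) * V - scale k (V * (A + B)) = A * V - scale k (V * A)"
    by (simp add: distrib_left distrib_right scale_simps BV)
  have 2: "B * (A * V - scale k (V * A)) = scale (x ^ 2 * k) ((A * V - scale k (V * A)) * B)"
    by (simp add: twist_simps BA BV BA' BV' mult_ac)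
  have "x ^ m * (x ^ 2 * k) = z * x * x"
    using x by (simp add: k_def power_inverse power2_eq_square)
  then have "scale (x ^ m) (B * (A * V - scale k (V * A))) = scale (z * x * x) ((A * V - scale k (V * A)) * B)"
    by (simp only: 2 scale_simps(3))
  from Suc.IH[OF this] show ?case
    unfolding q_serre_rec(1)[OF x] k_def[symmetric] 1 .
qed

text \<open>The mirror image: \<open>A\<close> drops out when the factors are applied from the highest exponent down.\<close>

lemma q_serre_sum_right:
  fixes A B V :: "('k::field_char_0, 'a) family"
  assumes x: "x \<noteq> 0" and BA: "B * A = scale (x ^ 2) (A * B)"
    and AV: "scale x (A * V) = scale (z * x ^ m) (V * A)"
  shows "q_serre x z m (A + B) V = q_serre x z m B V"
  using AV
proof (induction m arbitrary: z V)
  case 0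
  then show ?case by (simp add: x)
next
  case (Suc m)
  define k where "k = z * x ^ m"
  have AB: "A * B = scale (inverse x ^ 2) (B * A)"
    unfolding BA using x by (simp add: scale_simps flip: power_mult_distrib)
  have AV: "A * V = scale k (V * A)"
    using Suc.prems x by (simp add: scale_move scale_simps k_def field_simps)
  note AB' = scale_assoc_rule[OF AB] and AV' = scale_assoc_rule[OF AV]
  have 1: "(A + B) * V - scale k (V * (A + B)) = B * V - scale k (V * B)"
    by (simp add: distrib_left distrib_right scale_simps AV)
  have 2: "A * (B * V - scale k (V * B)) = scale (inverse x ^ 2 * k) ((B * V - scale k (V * B)) * A)"
    by (simp add: twist_simps AB AV AB' AV' mult_ac)
  have "x * (inverse x ^ 2 * k) = z * inverse x * x ^ m"
    using x by (simp add: k_def power2_eq_square)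
  then have "scale x (A * (B * V - scale k (V * B))) = scale (z * inverse x * x ^ m) ((B * V - scale k (V * B)) * A)"
    by (simp only: 2 scale_simps(3))
  from Suc.IH[OF this] show ?case
    unfolding q_serre_rec(2)[OF x] k_def[symmetric] 1 .
qed

text \<open>Additivity of the Serre element under \<open>q\<close>-commutation. The conditions on \<open>B * A'\<close> and \<open>B' * A\<close> are
  those that start the two preceding inductions with \<open>z = 1\<close>, on \<open>A'\<close> and on \<open>B'\<close>.\<close>

lemma q_serre_sum:
  fixes A B A' B' :: "('k::field_char_0, 'a) family"
  assumes x: "x \<noteq> 0" and "B * A = scale (x ^ 2) (A * B)"
    and "scale (x ^ m) (B * A') = scale x (A' * B)"
    and "scale (x ^ m) (B' * A) = scale x (A * B')"
  shows "q_serre x 1 m (A + B) (A' + B') = q_serre x 1 m A A' + q_serre x 1 m B B'"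
  using q_serre_sum_left[of x B A m A' 1] q_serre_sum_right[of x B A B' 1 m] assms
  by (simp add: q_serre_add_right)

text \<open>The elements \<open>k\<close> and \<open>l\<close> can be collected to the right of every factor, at the cost of a scalar;
  \<open>k l\<close> takes the place of \<open>l\<close> in the next step. The scalar and the collected element remain
  unspecified: the lemma serves to transport the vanishing of a Serre element.\<close>

lemma q_serre_twist:
  fixes e y k l :: "('k::field_char_0, 'a) family"
  assumes x: "x \<noteq> 0" and ke: "k * e = scale a (e * k)" and ky: "k * y = scale b (y * k)"
    and le: "l * e = scale b (e * l)" and kl: "k * l = l * k"
  shows "\<exists>c w. q_serre x z m (e * k) (y * l) = scale c (q_serre x z m e y * w)"
  using ky le kl
proof (induction m arbitrary: z y b l)
  case 0
  show ?case using x by (intro exI[of _ 1] exI[of _ l]) (simp add: scale_simps)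
next
  case (Suc m)
  note ky = Suc.prems(1) and le = Suc.prems(2) and kl = Suc.prems(3)
  define \<kappa> where "\<kappa> = z * inverse x ^ m"
  define y' where "y' = e * y - scale \<kappa> (y * e)"
  have lk: "l * (k * w) = k * (l * w)" for w using kl by (metis mult.assoc)
  note r = ke ky le scale_assoc_rule[OF ke] scale_assoc_rule[OF ky] scale_assoc_rule[OF le]
  have 1: "(e * k) * (y * l) - scale \<kappa> ((y * l) * (e * k)) = scale b (y' * (k * l))"
    by (simp add: y'_def twist_simps r kl mult_ac)
  have "k * y' = scale (a * b) (y' * k)"
    by (simp add: y'_def twist_simps r mult_ac)
  moreover have "(k * l) * e = scale (a * b) (e * (k * l))"
    by (simp add: twist_simps r mult_ac)
  moreover have "k * (k * l) = (k * l) * k"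
    by (metis mult.assoc kl)
  ultimately obtain c w where
    "q_serre x (z * x) m (e * k) (y' * (k * l)) = scale c (q_serre x (z * x) m e y' * w)"
    using Suc.IH by blast
  then have "q_serre x z (Suc m) (e * k) (y * l) = scale (b * c) (q_serre x z (Suc m) e y * w)"
    unfolding q_serre_rec(1)[OF x] \<kappa>_def[symmetric] 1 y'_def[symmetric]
    by (simp add: q_serre_scale_right scale_simps)
  then show ?case by blast
qed

text \<open>For a product \<open>p\<close> like that of pure tensors: since \<open>a\<close> and \<open>b\<close> commute, the commutators only affect
  the other argument.\<close>

lemma q_serre_bimultiplicative:
  fixes p :: "('k::field_char_0, 'a) family \<Rightarrow> ('k, 'b) family \<Rightarrow> ('k, 'c) family"
  assumes x: "x \<noteq> 0"
    and p: "\<And>a u b v. p a u * p b v = p (a * b) (u * v)"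
    and lin: "\<And>a u v c. p a (u - scale c v) = p a u - scale c (p a v)"
    and ab: "a * b = b * a"
  shows "q_serre x z m (p a u) (p b v) = p (a ^ m * b) (q_serre x z m u v)"
  using ab
proof (induction m arbitrary: z b v)
  case 0
  then show ?case by (simp add: x)
next
  case (Suc m)
  have 1: "a * (a * b) = (a * b) * a" using Suc.prems by (metis mult.assoc)
  have 2: "p a u * p b v - scale c (p b v * p a u) = p (a * b) (u * v - scale c (v * u))" for c
    by (simp add: p lin Suc.prems)
  have "a ^ m * (a * b) = a ^ Suc m * b" by (simp only: power_Suc2 mult.assoc)
  then show ?case
    unfolding q_serre_rec(1)[OF x] 2 Suc.IH[OF 1] by simp
qed

lemma q_serre_scale_both:
  fixes u v :: "('k::field_char_0, 'a) family"
  assumes x: "x \<noteq> 0"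
  shows "q_serre x z m (scale a u) (scale b v) = scale (a ^ m * b) (q_serre x z m u v)"
proof (induction m arbitrary: z b v)
  case 0
  then show ?case by (simp add: x)
next
  case (Suc m)
  have "scale a u * scale b v - scale k (scale b v * scale a u) = scale (a * b) (u * v - scale k (v * u))" for k
    by (simp add: twist_simps mult_ac)
  then show ?case unfolding q_serre_rec(1)[OF x] by (simp add: Suc.IH mult_ac)
qed

text \<open>Elements commuting with \<open>U\<close> up to the scalar of an extreme factor are annihilated by that factor.\<close>

lemma q_serre_eq_0_ascending:
  assumes x: "x \<noteq> 0" and "scale (x ^ m) (U * V) = scale z (V * U)"
  shows "q_serre x z (Suc m) U V = 0"
proof -
  have "U * V = scale (z * inverse x ^ m) (V * U)"
    using assms by (simp add: scale_move scale_simps power_inverse mult.commute)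
  then show ?thesis by (simp add: q_serre_rec(1)[OF x])
qed

lemma q_serre_eq_0_descending:
  assumes x: "x \<noteq> 0" and "U * V = scale (z * x ^ m) (V * U)"
  shows "q_serre x z (Suc m) U V = 0"
  by (simp add: q_serre_rec(2)[OF x] assms(2))

text \<open>The sum of \<open>k\<^sup>-\<^sup>1 - k\<close> over the scalars \<open>k\<close> of the factors of a Serre element. For \<open>z = 1\<close> it is zero
  because the exponents are symmetric about 0.\<close>

fun exponent_defect :: "'k::field \<Rightarrow> 'k \<Rightarrow> nat \<Rightarrow> 'k" where
  "exponent_defect x z 0 = 0"
| "exponent_defect x z (Suc m) =
     (inverse (z * inverse x ^ m) - z * inverse x ^ m) + exponent_defect x (z * x) m"

lemma powi_Suc: "(x :: 'k::field) \<noteq> 0 \<Longrightarrow> a = 1 + b \<Longrightarrow> x powi a = x * x powi b"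
  by (simp add: power_int_add)

lemma exponent_defect_eq:
  assumes x: "x \<noteq> 0"
  shows "exponent_defect x z m = (\<Sum>t<m. inverse z * x powi (int m - 1 - 2 * int t) - z * x powi (2 * int t + 1 - int m))"
proof (induction m arbitrary: z)
  case (Suc m)
  have 1: "inverse (z * inverse x ^ m) = inverse z * x powi (int (Suc m) - 1 - 2 * int 0)"
    "z * inverse x ^ m = z * x powi (2 * int 0 + 1 - int (Suc m))"
  proof -
    have "int (Suc m) - 1 - 2 * int 0 = int m" "2 * int 0 + 1 - int (Suc m) = - int m" by simp_all
    then show "inverse (z * inverse x ^ m) = inverse z * x powi (int (Suc m) - 1 - 2 * int 0)"
      "z * inverse x ^ m = z * x powi (2 * int 0 + 1 - int (Suc m))"
      by (simp_all only: power_int_minus power_int_of_nat power_inverse inverse_mult_distrib inverse_inverse_eq)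
  qed
  have 2: "inverse (z * x) * x powi (int m - 1 - 2 * int t) = inverse z * x powi (int (Suc m) - 1 - 2 * int (Suc t))" for t
  proof -
    have 1: "x powi (int m - 1 - 2 * int t) = x * x powi (int (Suc m) - 1 - 2 * int (Suc t))"
      by (rule powi_Suc[OF x]) simp
    show ?thesis unfolding 1 using x by simp
  qed
  have 3: "z * x * x powi (2 * int t + 1 - int m) = z * x powi (2 * int (Suc t) + 1 - int (Suc m))" for t
  proof -
    have 1: "x powi (2 * int (Suc t) + 1 - int (Suc m)) = x * x powi (2 * int t + 1 - int m)"
      by (rule powi_Suc[OF x]) simp
    show ?thesis unfolding 1 by simp
  qed
  show ?case
    unfolding exponent_defect.simps Suc.IH sum.lessThan_Suc_shift 2 3
    unfolding 1(1) unfolding 1(2) by simp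
qed simp

lemma exponent_defect_zero:
  assumes x: "x \<noteq> 0"
  shows "exponent_defect x 1 m = 0"
proof -
  have "(\<Sum>t<m. x powi (2 * int t + 1 - int m)) = (\<Sum>t<m. x powi (2 * int (m - Suc t) + 1 - int m))"
    by (rule sum.nat_diff_reindex[symmetric])
  also have "\<dots> = (\<Sum>t<m. x powi (int m - 1 - 2 * int t))"
  proof (rule sum.cong)
    fix t assume "t \<in> {..<m}"
    then have "2 * int (m - Suc t) + 1 - int m = int m - 1 - 2 * int t"
      by (simp add: of_nat_diff)
    then show "x powi (2 * int (m - Suc t) + 1 - int m) = x powi (int m - 1 - 2 * int t)" by (simp only:)
  qed simp
  finally show ?thesis by (simp add: exponent_defect_eq[OF x] sum_subtractf)
qed

text \<open>This is the commutator of \<open>E i\<close> with the Serre element of \<open>F i\<close> and \<open>F j\<close>, computed factor by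
  factor. When the factor with scalar \<open>k\<close> is applied to \<open>V\<close>, the commutator with \<open>e\<close> receives
  \<open>(h - h') V - k V (h - h') = (k\<^sup>-\<^sup>1 - k) V h\<close>: the contribution of \<open>h'\<close> cancels, and that of \<open>h\<close> adds
  \<open>k\<^sup>-\<^sup>1 - k\<close> to a coefficient \<open>c\<close>. The induction keeps the invariant \<open>e V - V e = c W h\<close>, where \<open>W\<close> is the
  element from which \<open>V\<close> arose by the previous factor; at the end the coefficient is \<open>c\<close> plus the
  defect, that is, zero.\<close>

lemma q_serre_derivation:
  fixes e f V W h h' :: "('k::field_char_0, 'a) family"
  assumes x: "x \<noteq> 0" and ef: "e * f - f * e = h - h'"
    and hf: "h * f = scale (inverse x ^ 2) (f * h)" and hf': "h' * f = scale (x ^ 2) (f * h')"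
    and z: "z \<noteq> 0"
    and hV: "scale (z * x) (h * V) = scale (x ^ m) (V * h)"
    and hV': "scale (x ^ m) (h' * V) = scale (z * x) (V * h')"
    and eV: "e * V - V * e = scale c (W * h)"
    and W: "f * W - scale (z * inverse x ^ Suc m) (W * f) = V \<or> c = 0"
    and c: "c + exponent_defect x z m = 0"
  shows "e * q_serre x z m f V = q_serre x z m f V * e"
  using z hV hV' eV W c
proof (induction m arbitrary: z V W c)
  case 0
  then show ?case by (simp add: x)
next
  case (Suc m)
  note z = Suc.prems(1)
  define k where "k = z * inverse x ^ m"
  have k: "k \<noteq> 0" using x z by (simp add: k_def)
  have hV: "h * V = scale (inverse k) (V * h)"
    using Suc.prems(2) x z by (simp add: scale_move scale_simps k_def power_inverse field_simps)
  have hV': "h' * V = scale k (V * h')"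
    using Suc.prems(3) x z by (simp add: scale_move scale_simps k_def power_inverse field_simps)
  define V' where "V' = f * V - scale k (V * f)"
  note r = hf hf' hV hV' scale_assoc_rule[OF hf] scale_assoc_rule[OF hf'] scale_assoc_rule[OF hV] scale_assoc_rule[OF hV']
  have ef': "e * f = f * e + h - h'" and eV': "e * V = V * e + scale c (W * h)"
    using ef Suc.prems(4) by (simp_all add: algebra_simps)
  have ef'': "e * (f * w) = f * (e * w) + h * w - h' * w"
    and eV'': "e * (V * w) = V * (e * w) + scale c (W * (h * w))" for w
    using ef' eV' by (simp_all add: mult.assoc[symmetric] distrib_right left_diff_distrib scale_simps(5)[symmetric])
  \<comment> \<open>the old term, carried through the factor, turns \<open>W\<close> into \<open>V\<close>\<close>
  have kW: "scale c (f * (W * h)) - scale (c * k * inverse x ^ 2) (W * (f * h)) = scale c (V * h)"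
  proof (cases "c = 0")
    case False
    then have V: "V = f * W - scale (z * inverse x ^ Suc (Suc m)) (W * f)"
      using Suc.prems(5) by simp
    show ?thesis unfolding V
      by (simp add: twist_simps k_def power2_eq_square mult_ac)
  qed simp
  have eV1: "e * V' - V' * e = scale (c + (inverse k - k)) (V * h)"
  proof -
    have "e * V' - V' * e = (scale (inverse k) (V * h) - scale k (V * h)) +
        (scale c (f * (W * h)) - scale (c * k * inverse x ^ 2) (W * (f * h)))"
      by (simp add: V'_def twist_simps distrib_left distrib_right ef' ef'' eV' eV'' r scale_simps mult_ac
          algebra_simps)
    then show ?thesis unfolding kW by (simp add: scale_simps scale.scale_left_diff_distrib add.commute)
  qed
  have "h * V' = scale (inverse x ^ 2 * inverse k) (V' * h)" "h' * V' = scale (x ^ 2 * k) (V' * h')"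
    by (simp_all add: V'_def twist_simps r mult_ac)
  then have hV1: "scale (z * x * x) (h * V') = scale (x ^ m) (V' * h)"
    "scale (x ^ m) (h' * V') = scale (z * x * x) (V' * h')"
    using x z by (simp_all add: scale_simps k_def power_inverse power2_eq_square field_simps)
  have W1: "f * V - scale (z * x * inverse x ^ Suc m) (V * f) = V'"
  proof -
    have "z * x * inverse x ^ Suc m = k" using x by (simp add: k_def)
    then show ?thesis by (simp only: V'_def)
  qed
  have c1: "c + (inverse k - k) + exponent_defect x (z * x) m = 0"
    using Suc.prems(6) by (simp add: k_def add.assoc)
  have zx: "z * x \<noteq> 0" using x z by simp
  show ?case
    unfolding q_serre_rec(1)[OF x] k_def[symmetric] V'_def[symmetric]
    by (rule Suc.IH[OF zx hV1 eV1 _ c1]) (use W1 in simp)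
qed

section \<open>Root systems\<close>

text \<open>The roots of a fixed length are permuted by the reflections. So a root that is not orthogonal to
  one of them, say \<open>t\<close>, is proportional to the difference of \<open>t\<close> and its image under the reflection in that root, and lies in
  their span. This divides the roots into two orthogonal sets, of which irreducibility makes one empty.\<close>

lemma irreducible_root_not_orthogonal:
  assumes "irreducible_root_system R" and g: "\<gamma> \<in> R" and s: "\<sigma> \<in> R"
  shows "\<exists>t\<in>R. t \<bullet> t = \<gamma> \<bullet> \<gamma> \<and> t \<bullet> \<sigma> \<noteq> 0"
proof -
  interpret irreducible_root_system R by fact
  define T where "T = {\<beta> \<in> R. \<beta> \<bullet> \<beta> = \<gamma> \<bullet> \<gamma>}"
  define S where "S = {\<beta> \<in> R. \<beta> \<in> span T}"
  define S' where "S' = {\<beta> \<in> R. \<forall>t\<in>T. t \<bullet> \<beta> = 0}"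
  have "R = S \<union> S'"
  proof (intro equalityI subsetI)
    fix \<beta> assume b: "\<beta> \<in> R"
    show "\<beta> \<in> S \<union> S'"
    proof (cases "\<forall>t\<in>T. t \<bullet> \<beta> = 0")
      case False
      then obtain t where t: "t \<in> T" "t \<bullet> \<beta> \<noteq> 0" by blast
      have bb: "\<beta> \<bullet> \<beta> \<noteq> 0" using b zero_notin_roots by auto
      define c where "c = 2 * (t \<bullet> \<beta>) / (\<beta> \<bullet> \<beta>)"
      have c: "c \<noteq> 0" using t bb by (simp add: c_def)
      have "t - c *\<^sub>R \<beta> \<in> R" unfolding c_def using t b by (intro reflection_closed) (auto simp: T_def)
      moreover have "(t - c *\<^sub>R \<beta>) \<bullet> (t - c *\<^sub>R \<beta>) = t \<bullet> t"
        using bb by (simp add: c_def inner_diff inner_commute power2_eq_square field_simps)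
      ultimately have "t - c *\<^sub>R \<beta> \<in> T" using t by (simp add: T_def)
      then have "(1 / c) *\<^sub>R (t - (t - c *\<^sub>R \<beta>)) \<in> span T"
        using t(1) by (intro span_scale span_diff span_base)
      then show ?thesis using b c by (simp add: S_def)
    qed (use b in \<open>auto simp: S'_def\<close>)
  qed (auto simp: S_def S'_def)
  moreover have "\<beta> \<bullet> \<delta> = 0" if "\<beta> \<in> S" "\<delta> \<in> S'" for \<beta> \<delta>
  proof -
    have "orthogonal \<delta> \<beta>"
      using that by (intro orthogonal_to_span[of \<beta> T]) (auto simp: S_def S'_def orthogonal_def inner_commute)
    then show ?thesis by (simp add: orthogonal_def inner_commute)
  qed
  ultimately have "S = {} \<or> S' = {}" by (rule irreducible)
  moreover have "\<gamma> \<in> S" using g by (auto simp: S_def T_def intro: span_base)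
  ultimately have "S' = {}" by blast
  then show ?thesis using s unfolding S'_def T_def by blast
qed

text \<open>The number \<open>d i = (\<alpha> i, \<alpha> i) / 2\<close> is rounded in its definition; this lemma shows that nothing is lost.
  Choose a root \<open>t\<close> of the given length \<open>N\<close> that is not orthogonal to a shortest root \<open>\<sigma>\<close>. The two
  Cartan integers of the pair satisfy \<open>n N = 2 m\<close>, and \<open>n\<^sup>2 N \<le> 8\<close> by the Cauchy-Schwarz
  inequality. So \<open>n = 1\<close> or \<open>n = -1\<close>, whence \<open>N\<close> is even, or \<open>n\<^sup>2 \<ge> 4\<close>, whence \<open>N = 2\<close>, as no root is shorter than \<open>\<sigma>\<close>.\<close>

lemma root_length_even:
  assumes R: "irreducible_root_system R" and short: "\<forall>\<beta>\<in>short_roots R. \<beta> \<bullet> \<beta> = 2" and g: "\<gamma> \<in> R"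
  shows "\<exists>d::nat. d > 0 \<and> \<gamma> \<bullet> \<gamma> = 2 * real d"
proof -
  interpret irreducible_root_system R by fact
  define \<sigma> where "\<sigma> = arg_min_on (\<lambda>\<beta>. \<beta> \<bullet> \<beta>) R"
  have \<sigma>: "\<sigma> \<in> R" "\<And>\<beta>. \<beta> \<in> R \<Longrightarrow> \<sigma> \<bullet> \<sigma> \<le> \<beta> \<bullet> \<beta>"
    unfolding \<sigma>_def using finite_roots roots_nonempty
    by (auto intro: arg_min_if_finite(1) arg_min_least)
  then have s2: "\<sigma> \<bullet> \<sigma> = 2" using short unfolding short_roots_def by blast
  obtain t where t: "t \<in> R" "t \<bullet> t = \<gamma> \<bullet> \<gamma>" "t \<bullet> \<sigma> \<noteq> 0"
    using irreducible_root_not_orthogonal[OF R g \<sigma>(1)] by blast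
  define N where "N = t \<bullet> t"
  have N: "N \<ge> 2" using \<sigma>(2)[OF t(1)] s2 by (simp add: N_def)
  have "2 * (t \<bullet> \<sigma>) / (\<sigma> \<bullet> \<sigma>) \<in> \<int>" "2 * (\<sigma> \<bullet> t) / (t \<bullet> t) \<in> \<int>"
    using integrality \<sigma>(1) t(1) by blast+
  then obtain m n where m: "t \<bullet> \<sigma> = of_int m" and n: "2 * (t \<bullet> \<sigma>) / N = of_int n"
    by (auto simp: s2 N_def inner_commute elim!: Ints_cases)
  have nN: "of_int n * N = 2 * of_int m" using n m N by (simp add: field_simps)
  have m0: "m \<noteq> 0" using t(3) m by auto
  then have n0: "n \<noteq> 0" using nN by auto
  have "(t \<bullet> \<sigma>)\<^sup>2 \<le> N * 2"
    using Cauchy_Schwarz_ineq[of t \<sigma>] by (simp add: N_def s2)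
  then have "4 * (of_int m)\<^sup>2 \<le> 8 * N" by (simp add: m)
  then have "(of_int n * N)\<^sup>2 \<le> 8 * N" by (simp add: nN power_mult_distrib)
  then have "(of_int n)\<^sup>2 * N \<le> 8" using N by (simp add: power_mult_distrib power2_eq_square)
  have "\<bar>n\<bar> = 1 \<or> \<bar>n\<bar> \<ge> 2" using n0 by linarith
  then have "\<exists>k::int. N = 2 * of_int k"
  proof
    assume "\<bar>n\<bar> = 1"
    then have "N = 2 * of_int m \<or> N = 2 * of_int (- m)" using nN by (auto simp: abs_if split: if_splits)
    then show ?thesis by blast
  next
    assume "\<bar>n\<bar> \<ge> 2"
    then have "(2::int)\<^sup>2 \<le> n\<^sup>2" by (metis abs_le_square_iff abs_numeral)
    then have "(4::real) \<le> (of_int n)\<^sup>2" by (metis (mono_tags) of_int_le_iff of_int_numeral of_int_power power2_eq_square mult_2 numeral_Bit0 numeral_plus_numeral)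
    then have "4 * N \<le> (of_int n)\<^sup>2 * N" using N by (intro mult_right_mono) auto
    then have "N = 2" using \<open>(of_int n)\<^sup>2 * N \<le> 8\<close> N by linarith
    then show ?thesis by (intro exI[of _ 1]) simp
  qed
  then obtain k :: int where k: "N = 2 * of_int k" by blast
  have "k > 0" using k N by linarith
  then show ?thesis using k t(2) by (intro exI[of _ "nat k"]) (simp add: N_def)
qed

locale simple_root_data =
  fixes R :: "'v::euclidean_space set" and \<alpha> :: "'n::finite \<Rightarrow> 'v"
  assumes R: "irreducible_root_system R" and simple: "simple_roots R \<alpha>"
    and short: "\<forall>\<beta>\<in>short_roots R. \<beta> \<bullet> \<beta> = 2"
begin

lemma simple_in: "\<alpha> i \<in> R"
  using simple unfolding simple_roots_def by blast

lemma root_d_eq: "2 * real (root_d \<alpha> i) = \<alpha> i \<bullet> \<alpha> i"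
  using root_length_even[OF R short simple_in[of i]] by (auto simp: root_d_def)

lemma root_d_pos: "root_d \<alpha> i > 0"
  using root_length_even[OF R short simple_in[of i]] by (auto simp: root_d_def)

lemma cartan_eq: "real_of_int (cartan \<alpha> i j) = 2 * (\<alpha> i \<bullet> \<alpha> j) / (\<alpha> i \<bullet> \<alpha> i)"
proof -
  interpret irreducible_root_system R by (rule R)
  have "2 * (\<alpha> j \<bullet> \<alpha> i) / (\<alpha> i \<bullet> \<alpha> i) \<in> \<int>" by (rule integrality) (rule simple_in)+
  then show ?thesis by (simp add: cartan_def inner_commute)
qed

lemma cartan_diag: "cartan \<alpha> i i = 2"
proof -
  have "\<alpha> i \<bullet> \<alpha> i \<noteq> 0" using root_d_eq[of i] root_d_pos[of i] by linarith
  then have "real_of_int (cartan \<alpha> i i) = 2" by (simp add: cartan_eq)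
  then show ?thesis by linarith
qed

lemma cartan_sym: "int (root_d \<alpha> i) * cartan \<alpha> i j = int (root_d \<alpha> j) * cartan \<alpha> j i"
proof -
  have "real (root_d \<alpha> i) * real_of_int (cartan \<alpha> i j) = \<alpha> i \<bullet> \<alpha> j" for i j
    using root_d_eq[of i] root_d_pos[of i] by (simp add: cartan_eq flip: root_d_eq)
  then have "real_of_int (int (root_d \<alpha> i) * cartan \<alpha> i j) = real_of_int (int (root_d \<alpha> j) * cartan \<alpha> j i)"
    by (simp add: inner_commute)
  then show ?thesis by (simp only: of_int_eq_iff)
qed

lemma simple_coefficients_unique:
  assumes "(\<Sum>k\<in>UNIV. f k *\<^sub>R \<alpha> k) = 0"
  shows "f i = 0"
proof -
  have inj: "inj \<alpha>" and ind: "independent (range \<alpha>)"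
    using simple unfolding simple_roots_def by auto
  have "(\<Sum>v\<in>range \<alpha>. f (inv_into UNIV \<alpha> v) *\<^sub>R v) = 0"
    using assms by (simp add: sum.reindex[OF inj] inv_f_f[OF inj])
  from independentD[OF ind _ order.refl this, of "\<alpha> i"] show ?thesis
    by (simp add: inv_f_f[OF inj])
qed

text \<open>The reflection \<open>\<alpha> j - a \<alpha> i\<close> of a simple root is a root, so its coefficients do not have opposite
  signs.\<close>

lemma cartan_nonpos:
  assumes ij: "i \<noteq> j"
  shows "cartan \<alpha> i j \<le> 0"
proof (rule ccontr)
  interpret irreducible_root_system R by (rule R)
  assume "\<not> cartan \<alpha> i j \<le> 0"
  then have c: "real_of_int (cartan \<alpha> i j) > 0" by simp
  let ?c = "real_of_int (cartan \<alpha> i j)"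
  let ?f = "\<lambda>k. (if k = j then 1 else 0) - (if k = i then ?c else 0)"
  have sum: "(\<Sum>k\<in>UNIV. ?f k *\<^sub>R \<alpha> k) = \<alpha> j - ?c *\<^sub>R \<alpha> i"
    by (simp add: scaleR_diff_left sum_subtractf if_distrib[of "\<lambda>c. c *\<^sub>R _"] cong: if_cong)
  have "\<alpha> j - (2 * (\<alpha> j \<bullet> \<alpha> i) / (\<alpha> i \<bullet> \<alpha> i)) *\<^sub>R \<alpha> i \<in> R"
    by (rule reflection_closed) (rule simple_in)+
  then have "\<alpha> j - ?c *\<^sub>R \<alpha> i \<in> R" by (simp add: cartan_eq inner_commute)
  then obtain d :: "'n \<Rightarrow> nat" where d:
    "\<alpha> j - ?c *\<^sub>R \<alpha> i = (\<Sum>k\<in>UNIV. real (d k) *\<^sub>R \<alpha> k) \<or> \<alpha> j - ?c *\<^sub>R \<alpha> i = - (\<Sum>k\<in>UNIV. real (d k) *\<^sub>R \<alpha> k)"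
    using simple unfolding simple_roots_def by blast
  then show False
  proof
    assume "\<alpha> j - ?c *\<^sub>R \<alpha> i = (\<Sum>k\<in>UNIV. real (d k) *\<^sub>R \<alpha> k)"
    then have "(\<Sum>k\<in>UNIV. (?f k - real (d k)) *\<^sub>R \<alpha> k) = 0"
      using sum by (simp only: scaleR_diff_left[of "?f _"] sum_subtractf) simp
    from simple_coefficients_unique[OF this, of i] show False using c ij by simp
  next
    assume "\<alpha> j - ?c *\<^sub>R \<alpha> i = - (\<Sum>k\<in>UNIV. real (d k) *\<^sub>R \<alpha> k)"
    then have "(\<Sum>k\<in>UNIV. (?f k + real (d k)) *\<^sub>R \<alpha> k) = 0"
      using sum by (simp only: scaleR_add_left[of "?f _"] sum.distrib) simp
    from simple_coefficients_unique[OF this, of j] show False using ij by simp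
  qed
qed

text \<open>Both sides are \<open>q\<close> to the power \<open>(\<alpha> i, \<alpha> j)\<close>.\<close>

lemma q_root_sym: "q_root \<alpha> q i powi cartan \<alpha> i j = q_root \<alpha> q j powi cartan \<alpha> j i"
proof -
  have "q_root \<alpha> q i powi cartan \<alpha> i j = q powi (int (root_d \<alpha> i) * cartan \<alpha> i j)" for i j
    unfolding q_root_def by (simp add: power_int_mult flip: power_int_of_nat)
  then show ?thesis by (simp add: cartan_sym[of i j])
qed

end

section \<open>Evaluation of noncommutative polynomials\<close>

lemma monoid_word: "monoid word_monoid"
  by (rule monoidI) (simp_all add: word_monoid_def)

lemma word_monoid_simps [simp]:
  "carrier word_monoid = UNIV" "mult word_monoid = (@)" "one word_monoid = []"
  by (simp_all add: word_monoid_def)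

lemmas unital_free = unital_monoid_algebra[OF monoid_word]

definition ev :: "('g \<Rightarrow> ('k::field, 'b) family) \<Rightarrow> ('g list \<Rightarrow>\<^sub>0 'k) \<Rightarrow> ('k, 'b) family" where
  "ev Z f = lin_ext (\<lambda>w c. scale c (prod_list (map Z w))) f"

lemma ev_simps:
  "ev Z 0 = 0"
  "ev Z (f + g) = ev Z f + ev Z g"
  "ev Z (f - g) = ev Z f - ev Z g"
  "ev Z (Poly_Mapping.single w c) = scale c (prod_list (map Z w))"
  "ev Z (f \<otimes>\<^bsub>free_algebra\<^esub> g) = ev Z f * ev Z g"
  "ev Z (Poly_Mapping.map ((*) c) f) = scale c (ev Z f)"
  "ev Z (\<Sum>s\<in>S. h s) = (\<Sum>s\<in>S. ev Z (h s))"
proof -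
  show 0: "ev Z 0 = 0" by (simp add: ev_def)
  show add: "ev Z (f + g) = ev Z f + ev Z g" for f g
    unfolding ev_def by (rule lin_ext_add) (simp_all add: scale_simps)
  show "ev Z (f - g) = ev Z f - ev Z g"
    using add[of "f - g" g] by (simp add: algebra_simps)
  show ev_single: "ev Z (Poly_Mapping.single w c) = scale c (prod_list (map Z w))" for w c
    by (simp add: ev_def lin_ext_single)
  show "ev Z (Poly_Mapping.map ((*) c) f) = scale c (ev Z f)"
    unfolding ev_def by (subst lin_ext_map) (simp_all add: lin_ext_def scale.scale_sum_right scale_simps)
  show "ev Z (\<Sum>s\<in>S. h s) = (\<Sum>s\<in>S. ev Z (h s))"
    by (induction S rule: infinite_finite_induct) (simp_all add: 0 add)
  have "Poly_Mapping.keys f \<subseteq> UNIV" by simp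
  then show "ev Z (f \<otimes>\<^bsub>free_algebra\<^esub> g) = ev Z f * ev Z g"
  proof (induction rule: poly_mapping_single_induct)
    case (single u c)
    have "Poly_Mapping.keys g \<subseteq> UNIV" by simp
    then show ?case
      by (induction rule: poly_mapping_single_induct)
        (simp_all add: monoid_algebra_mult_simps 0 add ev_single distrib_left scale_simps mult.commute)
  qed (simp_all add: monoid_algebra_mult_simps 0 add distrib_right)
qed

section \<open>The defining relations\<close>

text \<open>The relations as equations between elements of a ring of families, with the Serre relations in the
  closed form. This is what both a presentation and a representation of the algebra have to meet.\<close>

definition weak_relations ::
  "('n \<Rightarrow> 'v::euclidean_space) \<Rightarrow> 'k::field_char_0 \<Rightarrow> ('n \<Rightarrow> bool) \<Rightarrow> ('n \<Rightarrow> bool) \<Rightarrow>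
     ('n gen \<Rightarrow> ('k, 'b) family) \<Rightarrow> bool" where
  "weak_relations \<alpha> q \<kappa> \<kappa>' Z \<longleftrightarrow>
     (\<forall>i. Z J = Z (K i) * Z (Kbar i)) \<and>
     (\<forall>i j. Z (K i) * Z (Kbar j) = Z (Kbar j) * Z (K i)) \<and>
     (\<forall>i j. Z (K i) * Z (K j) = Z (K j) * Z (K i)) \<and>
     (\<forall>i j. Z (Kbar i) * Z (Kbar j) = Z (Kbar j) * Z (Kbar i)) \<and>
     (\<forall>i. Z J * Z (K i) = Z (K i)) \<and>
     (\<forall>i. Z J * Z (Kbar i) = Z (Kbar i)) \<and>
     (\<forall>i j. \<kappa> i \<longrightarrow> Z (K j) * Z (E i) = scale (q_root \<alpha> q i powi cartan \<alpha> i j) (Z (E i) * Z (K j))) \<and>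
     (\<forall>i j. \<kappa> i \<longrightarrow> Z (E i) * Z (Kbar j) = scale (q_root \<alpha> q i powi cartan \<alpha> i j) (Z (Kbar j) * Z (E i))) \<and>
     (\<forall>i j. \<not> \<kappa> i \<longrightarrow> Z (K j) * (Z (E i) * Z (Kbar j)) = scale (q_root \<alpha> q i powi cartan \<alpha> i j) (Z (E i))) \<and>
     (\<forall>i j. \<kappa>' i \<longrightarrow> Z (K j) * Z (F i) = scale (q_root \<alpha> q i powi (- cartan \<alpha> i j)) (Z (F i) * Z (K j))) \<and>
     (\<forall>i j. \<kappa>' i \<longrightarrow> Z (F i) * Z (Kbar j) = scale (q_root \<alpha> q i powi (- cartan \<alpha> i j)) (Z (Kbar j) * Z (F i))) \<and>
     (\<forall>i j. \<not> \<kappa>' i \<longrightarrow> Z (K j) * (Z (F i) * Z (Kbar j)) = scale (q_root \<alpha> q i powi (- cartan \<alpha> i j)) (Z (F i))) \<and>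
     (\<forall>i j. i \<noteq> j \<longrightarrow> Z (E i) * Z (F j) = Z (F j) * Z (E i)) \<and>
     (\<forall>i. Z (E i) * Z (F i) - Z (F i) * Z (E i) =
        scale (1 / (q_root \<alpha> q i - inverse (q_root \<alpha> q i))) (Z (K i) - Z (Kbar i))) \<and>
     (\<forall>i j. i \<noteq> j \<longrightarrow> q_serre (q_root \<alpha> q i) 1 (nat (1 - cartan \<alpha> i j)) (Z (E i)) (Z (E j)) = 0) \<and>
     (\<forall>i j. i \<noteq> j \<longrightarrow> q_serre (q_root \<alpha> q i) 1 (nat (1 - cartan \<alpha> i j)) (Z (F i)) (Z (F j)) = 0)"

lemma ev_serre:
  "ev Z (serre \<alpha> q G i j) = q_serre (q_root \<alpha> q i) 1 (nat (1 - cartan \<alpha> i j)) (Z (G i)) (Z (G j))"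
  by (simp add: serre_def Let_def ev_simps q_serre_def prod_list_replicate mult.assoc)

lemma ball_image_collect:
  "(\<forall>r\<in>{f i | i. P i}. Q r) \<longleftrightarrow> (\<forall>i. P i \<longrightarrow> Q (f i))"
  "(\<forall>r\<in>{f' i j | i j. P' i j}. Q r) \<longleftrightarrow> (\<forall>i j. P' i j \<longrightarrow> Q (f' i j))"
  by blast+

lemma ev_relators_iff:
  "(\<forall>r\<in>relators \<alpha> q \<kappa> \<kappa>'. ev Z r = 0) \<longleftrightarrow> weak_relations \<alpha> q \<kappa> \<kappa>' Z"
  unfolding relators_def ball_Un ball_image_collect weak_relations_def
  by (simp only: ev_simps ev_serre list.map prod_list.Cons prod_list.Nil mult_1_right scale_simps(4)
      right_minus_eq simp_thms scale.scale_right_diff_distrib conj_assoc)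

text \<open>The relators have no constant term. Therefore they vanish where all generators are 0, for
  instance in the components of \<open>emb\<close> at other algebras.\<close>

lemma relators_lookup_Nil: "r \<in> relators \<alpha> q \<kappa> \<kappa>' \<Longrightarrow> Poly_Mapping.lookup r [] = 0"
proof -
  have "Poly_Mapping.lookup (serre \<alpha> q G i j) [] = 0" for G i j
    by (simp add: serre_def Let_def lookup_sum lookup_single when_def)
  then have "\<forall>r\<in>relators \<alpha> q \<kappa> \<kappa>'. Poly_Mapping.lookup r [] = 0"
    unfolding relators_def ball_Un ball_image_collect
    by (simp add: lookup_minus lookup_single when_def)
  then show "r \<in> relators \<alpha> q \<kappa> \<kappa>' \<Longrightarrow> Poly_Mapping.lookup r [] = 0" by blast
qed

lemma free_minus: "f \<ominus>\<^bsub>free_algebra\<^esub> g = f - g"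
  by (simp add: a_minus_def monoid_algebra_uminus[OF monoid_word])

lemma relation_ideal: "ideal (relation_ideal \<alpha> q \<kappa> \<kappa>') free_algebra"
  unfolding relation_ideal_def
  by (rule ring.genideal_ideal[OF unital_algebraD(2)[OF unital_free]]) simp

lemma relators_in_ideal: "r \<in> relators \<alpha> q \<kappa> \<kappa>' \<Longrightarrow> r \<in> relation_ideal \<alpha> q \<kappa> \<kappa>'"
  unfolding relation_ideal_def
  using ring.genideal_self[OF unital_algebraD(2)[OF unital_free], of "relators \<alpha> q \<kappa> \<kappa>'"] by auto

lemma relation_ideal_minimal:
  assumes "ideal I free_algebra" "relators \<alpha> q \<kappa> \<kappa>' \<subseteq> I"
  shows "relation_ideal \<alpha> q \<kappa> \<kappa>' \<subseteq> I"
  unfolding relation_ideal_def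
  by (rule ring.genideal_minimal[OF unital_algebraD(2)[OF unital_free] assms])

lemma free_idealI:
  fixes I :: "('g list \<Rightarrow>\<^sub>0 'k::field) set"
  assumes "0 \<in> I" "\<And>f g. f \<in> I \<Longrightarrow> g \<in> I \<Longrightarrow> f + g \<in> I" "\<And>f. f \<in> I \<Longrightarrow> - f \<in> I"
    "\<And>f g. f \<in> I \<Longrightarrow> g \<otimes>\<^bsub>free_algebra\<^esub> f \<in> I" "\<And>f g. f \<in> I \<Longrightarrow> f \<otimes>\<^bsub>free_algebra\<^esub> g \<in> I"
  shows "ideal I free_algebra"
proof (rule idealI)
  interpret ring "free_algebra :: ('k, 'g list \<Rightarrow>\<^sub>0 'k) module" by (rule unital_algebraD[OF unital_free])
  show "ring (free_algebra :: ('k, 'g list \<Rightarrow>\<^sub>0 'k) module)" ..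
  show "subgroup I (add_monoid (free_algebra :: ('k, 'g list \<Rightarrow>\<^sub>0 'k) module))"
  proof (rule add.subgroupI)
    fix f assume f: "f \<in> I"
    have "\<ominus>\<^bsub>free_algebra\<^esub> f = - f"
      by (rule monoid_algebra_uminus[OF monoid_word]) simp
    then show "\<ominus>\<^bsub>free_algebra\<^esub> f \<in> I" using f assms(3) by simp
  qed (use assms in auto)
qed (use assms in auto)

section \<open>The universal property\<close>

abbreviation coset :: "'a set \<Rightarrow> ('k::field, 'a) module \<Rightarrow> 'a \<Rightarrow> 'a set" where
  "coset I A x \<equiv> I +>\<^bsub>A\<^esub> x"

lemma unital_weak_quantum_algebra: "unital_algebra (weak_quantum_algebra \<alpha> q \<kappa> \<kappa>')"
  unfolding weak_quantum_algebra_def by (rule unital_quotient_algebra[OF unital_free relation_ideal])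

lemmas weak_quantum_algebra_simps =
  quotient_algebra_simps[OF relation_ideal, folded weak_quantum_algebra_def]
  quotient_algebra_smult[OF unital_free relation_ideal, folded weak_quantum_algebra_def]

lemma generator_closed [simp]: "generator \<alpha> q \<kappa> \<kappa>' x \<in> carrier (weak_quantum_algebra \<alpha> q \<kappa> \<kappa>')"
  unfolding generator_def weak_quantum_algebra_simps(1) by (rule imageI) simp

lemma value_at_ev_generator:
  "value_at (weak_quantum_algebra \<alpha> q \<kappa> \<kappa>') (ev (\<lambda>x. emb (weak_quantum_algebra \<alpha> q \<kappa> \<kappa>') (generator \<alpha> q \<kappa> \<kappa>' x)) f)
    = coset (relation_ideal \<alpha> q \<kappa> \<kappa>') free_algebra f"
proof -
  define W where "W = weak_quantum_algebra \<alpha> q \<kappa> \<kappa>'"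
  define I where "I = relation_ideal \<alpha> q \<kappa> \<kappa>'"
  define Z where "Z = (\<lambda>x. emb W (generator \<alpha> q \<kappa> \<kappa>' x))"
  have W: "unital_algebra W" unfolding W_def by (rule unital_weak_quantum_algebra)
  note s = weak_quantum_algebra_simps[where \<alpha> = \<alpha> and q = q and \<kappa> = \<kappa> and \<kappa>' = \<kappa>', folded W_def I_def]
  note v = value_at_simps[OF W]
  have word: "value_at W (prod_list (map Z w)) = coset I free_algebra (word w)" for w
  proof (induction w)
    case Nil
    then show ?case by (simp add: v s)
  next
    case (Cons x w)
    have "value_at W (Z x) = coset I free_algebra (word [x])"
      unfolding Z_def by (subst value_at_emb[OF W]) (simp_all add: W_def, simp add: generator_def I_def)
    then show ?case using Cons
      by (simp add: v s(5) monoid_algebra_mult_simps)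
  qed
  have "Poly_Mapping.keys f \<subseteq> UNIV" by simp
  then have "value_at W (ev Z f) = coset I free_algebra f"
  proof (induction rule: poly_mapping_single_induct)
    case (single u c)
    have "value_at W (ev Z (Poly_Mapping.single u c)) = c \<odot>\<^bsub>W\<^esub> coset I free_algebra (word u)"
      by (simp add: ev_simps v word)
    also have "\<dots> = coset I free_algebra (Poly_Mapping.single u c)"
      by (subst s(6)) (simp_all add: pm_scale_simps)
    finally show ?case .
  next
    case (add f g)
    then show ?case by (simp add: ev_simps v s(4))
  qed (simp add: ev_simps v s)
  then show ?thesis by (simp add: W_def Z_def I_def)
qed

text \<open>The relations hold at the algebra itself because the ideal is divided out, and at all other
  algebras because relators have no constant term.\<close>

lemma weak_relations_generator:
  "weak_relations \<alpha> q \<kappa> \<kappa>' (\<lambda>x. emb (weak_quantum_algebra \<alpha> q \<kappa> \<kappa>') (generator \<alpha> q \<kappa> \<kappa>' x))"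
proof -
  define W where "W = weak_quantum_algebra \<alpha> q \<kappa> \<kappa>'"
  define Z where "Z = (\<lambda>x. emb W (generator \<alpha> q \<kappa> \<kappa>' x))"
  define I where "I = relation_ideal \<alpha> q \<kappa> \<kappa>'"
  have W: "unital_algebra W" unfolding W_def by (rule unital_weak_quantum_algebra)
  interpret ring W by (rule unital_algebraD[OF W])
  have gc: "generator \<alpha> q \<kappa> \<kappa>' x \<in> carrier W" for x by (simp add: W_def)
  have e: "emb W \<one>\<^bsub>W\<^esub> * Z x = Z x" for x
    unfolding Z_def by (simp add: gc flip: emb_mult[OF W])
  have e': "emb W \<one>\<^bsub>W\<^esub> * prod_list (map Z w) = prod_list (map Z w)" if "w \<noteq> []" for w
    using that e by (cases w) (simp_all flip: mult.assoc)
  have "ev Z r = 0" if r: "r \<in> relators \<alpha> q \<kappa> \<kappa>'" for r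
  proof -
    \<comment> \<open>so that the value at \<open>W\<close> determines \<open>ev Z r\<close>\<close>
    have "emb W \<one>\<^bsub>W\<^esub> * ev Z r = ev Z r"
      unfolding ev_def lin_ext_def sum_distrib_left
    proof (rule sum.cong)
      fix w assume "w \<in> Poly_Mapping.keys r"
      then have "w \<noteq> []" using relators_lookup_Nil[OF r] by (auto simp: in_keys_iff)
      then show "emb W \<one>\<^bsub>W\<^esub> * scale (poly_mapping.lookup r w) (prod_list (map Z w)) = scale (poly_mapping.lookup r w) (prod_list (map Z w))"
        by (simp add: scale_simps e')
    qed simp
    moreover have "value_at W (ev Z r) = \<zero>\<^bsub>W\<^esub>"
    proof -
      have "coset I free_algebra r = coset I free_algebra 0"
        using relators_in_ideal[OF r]
        by (subst quotient_eq_iff) (simp_all add: I_def relation_ideal free_minus)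
      then show ?thesis
        using value_at_ev_generator[of \<alpha> q \<kappa> \<kappa>' r] weak_quantum_algebra_simps(3)[where \<alpha> = \<alpha> and q = q and \<kappa> = \<kappa> and \<kappa>' = \<kappa>']
        by (simp add: W_def Z_def I_def)
    qed
    ultimately show ?thesis
      using emb_value_at(1)[OF W, of "ev Z r"] by (simp add: emb_zero[OF W])
  qed
  then show ?thesis
    unfolding Z_def W_def using ev_relators_iff by blast
qed

text \<open>The polynomials that evaluate to zero form an ideal that contains the relators.\<close>

lemma universal_property:
  assumes B: "unital_algebra B" and Z: "weak_relations \<alpha> q \<kappa> \<kappa>' Z"
  shows "\<exists>\<phi>\<in>algebra_homs (weak_quantum_algebra \<alpha> q \<kappa> \<kappa>') B. \<forall>x. \<phi> (generator \<alpha> q \<kappa> \<kappa>' x) = value_at B (Z x)"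
proof -
  define W where "W = weak_quantum_algebra \<alpha> q \<kappa> \<kappa>'"
  define I where "I = relation_ideal \<alpha> q \<kappa> \<kappa>'"
  interpret B: ring B by (rule unital_algebraD[OF B])
  note v = value_at_simps[OF B]
  note s = weak_quantum_algebra_simps[where \<alpha> = \<alpha> and q = q and \<kappa> = \<kappa> and \<kappa>' = \<kappa>', folded W_def I_def]
  have I: "ideal I free_algebra" by (simp add: I_def relation_ideal)
  define \<phi> where "\<phi> Y = value_at B (ev Z (SOME f. f \<in> Y))" for Y
  have "ideal {f. value_at B (ev Z f) = \<zero>\<^bsub>B\<^esub>} free_algebra"
  proof (rule free_idealI)
    fix f assume "f \<in> {f. value_at B (ev Z f) = \<zero>\<^bsub>B\<^esub>}"
    then show "- f \<in> {f. value_at B (ev Z f) = \<zero>\<^bsub>B\<^esub>}"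
      using ev_simps(3)[of Z 0 f] by (simp add: v ev_simps)
  qed (simp_all add: v ev_simps)
  moreover have "relators \<alpha> q \<kappa> \<kappa>' \<subseteq> {f. value_at B (ev Z f) = \<zero>\<^bsub>B\<^esub>}"
    using Z[folded ev_relators_iff] by (auto simp: v)
  ultimately have ker: "I \<subseteq> {f. value_at B (ev Z f) = \<zero>\<^bsub>B\<^esub>}"
    unfolding I_def by (rule relation_ideal_minimal)
  have \<phi>: "\<phi> (coset I free_algebra f) = value_at B (ev Z f)" for f
  proof -
    have "f \<in> coset I free_algebra f"
    proof -
      interpret I: ideal I free_algebra by (rule I)
      show ?thesis by (rule I.a_rcos_self) simp
    qed
    then have "(SOME g. g \<in> coset I free_algebra f) \<in> coset I free_algebra f" by (rule someI)
    then obtain h where h: "h \<in> I" "(SOME g. g \<in> coset I free_algebra f) = h + f"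
      by (auto simp: a_r_coset_def')
    then have "value_at B (ev Z h) = \<zero>\<^bsub>B\<^esub>" using ker by blast
    then show ?thesis unfolding \<phi>_def h(2) by (simp add: ev_simps v)
  qed
  have c: "\<exists>f. x = coset I free_algebra f" if "x \<in> carrier W" for x
    using that unfolding s(1) by blast
  have "\<phi> \<in> linear_maps W B"
    unfolding linear_maps_def
    by (auto dest!: c simp: \<phi> s(4,6) v ev_simps)
  moreover have "\<phi> \<in> ring_hom W B"
    by (rule ring_hom_memI) (auto dest!: c simp: \<phi> s(2,4,5) v ev_simps scale_simps)
  moreover have "\<phi> (generator \<alpha> q \<kappa> \<kappa>' x) = value_at B (Z x)" for x
    unfolding generator_def I_def[symmetric] \<phi> by (simp add: ev_simps scale_simps)
  ultimately show ?thesis unfolding algebra_homs_def W_def by blast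
qed

lemma weak_quantum_algebra_induct [consumes 1, case_names one mult add smult]:
  assumes y: "y \<in> carrier (weak_quantum_algebra \<alpha> q \<kappa> \<kappa>')"
    and one: "P \<one>\<^bsub>weak_quantum_algebra \<alpha> q \<kappa> \<kappa>'\<^esub>"
    and mult: "\<And>x y. \<lbrakk>y \<in> carrier (weak_quantum_algebra \<alpha> q \<kappa> \<kappa>'); P y\<rbrakk> \<Longrightarrow>
      P (generator \<alpha> q \<kappa> \<kappa>' x \<otimes>\<^bsub>weak_quantum_algebra \<alpha> q \<kappa> \<kappa>'\<^esub> y)"
    and add: "\<And>x y. \<lbrakk>x \<in> carrier (weak_quantum_algebra \<alpha> q \<kappa> \<kappa>'); y \<in> carrier (weak_quantum_algebra \<alpha> q \<kappa> \<kappa>'); P x; P y\<rbrakk> \<Longrightarrow>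
      P (x \<oplus>\<^bsub>weak_quantum_algebra \<alpha> q \<kappa> \<kappa>'\<^esub> y)"
    and smult: "\<And>c y. \<lbrakk>y \<in> carrier (weak_quantum_algebra \<alpha> q \<kappa> \<kappa>'); P y\<rbrakk> \<Longrightarrow>
      P (c \<odot>\<^bsub>weak_quantum_algebra \<alpha> q \<kappa> \<kappa>'\<^esub> y)"
  shows "P y"
proof -
  let ?W = "weak_quantum_algebra \<alpha> q \<kappa> \<kappa>'" and ?I = "relation_ideal \<alpha> q \<kappa> \<kappa>'"
  note s = weak_quantum_algebra_simps[where \<alpha> = \<alpha> and q = q and \<kappa> = \<kappa> and \<kappa>' = \<kappa>']
  have word: "P (coset ?I free_algebra (word w))" for w
  proof (induction w)
    case Nil
    then show ?case using one by (simp add: s)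
  next
    case (Cons x w)
    have "coset ?I free_algebra (word w) \<in> carrier ?W" by (simp add: s)
    from mult[OF this Cons, of x] show ?case
      unfolding generator_def by (simp add: s(5) monoid_algebra_mult_simps)
  qed
  obtain f where f: "y = coset ?I free_algebra f" using y unfolding s(1) by blast
  have single: "P (coset ?I free_algebra (Poly_Mapping.single u c))" for u c
  proof -
    have "coset ?I free_algebra (word u) \<in> carrier ?W" by (simp add: s)
    from smult[OF this word, of c] show ?thesis by (simp add: s(6) pm_scale_simps)
  qed
  have "Poly_Mapping.keys f \<subseteq> UNIV" by simp
  then have "P (coset ?I free_algebra f)"
  proof (induction rule: poly_mapping_single_induct)
    case zero
    then show ?case using single[of "[]" 0] by simp
  next
    case (add f g)
    have "coset ?I free_algebra f \<in> carrier ?W" "coset ?I free_algebra g \<in> carrier ?W" by (simp_all add: s)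
    from assms(4)[OF this add(3,4)] show ?case by (simp add: s(4))
  qed (rule single)
  then show ?thesis by (simp add: f)
qed

section \<open>Consequences of the relations\<close>

lemma twist_mult_right:
  "\<lbrakk>u * l = scale c (l * u); v * l = scale d (l * v)\<rbrakk> \<Longrightarrow> (u * v) * l = scale (c * d) (l * (u * v))"
  by (simp add: mult.assoc scale_simps scale_assoc_rule mult.commute)

lemma twist_mult_left:
  "\<lbrakk>k * u = scale c (u * k); k * v = scale d (v * k)\<rbrakk> \<Longrightarrow> k * (u * v) = scale (c * d) ((u * v) * k)"
  by (simp add: mult.assoc scale_simps scale_assoc_rule)

lemma twist_cancel:
  assumes "k * u = scale c (u * k)" "l * u = scale (inverse c) (u * l)" "c \<noteq> 0"
  shows "(k * l) * u = u * (k * l)"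
  using assms(3) by (simp add: mult.assoc assms(1,2) scale_simps scale_assoc_rule[OF assms(1)])

locale weak_quantum_data = simple_root_data R \<alpha>
  for R :: "'v::euclidean_space set" and \<alpha> :: "'n::finite \<Rightarrow> 'v" +
  fixes q :: "'k::field_char_0" and \<kappa> \<kappa>' :: "'n \<Rightarrow> bool"
  assumes q_root_cond: "q_root \<alpha> q i \<noteq> 0 \<and> q_root \<alpha> q i \<noteq> 1 \<and> q_root \<alpha> q i \<noteq> - 1"
begin

abbreviation qi :: "'n \<Rightarrow> 'k" where "qi i \<equiv> q_root \<alpha> q i"
abbreviation qa :: "'n \<Rightarrow> 'n \<Rightarrow> 'k" where "qa i j \<equiv> q_root \<alpha> q i powi cartan \<alpha> i j"

lemma qi_nonzero: "qi i \<noteq> 0" using q_root_cond by blast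

lemma qa_nonzero: "qa i j \<noteq> 0" by (simp add: qi_nonzero)

lemma qa_sym: "qa j i = qa i j" by (rule q_root_sym)

lemma qa_diag: "qa i i = qi i ^ 2"
  by (simp add: cartan_diag)

lemma qa_minus: "q_root \<alpha> q i powi (- cartan \<alpha> i j) = inverse (qa i j)"
  by (simp add: power_int_minus)

lemma qi_power_qa:
  assumes "i \<noteq> j"
  shows "qi i ^ nat (1 - cartan \<alpha> i j) * qa i j = qi i"
proof -
  have "qi i ^ nat (1 - cartan \<alpha> i j) = qi i powi (1 - cartan \<alpha> i j)"
    using cartan_nonpos[OF assms] by (simp add: power_int_def)
  then show ?thesis using qi_nonzero[of i] by (simp flip: power_int_add)
qed

end

text \<open>Elements that satisfy the relations, such as the generators themselves. The derived rules hold for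
  both types of generators, so that the types hardly matter afterwards.\<close>

locale weak_quantum_relations = weak_quantum_data R \<alpha> q \<kappa> \<kappa>'
  for R :: "'v::euclidean_space set" and \<alpha> :: "'n::finite \<Rightarrow> 'v" and q :: "'k::field_char_0"
    and \<kappa> \<kappa>' +
  fixes Z :: "'n gen \<Rightarrow> ('k, 'b) family"
  assumes relations: "weak_relations \<alpha> q \<kappa> \<kappa>' Z"
begin

abbreviation "zE i \<equiv> Z (E i)"
abbreviation "zF i \<equiv> Z (F i)"
abbreviation "zK i \<equiv> Z (K i)"
abbreviation "zL i \<equiv> Z (Kbar i)"
abbreviation "zJ \<equiv> Z J"

lemmas relations1 = relations[unfolded weak_relations_def qa_minus]
lemmas relations2 = relations1[THEN conjunct2]
lemmas relations3 = relations2[THEN conjunct2]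
lemmas relations4 = relations3[THEN conjunct2]
lemmas relations5 = relations4[THEN conjunct2]
lemmas relations6 = relations5[THEN conjunct2]
lemmas relations7 = relations6[THEN conjunct2]
lemmas relations8 = relations7[THEN conjunct2]
lemmas relations9 = relations8[THEN conjunct2]
lemmas relations10 = relations9[THEN conjunct2]
lemmas relations11 = relations10[THEN conjunct2]
lemmas relations12 = relations11[THEN conjunct2]
lemmas relations13 = relations12[THEN conjunct2]
lemmas relations14 = relations13[THEN conjunct2]
lemmas relations15 = relations14[THEN conjunct2]
lemmas relations16 = relations15[THEN conjunct2]

lemmas basic = relations1[THEN conjunct1, rule_format] relations2[THEN conjunct1, rule_format] relations3[THEN conjunct1, rule_format] relations4[THEN conjunct1, rule_format] relations5[THEN conjunct1, rule_format] relations6[THEN conjunct1, rule_format]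
  relations13[THEN conjunct1, rule_format] relations14[THEN conjunct1, rule_format] relations15[THEN conjunct1, rule_format] relations16[rule_format]
lemmas type1 = relations7[THEN conjunct1, rule_format] relations8[THEN conjunct1, rule_format] relations10[THEN conjunct1, rule_format] relations11[THEN conjunct1, rule_format]
lemmas type2 = relations9[THEN conjunct1, rule_format] relations12[THEN conjunct1, rule_format]

lemma JK: "zK i * zJ = zK i" "zL i * zJ = zL i" "zJ * zJ = zJ" "zL i * zK i = zJ" "zK i * zL i = zJ"
proof -
  show 1: "zL i * zK i = zJ" "zK i * zL i = zJ" for i using basic(1)[of i] basic(2)[of i i] by simp_all
  show "zK i * zJ = zK i"
    by (metis basic(1-3,5) mult.assoc)
  show "zL i * zJ = zL i"
    by (metis 1 basic(4,6) mult.assoc)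
  show "zJ * zJ = zJ" using basic(1)[of i] basic(5) by (metis mult.assoc)
qed

text \<open>An element of type 2 is, up to a scalar, of the form \<open>K j * u * Kbar j\<close>, and \<open>K j\<close>, \<open>Kbar j\<close> absorb
  \<open>J\<close>.\<close>

lemma J_absorb:
  assumes "zK j * (u * zL j) = scale c u" "c \<noteq> 0"
  shows "zJ * u = u" "u * zJ = u"
proof -
  have u: "u = scale (inverse c) (zK j * (u * zL j))"
    using assms by (simp add: scale_simps)
  have "zJ * u = scale (inverse c) ((zJ * zK j) * (u * zL j))"
    by (subst u) (simp add: scale_simps mult.assoc)
  then show "zJ * u = u" using u by (simp add: basic)
  have "u * zJ = scale (inverse c) (zK j * (u * (zL j * zJ)))"
    by (subst u) (simp add: scale_simps mult.assoc)
  then show "u * zJ = u" using u by (simp add: JK)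
qed

lemma type2_J:
  "\<not> \<kappa> i \<Longrightarrow> zJ * zE i = zE i" "\<not> \<kappa> i \<Longrightarrow> zE i * zJ = zE i"
  "\<not> \<kappa>' i \<Longrightarrow> zJ * zF i = zF i" "\<not> \<kappa>' i \<Longrightarrow> zF i * zJ = zF i"
  using J_absorb[OF type2(1)] J_absorb[OF type2(2)] qa_nonzero by auto

lemma twist_from_type2:
  assumes u: "zK j * (u * zL j) = scale c u" "c \<noteq> 0"
  shows "zK j * u = scale c (u * zK j)" "u * zL j = scale c (zL j * u)"
proof -
  note J = J_absorb[OF u]
  have "zK j * u = zK j * (u * (zL j * zK j))" by (simp add: JK J)
  also have "\<dots> = (zK j * (u * zL j)) * zK j" by (simp add: mult.assoc)
  finally show "zK j * u = scale c (u * zK j)" by (simp add: u scale_simps)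
  have "u * zL j = (zL j * zK j) * (u * zL j)" by (simp add: JK J flip: mult.assoc)
  also have "\<dots> = zL j * (zK j * (u * zL j))" by (simp add: mult.assoc)
  finally show "u * zL j = scale c (zL j * u)" by (simp add: u scale_simps)
qed

text \<open>The commutation rules that are imposed for type 1 are consequences of the relations for type 2.\<close>

lemma twist:
  "zK j * zE i = scale (qa i j) (zE i * zK j)" "zE i * zL j = scale (qa i j) (zL j * zE i)"
  "zK j * zF i = scale (inverse (qa i j)) (zF i * zK j)" "zF i * zL j = scale (inverse (qa i j)) (zL j * zF i)"
proof -
  show
    "zK j * zE i = scale (qa i j) (zE i * zK j)" "zE i * zL j = scale (qa i j) (zL j * zE i)"
    "zK j * zF i = scale (inverse (qa i j)) (zF i * zK j)" "zF i * zL j = scale (inverse (qa i j)) (zL j * zF i)"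
    using type1[of i j] twist_from_type2[OF type2(1)[of i j]] twist_from_type2[OF type2(2)[of i j]] qa_nonzero[of i j] by auto
qed

lemma twist_inverse:
  "zL j * zE i = scale (inverse (qa i j)) (zE i * zL j)" "zL j * zF i = scale (qa i j) (zF i * zL j)"
  using qa_nonzero[of i j] by (simp_all add: twist scale_simps)

text \<open>Since \<open>J = K i * Kbar i\<close>, the two scalars cancel.\<close>

lemma J_central: "zJ * Z g = Z g * zJ"
proof -
  have "zJ * zE i = zE i * zJ" "zJ * zF i = zF i * zJ" for i
    unfolding basic(1)[of i] using qa_nonzero[of i i]
    by (rule twist_cancel[OF twist(1) twist_inverse(1)],
        intro twist_cancel[OF twist(3)]) (simp_all add: twist_inverse(2))
  then show ?thesis by (cases g) (simp_all add: basic JK)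
qed

text \<open>The commutators \<open>K i - Kbar i\<close> lie in the ideal of \<open>J\<close>.\<close>

lemma EF_commute_outside_J: "(zE i * zF j - zF j * zE i) * zJ = zE i * zF j - zF j * zE i"
proof (cases "i = j")
  case True
  then show ?thesis by (simp add: basic(8) scale_simps left_diff_distrib JK)
qed (simp add: basic)

end

section \<open>Existence of the structure maps\<close>

lemma unital_field_algebra: "unital_algebra (field_algebra :: ('k::field, 'k) module)"
proof -
  have ab: "abelian_group (field_algebra :: ('k::field, 'k) module)"
    by (rule abelian_groupI) (auto simp: field_algebra_def intro: exI[of _ "- _"])
  have mon: "Group.monoid (field_algebra :: ('k::field, 'k) module)"
    by (rule monoidI) (auto simp: field_algebra_def)
  have "ring (field_algebra :: ('k::field, 'k) module)"
    by (rule ringI[OF ab mon]) (auto simp: field_algebra_def algebra_simps)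
  moreover have "Module.module scalars (field_algebra :: ('k::field, 'k) module)"
    by (rule module_scalarsI[OF ab]) (auto simp: field_algebra_def algebra_simps)
  ultimately show ?thesis by (simp add: unital_algebra_def field_algebra_def)
qed

definition opposite :: "('k::field, 'a) module \<Rightarrow> ('k, 'a) module" where
  "opposite A = A\<lparr>mult := (\<lambda>x y. y \<otimes>\<^bsub>A\<^esub> x)\<rparr>"

lemma opposite_simps [simp]:
  "carrier (opposite A) = carrier A" "\<one>\<^bsub>opposite A\<^esub> = \<one>\<^bsub>A\<^esub>" "\<zero>\<^bsub>opposite A\<^esub> = \<zero>\<^bsub>A\<^esub>"
  "x \<oplus>\<^bsub>opposite A\<^esub> y = x \<oplus>\<^bsub>A\<^esub> y" "x \<otimes>\<^bsub>opposite A\<^esub> y = y \<otimes>\<^bsub>A\<^esub> x" "c \<odot>\<^bsub>opposite A\<^esub> x = c \<odot>\<^bsub>A\<^esub> x"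
  by (simp_all add: opposite_def)

lemma unital_opposite:
  assumes A: "unital_algebra A"
  shows "unital_algebra (opposite A)"
proof -
  interpret ring A by (rule unital_algebraD[OF A])
  note m = module_scalarsD[OF unital_algebraD(1)[OF A]]
  have ab: "abelian_group (opposite A)"
  proof (rule abelian_groupI)
    fix x assume "x \<in> carrier (opposite A)"
    then show "\<exists>y\<in>carrier (opposite A). y \<oplus>\<^bsub>opposite A\<^esub> x = \<zero>\<^bsub>opposite A\<^esub>"
      by (intro bexI[of _ "\<ominus>\<^bsub>A\<^esub> x"]) (simp_all add: l_neg)
  qed (simp_all add: a_ac)
  have mon: "Group.monoid (opposite A)"
    by (rule monoidI) (simp_all add: m_assoc)
  have "ring (opposite A)"
    by (rule ringI[OF ab mon]) (simp_all add: l_distr r_distr)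
  moreover have "Module.module scalars (opposite A)"
    by (rule module_scalarsI[OF ab]) (simp_all add: m)
  ultimately show ?thesis
    by (auto simp: unital_algebra_def unital_algebraD(3,4)[OF A])
qed

text \<open>An anti-homomorphism into \<open>A\<close> is a homomorphism into the opposite algebra, so the universal property
  also yields anti-homomorphisms.\<close>

definition to_opposite :: "('k::field, 'a) module \<Rightarrow> ('k, 'a) family \<Rightarrow> ('k, 'a) family" where
  "to_opposite A x = emb (opposite A) (value_at A x)"

lemma to_opposite_simps:
  assumes A: "unital_algebra A"
  shows "to_opposite A (x * y) = to_opposite A y * to_opposite A x"
    "to_opposite A (x + y) = to_opposite A x + to_opposite A y"
    "to_opposite A (- x) = - to_opposite A x"
    "to_opposite A (x - y) = to_opposite A x - to_opposite A y"
    "to_opposite A (scale c x) = scale c (to_opposite A x)" "to_opposite A 0 = 0"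
proof -
  note o = unital_opposite[OF A] and v = value_at_simps[OF A]
  have e: "emb (opposite A) (a \<otimes>\<^bsub>A\<^esub> b) = emb (opposite A) b * emb (opposite A) a"
    if "a \<in> carrier A" "b \<in> carrier A" for a b
    using emb_mult[OF o, of b a] that by simp
  have s: "emb (opposite A) (a \<oplus>\<^bsub>A\<^esub> b) = emb (opposite A) a + emb (opposite A) b"
    if "a \<in> carrier A" "b \<in> carrier A" for a b
    using emb_add[OF o, of a b] that by simp
  show "to_opposite A (x * y) = to_opposite A y * to_opposite A x"
    by (simp add: to_opposite_def v e)
  show add: "to_opposite A (x + y) = to_opposite A x + to_opposite A y" for x y
    by (simp add: to_opposite_def v s)
  show sc: "to_opposite A (scale c x) = scale c (to_opposite A x)" for c x
    using emb_scale[OF o, of "value_at A x" c] by (simp add: to_opposite_def v)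
  show m: "to_opposite A (- x) = - to_opposite A x" for x
    using sc[of "- 1" x] by simp
  show "to_opposite A (x - y) = to_opposite A x - to_opposite A y"
    using add[of x "- y"] m[of y] by simp
  show "to_opposite A 0 = 0" using sc[of 0 0] by simp
qed

text \<open>Reversing products turns the factor \<open>L - k R\<close> into \<open>R - k L\<close>, which is \<open>-k\<close> times the factor with
  scalar \<open>k\<^sup>-\<^sup>1\<close>. So the order of the exponents is reversed, and the two recursions correspond.\<close>

lemma q_serre_to_opposite:
  assumes A: "unital_algebra A" and x: "x \<noteq> 0" and z: "z \<noteq> 0"
  shows "\<exists>c. q_serre x z m (to_opposite A u) (to_opposite A v) = scale c (to_opposite A (q_serre x (inverse z) m u v))"
  using z
proof (induction m arbitrary: z v)
  case 0
  show ?case using x by (intro exI[of _ 1]) (simp add: scale_simps)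
next
  case (Suc m)
  note o = to_opposite_simps[OF A]
  define k where "k = z * inverse x ^ m"
  have k: "k \<noteq> 0" "inverse k = inverse z * x ^ m"
    using Suc.prems x by (simp_all add: k_def power_inverse)
  have "to_opposite A u * to_opposite A v - scale k (to_opposite A v * to_opposite A u) =
      scale (- k) (to_opposite A (u * v - scale (inverse k) (v * u)))"
    using k(1) by (simp add: o scale_simps scale.scale_right_diff_distrib)
  moreover have "z * x \<noteq> 0" using Suc.prems x by simp
  then obtain c where "q_serre x (z * x) m (to_opposite A u) (to_opposite A (u * v - scale (inverse k) (v * u))) =
      scale c (to_opposite A (q_serre x (inverse (z * x)) m u (u * v - scale (inverse k) (v * u))))"
    using Suc.IH by blast
  moreover have "q_serre x (inverse (z * x)) m u (u * v - scale (inverse k) (v * u)) = q_serre x (inverse z) (Suc m) u v"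
    unfolding q_serre_rec(2)[OF x] k(2) inverse_mult_distrib ..
  ultimately have "q_serre x z (Suc m) (to_opposite A u) (to_opposite A v) =
      scale (- k) (scale c (to_opposite A (q_serre x (inverse z) (Suc m) u v)))"
    unfolding q_serre_rec(1)[OF x] k_def[symmetric] by (simp only: q_serre_scale_right)
  then show ?case unfolding scale_simps(3) by blast
qed

definition pure_family :: "('k::field, 'a) module \<Rightarrow> ('k, 'b) module \<Rightarrow> ('k, 'a) family \<Rightarrow> ('k, 'b) family \<Rightarrow> ('k, (('a \<times> 'b) \<Rightarrow>\<^sub>0 'k) set) family" where
  "pure_family A B x y = emb (tensor A B) (pure_tensor A B (value_at A x) (value_at B y))"

context two_algebras
begin

lemma pure_family_simps:
  "pure_family A B x y * pure_family A B x' y' = pure_family A B (x * x') (y * y')"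
  "pure_family A B (x + x') y = pure_family A B x y + pure_family A B x' y"
  "pure_family A B x (y + y') = pure_family A B x y + pure_family A B x y'"
  "pure_family A B (scale c x) y = scale c (pure_family A B x y)"
  "pure_family A B x (scale c y) = scale c (pure_family A B x y)"
  "pure_family A B (x - x') y = pure_family A B x y - pure_family A B x' y"
  "pure_family A B x (y - y') = pure_family A B x y - pure_family A B x y'"
  "pure_family A B 0 y = 0" "pure_family A B x 0 = 0"
proof -
  note va = value_at_simps[OF A] and vb = value_at_simps[OF B] and e = emb_simps[OF unital_tensor]
  note b = bilinear_mapD[OF bilinear_pure]
  show "pure_family A B x y * pure_family A B x' y' = pure_family A B (x * x') (y * y')"
    by (simp add: pure_family_def va vb pure_mult flip: e(3))
  show a1: "pure_family A B (x + x') y = pure_family A B x y + pure_family A B x' y" for x x' y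
    by (simp add: pure_family_def va vb b e(2))
  show a2: "pure_family A B x (y + y') = pure_family A B x y + pure_family A B x y'" for x y y'
    by (simp add: pure_family_def va vb b e(2))
  show s1: "pure_family A B (scale c x) y = scale c (pure_family A B x y)" for c x y
    by (simp add: pure_family_def va vb b(4) e(5))
  show s2: "pure_family A B x (scale c y) = scale c (pure_family A B x y)" for c x y
    by (simp add: pure_family_def va vb b(5) e(5))
  show "pure_family A B (x - x') y = pure_family A B x y - pure_family A B x' y"
    using a1[of "x - x'" x' y] by simp
  show "pure_family A B x (y - y') = pure_family A B x y - pure_family A B x y'"
    using a2[of x "y - y'" y'] by simp
  show "pure_family A B 0 y = 0" "pure_family A B x 0 = 0"
    using s1[of 0 0 y] s2[of x 0 0] by simp_all
qed

lemma value_at_pure_family: "value_at (tensor A B) (pure_family A B x y) = pure_tensor A B (value_at A x) (value_at B y)"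
  unfolding pure_family_def by (rule value_at_emb[OF unital_tensor]) (simp add: value_at_closed[OF A] value_at_closed[OF B])

end

context weak_quantum_data
begin

abbreviation W :: "('k, ('n gen list \<Rightarrow>\<^sub>0 'k) set) module" where
  "W \<equiv> weak_quantum_algebra \<alpha> q \<kappa> \<kappa>'"
abbreviation g :: "'n gen \<Rightarrow> ('n gen list \<Rightarrow>\<^sub>0 'k) set" where
  "g \<equiv> generator \<alpha> q \<kappa> \<kappa>'"

lemmas unital_W = unital_weak_quantum_algebra[of \<alpha> q \<kappa> \<kappa>']

sublocale W: ring W by (rule unital_algebraD[OF unital_W])
sublocale WW: two_algebras W W by (rule two_algebras.intro[OF unital_W unital_W])

text \<open>The generators and the unit of the algebra as elements of the ring of families; \<open>eW\<close> is the unit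
  for them, but not of that ring.\<close>

definition gW :: "'n gen \<Rightarrow> ('k, ('n gen list \<Rightarrow>\<^sub>0 'k) set) family" where
  "gW y = emb W (g y)"

definition eW :: "('k, ('n gen list \<Rightarrow>\<^sub>0 'k) set) family" where
  "eW = emb W \<one>\<^bsub>W\<^esub>"

lemma value_at_gW: "value_at W (gW y) = g y"
  unfolding gW_def by (rule value_at_emb[OF unital_W]) simp

lemma value_at_eW: "value_at W eW = \<one>\<^bsub>W\<^esub>"
  unfolding eW_def by (rule value_at_emb[OF unital_W]) simp

lemma eW_gW: "eW * gW y = gW y" "gW y * eW = gW y" "eW * eW = eW"
  unfolding eW_def gW_def by (simp_all flip: emb_mult[OF unital_W])

end

sublocale weak_quantum_data \<subseteq> gen: weak_quantum_relations R \<alpha> q \<kappa> \<kappa>' gW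
  unfolding gW_def by unfold_locales (rule weak_relations_generator)

context weak_quantum_data
begin

text \<open>The grouplike elements that accompany \<open>E i\<close> and \<open>F i\<close> in the coproduct according to their type. They
  are central and absorbed by the respective generator.\<close>

definition xE :: "'n \<Rightarrow> ('k, ('n gen list \<Rightarrow>\<^sub>0 'k) set) family" where
  "xE i = (if \<kappa> i then eW else gW J)"
definition yF :: "'n \<Rightarrow> ('k, ('n gen list \<Rightarrow>\<^sub>0 'k) set) family" where
  "yF i = (if \<kappa>' i then eW else gW J)"

lemma xE_simps:
  "xE i * gW y = gW y * xE i" "gen.zK j * xE i = gen.zK j" "gen.zL j * xE i = gen.zL j"
  "gen.zE i * xE i = gen.zE i" "xE i * xE j = xE j * xE i" "gW J * xE i = gW J"
  by (simp_all add: xE_def eW_gW gen.J_central[of y] gen.JK gen.basic gen.type2_J)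

lemma yF_simps:
  "yF i * gW y = gW y * yF i" "gen.zK j * yF i = gen.zK j" "gen.zL j * yF i = gen.zL j"
  "gen.zF i * yF i = gen.zF i" "yF i * yF j = yF j * yF i" "gW J * yF i = gW J" "yF i * xE j = xE j * yF i"
  by (simp_all add: xE_def yF_def eW_gW gen.J_central[of y] gen.JK gen.basic gen.type2_J)

abbreviation p where "p \<equiv> pure_family W W"

fun coprod_of :: "'n gen \<Rightarrow> ('k, ((('n gen list \<Rightarrow>\<^sub>0 'k) set \<times> ('n gen list \<Rightarrow>\<^sub>0 'k) set) \<Rightarrow>\<^sub>0 'k) set) family" where
  "coprod_of (E i) = p (xE i) (gW (E i)) + p (gW (E i)) (gW (K i))"
| "coprod_of (F i) = p (gW (F i)) (yF i) + p (gW (Kbar i)) (gW (F i))"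
| "coprod_of (K i) = p (gW (K i)) (gW (K i))"
| "coprod_of (Kbar i) = p (gW (Kbar i)) (gW (Kbar i))"
| "coprod_of J = p (gW J) (gW J)"

lemma serre_pure_left:
  assumes "q_serre (qi i) 1 m u v = 0" "a * b = b * a"
  shows "q_serre (qi i) 1 m (p a u) (p b v) = 0"
  using q_serre_bimultiplicative[of "qi i" p a b 1 m u v] assms qi_nonzero
  by (simp add: WW.pure_family_simps)

lemma serre_pure_right:
  assumes "q_serre (qi i) 1 m u v = 0" "a * b = b * a"
  shows "q_serre (qi i) 1 m (p u a) (p v b) = 0"
  using q_serre_bimultiplicative[of "qi i" "\<lambda>a b. p b a" a b 1 m u v] assms qi_nonzero
  by (simp add: WW.pure_family_simps)

lemma coprod_of_twist:
  "coprod_of (K j) * coprod_of (E i) = scale (qa i j) (coprod_of (E i) * coprod_of (K j))"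
  "coprod_of (E i) * coprod_of (Kbar j) = scale (qa i j) (coprod_of (Kbar j) * coprod_of (E i))"
  "coprod_of (K j) * coprod_of (F i) = scale (inverse (qa i j)) (coprod_of (F i) * coprod_of (K j))"
  "coprod_of (F i) * coprod_of (Kbar j) = scale (inverse (qa i j)) (coprod_of (Kbar j) * coprod_of (F i))"
  by (simp_all add: WW.pure_family_simps distrib_left distrib_right scale_simps gen.basic gen.twist xE_simps yF_simps)

lemma coprod_of_J_absorb:
  "\<not> \<kappa> i \<Longrightarrow> coprod_of (E i) * coprod_of J = coprod_of (E i)" "\<not> \<kappa>' i \<Longrightarrow> coprod_of (F i) * coprod_of J = coprod_of (F i)"
  by (simp_all add: WW.pure_family_simps distrib_right gen.JK gen.type2_J xE_def yF_def)

text \<open>In \<open>\<Delta> (E i)\<close> the second summand passes the first with the scalar \<open>x\<^sup>2\<close>, and those for \<open>i\<close> and \<open>j\<close> pass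
  each other with \<open>x ^ cartan \<alpha> i j = x ^ (1 - m)\<close>, so that the sum rule applies.\<close>

lemma coprod_of_serre_E:
  assumes ij: "i \<noteq> j"
  shows "q_serre (qi i) 1 (nat (1 - cartan \<alpha> i j)) (coprod_of (E i)) (coprod_of (E j)) = 0"
proof -
  let ?m = "nat (1 - cartan \<alpha> i j)"
  note fp = WW.pure_family_simps
  have "q_serre (qi i) 1 ?m (coprod_of (E i)) (coprod_of (E j)) =
    q_serre (qi i) 1 ?m (p (xE i) (gW (E i))) (p (xE j) (gW (E j))) +
    q_serre (qi i) 1 ?m (p (gW (E i)) (gW (K i))) (p (gW (E j)) (gW (K j)))"
    unfolding coprod_of.simps
  proof (rule q_serre_sum)
    show "qi i \<noteq> 0" by (rule qi_nonzero)
    show "p (gW (E i)) (gW (K i)) * p (xE i) (gW (E i)) = scale ((qi i)\<^sup>2) (p (xE i) (gW (E i)) * p (gW (E i)) (gW (K i)))"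
      by (simp add: fp gen.twist(1)[of i i] xE_simps qa_diag)
    show "scale (qi i ^ ?m) (p (gW (E i)) (gW (K i)) * p (xE j) (gW (E j))) = scale (qi i) (p (xE j) (gW (E j)) * p (gW (E i)) (gW (K i)))"
      using qi_power_qa[OF ij] by (simp add: fp gen.twist(1)[of i j] xE_simps scale_simps qa_sym)
    show "scale (qi i ^ ?m) (p (gW (E j)) (gW (K j)) * p (xE i) (gW (E i))) = scale (qi i) (p (xE i) (gW (E i)) * p (gW (E j)) (gW (K j)))"
      using qi_power_qa[OF ij] by (simp add: fp gen.twist(1)[of j i] xE_simps scale_simps)
  qed
  also have "\<dots> = 0"
    using serre_pure_left[OF gen.basic(9)[OF ij] xE_simps(5)[of i j]]
      serre_pure_right[OF gen.basic(9)[OF ij] gen.basic(3)[of i j]] by simp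
  finally show ?thesis .
qed

lemma coprod_of_serre_F:
  assumes ij: "i \<noteq> j"
  shows "q_serre (qi i) 1 (nat (1 - cartan \<alpha> i j)) (coprod_of (F i)) (coprod_of (F j)) = 0"
proof -
  let ?m = "nat (1 - cartan \<alpha> i j)"
  note fp = WW.pure_family_simps
  note tw = gen.twist_inverse(2)
  have "q_serre (qi i) 1 ?m (coprod_of (F i)) (coprod_of (F j)) =
    q_serre (qi i) 1 ?m (p (gW (F i)) (yF i)) (p (gW (F j)) (yF j)) +
    q_serre (qi i) 1 ?m (p (gW (Kbar i)) (gW (F i))) (p (gW (Kbar j)) (gW (F j)))"
    unfolding coprod_of.simps
  proof (rule q_serre_sum)
    show "qi i \<noteq> 0" by (rule qi_nonzero)
    show "p (gW (Kbar i)) (gW (F i)) * p (gW (F i)) (yF i) = scale ((qi i)\<^sup>2) (p (gW (F i)) (yF i) * p (gW (Kbar i)) (gW (F i)))"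
      by (simp add: fp tw[of i i] yF_simps qa_diag)
    show "scale (qi i ^ ?m) (p (gW (Kbar i)) (gW (F i)) * p (gW (F j)) (yF j)) = scale (qi i) (p (gW (F j)) (yF j) * p (gW (Kbar i)) (gW (F i)))"
      using qi_power_qa[OF ij] by (simp add: fp tw[of i j] yF_simps scale_simps qa_sym)
    show "scale (qi i ^ ?m) (p (gW (Kbar j)) (gW (F j)) * p (gW (F i)) (yF i)) = scale (qi i) (p (gW (F i)) (yF i) * p (gW (Kbar j)) (gW (F j)))"
      using qi_power_qa[OF ij] by (simp add: fp tw[of j i] yF_simps scale_simps)
  qed
  also have "\<dots> = 0"
    using serre_pure_right[OF gen.basic(10)[OF ij] yF_simps(5)[of i j]]
      serre_pure_left[OF gen.basic(10)[OF ij] gen.basic(4)[of i j]] by simp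
  finally show ?thesis .
qed

text \<open>The mixed terms cancel: moving \<open>E i \<otimes> K i\<close> past \<open>Kbar j \<otimes> F j\<close> produces inverse scalars in the two
  tensor factors.\<close>

lemma coprod_of_commutator: "coprod_of (E i) * coprod_of (F j) - coprod_of (F j) * coprod_of (E i) =
   p (xE i * gen.zL j) (gen.zE i * gen.zF j - gen.zF j * gen.zE i) +
   p (gen.zE i * gen.zF j - gen.zF j * gen.zE i) (gen.zK i * yF j)"
proof -
  have "p (gen.zE i * gen.zL j) (gen.zK i * gen.zF j) = p (gen.zL j * gen.zE i) (gen.zF j * gen.zK i)"
    using qa_nonzero[of i j]
    by (simp add: gen.twist(2)[of i j] gen.twist(3)[of i j] WW.pure_family_simps scale_simps qa_sym)
  moreover have "p (xE i * gen.zF j) (gen.zE i * yF j) = p (gen.zF j * xE i) (yF j * gen.zE i)"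
    by (simp add: xE_simps yF_simps)
  ultimately show ?thesis
    by (simp add: WW.pure_family_simps distrib_left distrib_right xE_simps yF_simps algebra_simps)
qed

lemma weak_relations_coprod_of: "weak_relations \<alpha> q \<kappa> \<kappa>' coprod_of"
  unfolding weak_relations_def qa_minus
proof (intro conjI allI impI)
  fix i j
  note fp = WW.pure_family_simps
  show "coprod_of J = coprod_of (K i) * coprod_of (Kbar i)" "coprod_of (K i) * coprod_of (Kbar j) = coprod_of (Kbar j) * coprod_of (K i)"
    "coprod_of (K i) * coprod_of (K j) = coprod_of (K j) * coprod_of (K i)" "coprod_of (Kbar i) * coprod_of (Kbar j) = coprod_of (Kbar j) * coprod_of (Kbar i)"
    "coprod_of J * coprod_of (K i) = coprod_of (K i)" "coprod_of J * coprod_of (Kbar i) = coprod_of (Kbar i)"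
    by (simp_all add: fp gen.basic gen.JK)
  show "coprod_of (K j) * (coprod_of (E i) * coprod_of (Kbar j)) = scale (qa i j) (coprod_of (E i))" if "\<not> \<kappa> i"
  proof -
    have "coprod_of (K j) * (coprod_of (E i) * coprod_of (Kbar j)) = (coprod_of (K j) * coprod_of (E i)) * coprod_of (Kbar j)"
      by (simp only: mult.assoc)
    also have "\<dots> = scale (qa i j) (coprod_of (E i) * (coprod_of (K j) * coprod_of (Kbar j)))"
      unfolding coprod_of_twist(1) by (simp only: scale_simps mult.assoc)
    also have "coprod_of (K j) * coprod_of (Kbar j) = coprod_of J" by (simp add: fp gen.JK)
    finally show ?thesis unfolding coprod_of_J_absorb(1)[OF that] .
  qed
  show "coprod_of (K j) * (coprod_of (F i) * coprod_of (Kbar j)) = scale (inverse (qa i j)) (coprod_of (F i))" if "\<not> \<kappa>' i"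
  proof -
    have "coprod_of (K j) * (coprod_of (F i) * coprod_of (Kbar j)) = (coprod_of (K j) * coprod_of (F i)) * coprod_of (Kbar j)"
      by (simp only: mult.assoc)
    also have "\<dots> = scale (inverse (qa i j)) (coprod_of (F i) * (coprod_of (K j) * coprod_of (Kbar j)))"
      unfolding coprod_of_twist(3) by (simp only: scale_simps mult.assoc)
    also have "coprod_of (K j) * coprod_of (Kbar j) = coprod_of J" by (simp add: fp gen.JK)
    finally show ?thesis unfolding coprod_of_J_absorb(2)[OF that] .
  qed
  show "coprod_of (E i) * coprod_of (F j) = coprod_of (F j) * coprod_of (E i)" if "i \<noteq> j"
  proof -
    have "coprod_of (E i) * coprod_of (F j) - coprod_of (F j) * coprod_of (E i) = 0"
      unfolding coprod_of_commutator using gen.basic(7)[OF that] by (simp add: fp)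
    then show ?thesis by simp
  qed
  show "coprod_of (E i) * coprod_of (F i) - coprod_of (F i) * coprod_of (E i) = scale (1 / (qi i - inverse (qi i))) (coprod_of (K i) - coprod_of (Kbar i))"
  proof -
    have "xE i * gen.zL i = gen.zL i" by (simp add: xE_simps)
    then show ?thesis
      unfolding coprod_of_commutator gen.basic(8) by (simp add: fp yF_simps scale_simps scale.scale_right_diff_distrib)
  qed
  show "q_serre (qi i) 1 (nat (1 - cartan \<alpha> i j)) (coprod_of (E i)) (coprod_of (E j)) = 0" if "i \<noteq> j"
    by (rule coprod_of_serre_E[OF that])
  show "q_serre (qi i) 1 (nat (1 - cartan \<alpha> i j)) (coprod_of (F i)) (coprod_of (F j)) = 0" if "i \<noteq> j"
    by (rule coprod_of_serre_F[OF that])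
qed (simp_all only: coprod_of_twist)

lemma ex_comultiplication: "\<exists>\<Delta>. is_comultiplication W g \<kappa> \<kappa>' \<Delta>"
proof -
  obtain \<Delta> where d: "\<Delta> \<in> algebra_homs W (tensor W W)" "\<And>x. \<Delta> (g x) = value_at (tensor W W) (coprod_of x)"
    using universal_property[OF WW.unital_tensor weak_relations_coprod_of] by blast
  have "is_comultiplication W g \<kappa> \<kappa>' \<Delta>"
    unfolding is_comultiplication_def
    by (simp add: d WW.value_at_pure_family value_at_gW value_at_simps[OF WW.unital_tensor] xE_def yF_def value_at_eW)
  then show ?thesis by blast
qed

fun counit_of :: "'n gen \<Rightarrow> ('k, 'k) family" where
  "counit_of (E i) = 0"
| "counit_of (F i) = 0"
| "counit_of (K i) = emb field_algebra 1"
| "counit_of (Kbar i) = emb field_algebra 1"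
| "counit_of J = emb field_algebra 1"

lemma ex_counit: "\<exists>\<epsilon>. is_counit W g \<epsilon>"
proof -
  have one: "emb field_algebra 1 * emb field_algebra 1 = (emb field_algebra 1 :: ('k, 'k) family)"
    using emb_mult[OF unital_field_algebra, of 1 1, symmetric] by (simp add: field_algebra_def)
  have "weak_relations \<alpha> q \<kappa> \<kappa>' counit_of"
    unfolding weak_relations_def by (simp add: one)
  from universal_property[OF unital_field_algebra this] obtain \<epsilon> where
    e: "\<epsilon> \<in> algebra_homs W field_algebra" "\<And>x. \<epsilon> (g x) = value_at field_algebra (counit_of x)" by blast
  have "value_at field_algebra (emb field_algebra 1) = (1::'k)" "value_at field_algebra 0 = (0::'k)"
    using value_at_emb[OF unital_field_algebra, of "1::'k"] value_at_zero[OF unital_field_algebra]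
    by (simp_all add: field_algebra_def)
  then have "is_counit W g \<epsilon>" unfolding is_counit_def by (simp add: e)
  then show ?thesis by blast
qed

fun antipode_of :: "'n gen \<Rightarrow> ('k, ('n gen list \<Rightarrow>\<^sub>0 'k) set) family" where
  "antipode_of (E i) = - (gW (E i) * gW (Kbar i))"
| "antipode_of (F i) = - (gW (K i) * gW (F i))"
| "antipode_of (K i) = gW (Kbar i)"
| "antipode_of (Kbar i) = gW (K i)"
| "antipode_of J = gW J"

lemma antipode_of_serre:
  assumes ij: "i \<noteq> j"
  shows "q_serre (qi i) 1 (nat (1 - cartan \<alpha> i j)) (antipode_of (E i)) (antipode_of (E j)) = 0"
    "q_serre (qi i) 1 (nat (1 - cartan \<alpha> i j)) (antipode_of (F i)) (antipode_of (F j)) = 0"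
proof -
  let ?m = "nat (1 - cartan \<alpha> i j)"
  have "\<exists>c w. q_serre (qi i) 1 ?m (gen.zE i * gen.zL i) (gen.zE j * gen.zL j) =
      scale c (q_serre (qi i) 1 ?m (gen.zE i) (gen.zE j) * w)"
    by (rule q_serre_twist[OF qi_nonzero gen.twist_inverse(1)[of i i] gen.twist_inverse(1)[of i j]])
      (simp_all add: gen.twist_inverse(1)[of j i] qa_sym gen.basic)
  then have 1: "q_serre (qi i) 1 ?m (gen.zE i * gen.zL i) (gen.zE j * gen.zL j) = 0"
    using gen.basic(9)[OF ij] by (auto simp: scale_simps)
  have m: "- u = scale (- 1) u" for u :: "('k, ('n gen list \<Rightarrow>\<^sub>0 'k) set) family" by simp
  show "q_serre (qi i) 1 ?m (antipode_of (E i)) (antipode_of (E j)) = 0"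
    unfolding antipode_of.simps m[of "gen.zE _ * gen.zL _"] q_serre_scale_both[OF qi_nonzero] 1 by simp
  have "\<exists>c w. q_serre (qi i) 1 ?m (gen.zF i * gen.zK i) (gen.zF j * gen.zK j) =
      scale c (q_serre (qi i) 1 ?m (gen.zF i) (gen.zF j) * w)"
    by (rule q_serre_twist[OF qi_nonzero gen.twist(3)[of i i] gen.twist(3)[of i j]])
      (simp_all add: gen.twist(3)[of j i] qa_sym gen.basic)
  then have 2: "q_serre (qi i) 1 ?m (gen.zF i * gen.zK i) (gen.zF j * gen.zK j) = 0"
    using gen.basic(10)[OF ij] by (auto simp: scale_simps)
  have n: "- (gen.zK i * gen.zF i) = scale (- inverse (qa i i)) (gen.zF i * gen.zK i)" for i
    by (simp add: gen.twist scale_simps)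
  show "q_serre (qi i) 1 ?m (antipode_of (F i)) (antipode_of (F j)) = 0"
    unfolding antipode_of.simps n q_serre_scale_both[OF qi_nonzero] 2 by simp
qed

text \<open>In the opposite order because \<open>T\<close> reverses products; \<open>K j\<close> and \<open>Kbar i\<close> can be pulled out since
  their scalars with \<open>E i\<close> and \<open>F j\<close> cancel.\<close>

lemma antipode_of_commutator:
  "antipode_of (F j) * antipode_of (E i) - antipode_of (E i) * antipode_of (F j) = gen.zK j * ((gen.zF j * gen.zE i - gen.zE i * gen.zF j) * gen.zL i)"
proof -
  have "gen.zE i * (gen.zL i * (gen.zK j * gen.zF j)) = gen.zK j * (gen.zE i * (gen.zF j * gen.zL i))"
  proof -
    have "gen.zE i * (gen.zL i * (gen.zK j * gen.zF j)) = gen.zE i * (gen.zK j * (gen.zL i * gen.zF j))"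
      by (simp only: mult.assoc[symmetric, of "gen.zL i"] mult.assoc[symmetric, of "gen.zK j" "gen.zL i"] gen.basic(2)[of j i])
    also have "\<dots> = scale (qa j i) (gen.zE i * gen.zK j * (gen.zF j * gen.zL i))"
      by (simp add: gen.twist_inverse(2)[of i j] scale_simps mult.assoc)
    also have "\<dots> = scale (qa i j) (gen.zE i * gen.zK j) * (gen.zF j * gen.zL i)"
      by (simp add: scale_simps qa_sym)
    also have "\<dots> = gen.zK j * (gen.zE i * (gen.zF j * gen.zL i))"
      by (simp only: gen.twist(1)[of j i, symmetric] mult.assoc)
    finally show ?thesis .
  qed
  then show ?thesis by (simp add: mult.assoc left_diff_distrib right_diff_distrib)
qed

lemma ex_antipode_map: "\<exists>T. is_antipode_map W g T"
proof -
  let ?o = "to_opposite W"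
  note o = to_opposite_simps[OF unital_W]
  have rel: "weak_relations \<alpha> q \<kappa> \<kappa>' (\<lambda>y. ?o (antipode_of y))"
    unfolding weak_relations_def qa_minus o(1)[symmetric] o(4,5)[symmetric]
  proof (intro conjI allI impI arg_cong[where f = ?o])
    fix i j
    show "antipode_of J = antipode_of (Kbar i) * antipode_of (K i)" "antipode_of (Kbar j) * antipode_of (K i) = antipode_of (K i) * antipode_of (Kbar j)"
      "antipode_of (K j) * antipode_of (K i) = antipode_of (K i) * antipode_of (K j)" "antipode_of (Kbar j) * antipode_of (Kbar i) = antipode_of (Kbar i) * antipode_of (Kbar j)"
      "antipode_of (K i) * antipode_of J = antipode_of (K i)" "antipode_of (Kbar i) * antipode_of J = antipode_of (Kbar i)"
      by (simp_all add: gen.basic gen.JK)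
    have tE: "antipode_of (E i) * antipode_of (K j) = scale (qa i j) (antipode_of (K j) * antipode_of (E i))"
      "antipode_of (Kbar j) * antipode_of (E i) = scale (qa i j) (antipode_of (E i) * antipode_of (Kbar j))" for i j
      using twist_mult_right[OF gen.twist(2)[of i j], of "gen.zL i" 1] twist_mult_left[OF gen.twist(1)[of j i], of "gen.zL i" 1]
      by (simp_all add: gen.basic(2) gen.basic(4)[of i j])
    have tF: "antipode_of (F i) * antipode_of (K j) = scale (inverse (qa i j)) (antipode_of (K j) * antipode_of (F i))"
      "antipode_of (Kbar j) * antipode_of (F i) = scale (inverse (qa i j)) (antipode_of (F i) * antipode_of (Kbar j))" for i j
      using twist_mult_right[of "gen.zK i" "gen.zL j" 1, OF _ gen.twist(4)[of i j]]
        twist_mult_left[of "gen.zK j" "gen.zK i" 1, OF _ gen.twist(3)[of j i]]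
      by (simp_all add: gen.basic(2) gen.basic(3)[of i j])
    show "antipode_of (E i) * antipode_of (K j) = scale (qa i j) (antipode_of (K j) * antipode_of (E i))"
      "antipode_of (Kbar j) * antipode_of (E i) = scale (qa i j) (antipode_of (E i) * antipode_of (Kbar j))" by (rule tE)+
    show "antipode_of (F i) * antipode_of (K j) = scale (inverse (qa i j)) (antipode_of (K j) * antipode_of (F i))"
      "antipode_of (Kbar j) * antipode_of (F i) = scale (inverse (qa i j)) (antipode_of (F i) * antipode_of (Kbar j))" by (rule tF)+
    show "antipode_of (Kbar j) * antipode_of (E i) * antipode_of (K j) = scale (qa i j) (antipode_of (E i))" if "\<not> \<kappa> i"
      unfolding tE(2) by (simp add: scale_simps mult.assoc gen.JK)
    show "antipode_of (Kbar j) * antipode_of (F i) * antipode_of (K j) = scale (inverse (qa i j)) (antipode_of (F i))" if "\<not> \<kappa>' i"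
      unfolding tF(2) using that by (simp add: scale_simps mult.assoc gen.JK gen.type2_J)
    show "antipode_of (F j) * antipode_of (E i) = antipode_of (E i) * antipode_of (F j)" if "i \<noteq> j"
      using antipode_of_commutator[of j i] gen.basic(7)[OF that] by simp
    show "antipode_of (F i) * antipode_of (E i) - antipode_of (E i) * antipode_of (F i) = scale (1 / (qi i - inverse (qi i))) (antipode_of (K i) - antipode_of (Kbar i))"
    proof -
      have "gen.zF i * gen.zE i - gen.zE i * gen.zF i = scale (- (1 / (qi i - inverse (qi i)))) (gen.zK i - gen.zL i)"
        using arg_cong[OF gen.basic(8)[of i], of uminus] by simp
      moreover have "gen.zK i * (gen.zL i * gen.zL i) = gen.zL i" "gen.zK i * (gen.zK i * gen.zL i) = gen.zK i"
        by (simp_all only: mult.assoc[symmetric, of "gen.zK i" "gen.zL i"] gen.JK gen.basic(6))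
      ultimately show ?thesis
        unfolding antipode_of_commutator
        by (simp add: scale_simps left_diff_distrib right_diff_distrib mult.assoc scale.scale_right_diff_distrib)
    qed
  next
    fix i j :: 'n assume ij: "i \<noteq> j"
    show "q_serre (qi i) 1 (nat (1 - cartan \<alpha> i j)) (?o (antipode_of (E i))) (?o (antipode_of (E j))) = 0"
      "q_serre (qi i) 1 (nat (1 - cartan \<alpha> i j)) (?o (antipode_of (F i))) (?o (antipode_of (F j))) = 0"
      using q_serre_to_opposite[OF unital_W qi_nonzero, of 1 i "nat (1 - cartan \<alpha> i j)"] antipode_of_serre[OF ij]
      by (metis inverse_1 one_neq_zero o(6) scale.scale_zero_right)+
  qed
  obtain T where T: "T \<in> algebra_homs W (opposite W)" "\<And>x. T (g x) = value_at (opposite W) (?o (antipode_of x))"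
    using universal_property[OF unital_opposite[OF unital_W] rel] by blast
  have v: "value_at (opposite W) (?o x) = value_at W x" for x
    unfolding to_opposite_def
    by (rule value_at_emb[OF unital_opposite[OF unital_W]]) (simp add: value_at_closed[OF unital_W])
  have "T \<in> algebra_antihoms W W"
    using T(1) unfolding algebra_homs_def algebra_antihoms_def linear_maps_def ring_hom_def by simp
  then have "is_antipode_map W g T"
    unfolding is_antipode_map_def by (simp add: T(2) v value_at_simps[OF unital_W] value_at_gW)
  then show ?thesis by blast
qed

end

section \<open>The bialgebra axioms\<close>

lemma algebra_homsD:
  assumes "f \<in> algebra_homs A B"
  shows "f \<in> linear_maps A B" "x \<in> carrier A \<Longrightarrow> f x \<in> carrier B"
    "\<lbrakk>x \<in> carrier A; y \<in> carrier A\<rbrakk> \<Longrightarrow> f (x \<oplus>\<^bsub>A\<^esub> y) = f x \<oplus>\<^bsub>B\<^esub> f y"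
    "x \<in> carrier A \<Longrightarrow> f (c \<odot>\<^bsub>A\<^esub> x) = c \<odot>\<^bsub>B\<^esub> f x"
    "\<lbrakk>x \<in> carrier A; y \<in> carrier A\<rbrakk> \<Longrightarrow> f (x \<otimes>\<^bsub>A\<^esub> y) = f x \<otimes>\<^bsub>B\<^esub> f y"
    "f \<one>\<^bsub>A\<^esub> = \<one>\<^bsub>B\<^esub>"
  using assms by (auto simp: algebra_homs_def linear_mapsD ring_hom_def)

lemma linear_maps_id: "id \<in> linear_maps A A" "(\<lambda>x. x) \<in> linear_maps A A"
  by (auto simp: linear_maps_def)

locale weak_hopf_data = weak_quantum_data R \<alpha> q \<kappa> \<kappa>'
  for R :: "'v::euclidean_space set" and \<alpha> :: "'n::finite \<Rightarrow> 'v" and q :: "'k::field_char_0"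
    and \<kappa> \<kappa>' +
  fixes \<Delta> \<epsilon> T
  assumes Delta: "is_comultiplication W g \<kappa> \<kappa>' \<Delta>" and eps: "is_counit W g \<epsilon>"
    and T: "is_antipode_map W g T"
begin

abbreviation "TT \<equiv> tensor W W"

sublocale WT: two_algebras W TT by (rule two_algebras.intro[OF unital_W WW.unital_tensor])
sublocale TW: two_algebras TT W by (rule two_algebras.intro[OF WW.unital_tensor unital_W])
sublocale WTT: ring "tensor W TT" by (rule unital_algebraD[OF WT.unital_tensor])

sublocale TTW: ring "tensor TT W" by (rule unital_algebraD[OF TW.unital_tensor])

lemmas mW = module_scalarsD[OF unital_algebraD(1)[OF unital_W]]
lemmas mWTT = module_scalarsD[OF unital_algebraD(1)[OF WT.unital_tensor]]

text \<open>The elements \<open>xE\<close> and \<open>yF\<close>, read in the algebra itself.\<close>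

definition xg where "xg i = (if \<kappa> i then \<one>\<^bsub>W\<^esub> else g J)"
definition yg where "yg i = (if \<kappa>' i then \<one>\<^bsub>W\<^esub> else g J)"

lemma xg_closed [simp]: "xg i \<in> carrier W" "yg i \<in> carrier W"
  by (simp_all add: xg_def yg_def)

lemma Delta_hom: "\<Delta> \<in> algebra_homs W TT"
  using Delta unfolding is_comultiplication_def by blast

lemmas Delta_simps = algebra_homsD[OF Delta_hom]

lemma Delta_gen:
  "\<Delta> (g J) = pure_tensor W W (g J) (g J)"
  "\<Delta> (g (K i)) = pure_tensor W W (g (K i)) (g (K i))"
  "\<Delta> (g (Kbar i)) = pure_tensor W W (g (Kbar i)) (g (Kbar i))"
  "\<Delta> (g (E i)) = pure_tensor W W (xg i) (g (E i)) \<oplus>\<^bsub>TT\<^esub> pure_tensor W W (g (E i)) (g (K i))"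
  "\<Delta> (g (F i)) = pure_tensor W W (g (F i)) (yg i) \<oplus>\<^bsub>TT\<^esub> pure_tensor W W (g (Kbar i)) (g (F i))"
  using Delta unfolding is_comultiplication_def xg_def yg_def by simp_all

lemma Delta_one: "\<Delta> \<one>\<^bsub>W\<^esub> = pure_tensor W W \<one>\<^bsub>W\<^esub> \<one>\<^bsub>W\<^esub>"
  by (simp add: Delta_simps WW.one_tensor)

lemma Delta_xg: "\<Delta> (xg i) = pure_tensor W W (xg i) (xg i)" "\<Delta> (yg i) = pure_tensor W W (yg i) (yg i)"
  by (simp_all add: xg_def yg_def Delta_gen Delta_one)

lemma eps_hom: "\<epsilon> \<in> algebra_homs W field_algebra"
  using eps unfolding is_counit_def by blast

lemma field_algebra_simps [simp]:
  "carrier field_algebra = UNIV" "mult field_algebra = (*)" "\<one>\<^bsub>field_algebra\<^esub> = 1" "\<zero>\<^bsub>field_algebra\<^esub> = 0"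
  "add field_algebra = (+)" "module.smult field_algebra = (*)"
  by (simp_all add: field_algebra_def)

lemmas eps_simps = algebra_homsD[OF eps_hom, simplified]

lemma eps_gen: "\<epsilon> (g J) = 1" "\<epsilon> (g (E i)) = 0" "\<epsilon> (g (F i)) = 0" "\<epsilon> (g (K i)) = 1" "\<epsilon> (g (Kbar i)) = 1"
  "\<epsilon> (xg i) = 1" "\<epsilon> (yg i) = 1"
  using eps unfolding is_counit_def xg_def yg_def by (simp_all add: eps_simps)

lemma counit_left_bilinear: "bilinear_map W W W (\<lambda>a b. \<epsilon> a \<odot>\<^bsub>W\<^esub> b)"
  by (rule bilinear_mapI) (simp_all add: mW eps_simps mult.commute flip: mW(5))

lemma counit_right_bilinear: "bilinear_map W W W (\<lambda>a b. \<epsilon> b \<odot>\<^bsub>W\<^esub> a)"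
  by (rule bilinear_mapI) (simp_all add: mW eps_simps mult.commute flip: mW(5))

lemma mult_smult: "\<lbrakk>x \<in> carrier W; y \<in> carrier W\<rbrakk> \<Longrightarrow> (c \<odot>\<^bsub>W\<^esub> x) \<otimes>\<^bsub>W\<^esub> (d \<odot>\<^bsub>W\<^esub> y) = (c * d) \<odot>\<^bsub>W\<^esub> (x \<otimes>\<^bsub>W\<^esub> y)"
  by (simp add: unital_algebraD(3,4)[OF unital_W] mW(2) mult.commute flip: mW(5))

lemma hom_eqI:
  assumes B: "unital_algebra B"
    and \<phi>: "\<phi> \<in> linear_maps W B" "\<And>x y. \<lbrakk>x \<in> carrier W; y \<in> carrier W\<rbrakk> \<Longrightarrow> \<phi> (x \<otimes>\<^bsub>W\<^esub> y) = \<phi> x \<otimes>\<^bsub>B\<^esub> \<phi> y"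
    and \<psi>: "\<psi> \<in> linear_maps W B" "\<And>x y. \<lbrakk>x \<in> carrier W; y \<in> carrier W\<rbrakk> \<Longrightarrow> \<psi> (x \<otimes>\<^bsub>W\<^esub> y) = \<psi> x \<otimes>\<^bsub>B\<^esub> \<psi> y"
    and one: "\<phi> \<one>\<^bsub>W\<^esub> = \<psi> \<one>\<^bsub>W\<^esub>" and gen: "\<And>y. \<phi> (g y) = \<psi> (g y)"
    and x: "x \<in> carrier W"
  shows "\<phi> x = \<psi> x"
  using x
  by (induction rule: weak_quantum_algebra_induct)
    (simp_all add: one gen \<phi>(2) \<psi>(2) linear_mapsD[OF \<phi>(1)] linear_mapsD[OF \<psi>(1)])

lemma counit_laws:
  assumes x: "x \<in> carrier W"
  shows "tensor_lift W (\<lambda>a b. \<epsilon> a \<odot>\<^bsub>W\<^esub> b) (\<Delta> x) = x" "tensor_lift W (\<lambda>a b. \<epsilon> b \<odot>\<^bsub>W\<^esub> a) (\<Delta> x) = x"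
proof -
  note l = WW.tensor_lift_linear[OF unital_W counit_left_bilinear]
  note r = WW.tensor_lift_linear[OF unital_W counit_right_bilinear]
  have lm: "tensor_lift W (\<lambda>a b. \<epsilon> a \<odot>\<^bsub>W\<^esub> b) (s \<otimes>\<^bsub>TT\<^esub> t) = tensor_lift W (\<lambda>a b. \<epsilon> a \<odot>\<^bsub>W\<^esub> b) s \<otimes>\<^bsub>W\<^esub> tensor_lift W (\<lambda>a b. \<epsilon> a \<odot>\<^bsub>W\<^esub> b) t"
    if "s \<in> carrier TT" "t \<in> carrier TT" for s t
    by (rule WW.tensor_lift_mult[OF unital_W counit_left_bilinear _ that]) (simp add: eps_simps mult_smult)
  have rm: "tensor_lift W (\<lambda>a b. \<epsilon> b \<odot>\<^bsub>W\<^esub> a) (s \<otimes>\<^bsub>TT\<^esub> t) = tensor_lift W (\<lambda>a b. \<epsilon> b \<odot>\<^bsub>W\<^esub> a) s \<otimes>\<^bsub>W\<^esub> tensor_lift W (\<lambda>a b. \<epsilon> b \<odot>\<^bsub>W\<^esub> a) t"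
    if "s \<in> carrier TT" "t \<in> carrier TT" for s t
    by (rule WW.tensor_lift_mult[OF unital_W counit_right_bilinear _ that]) (simp add: eps_simps mult_smult)
  note lp = WW.tensor_lift_pure[OF unital_W counit_left_bilinear]
  note rp = WW.tensor_lift_pure[OF unital_W counit_right_bilinear]
  show "tensor_lift W (\<lambda>a b. \<epsilon> a \<odot>\<^bsub>W\<^esub> b) (\<Delta> x) = x"
  proof (rule hom_eqI[OF unital_W linear_maps_comp[OF Delta_simps(1) l] _ linear_maps_id(2) _ _ _ x])
    fix y show "tensor_lift W (\<lambda>a b. \<epsilon> a \<odot>\<^bsub>W\<^esub> b) (\<Delta> (g y)) = g y"
      by (cases y) (simp_all add: Delta_gen lp linear_mapsD[OF l] eps_gen mW)
  qed (simp_all add: Delta_simps(2,5) Delta_one lm lp eps_simps mW)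
  show "tensor_lift W (\<lambda>a b. \<epsilon> b \<odot>\<^bsub>W\<^esub> a) (\<Delta> x) = x"
  proof (rule hom_eqI[OF unital_W linear_maps_comp[OF Delta_simps(1) r] _ linear_maps_id(2) _ _ _ x])
    fix y show "tensor_lift W (\<lambda>a b. \<epsilon> b \<odot>\<^bsub>W\<^esub> a) (\<Delta> (g y)) = g y"
      by (cases y) (simp_all add: Delta_gen rp linear_mapsD[OF r] eps_gen mW)
  qed (simp_all add: Delta_simps(2,5) Delta_one rm rp eps_simps mW)
qed

subsection \<open>Coassociativity\<close>

text \<open>The inner of the two nested bilinear extensions that make up the canonical map
  \<open>(\<ww> \<otimes> \<ww>) \<otimes> \<ww> \<rightarrow> \<ww> \<otimes> (\<ww> \<otimes> \<ww>)\<close>.\<close>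

definition assoc_inner where
  "assoc_inner c = tensor_lift (tensor W TT) (\<lambda>a b. pure_tensor W TT a (pure_tensor W W b c))"

lemmas bW = bilinear_mapD[OF WW.bilinear_pure]
lemmas bWT = bilinear_mapD[OF WT.bilinear_pure]
lemmas bTW = bilinear_mapD[OF TW.bilinear_pure]

lemma assoc_inner_bilinear:
  "c \<in> carrier W \<Longrightarrow> bilinear_map W W (tensor W TT) (\<lambda>a b. pure_tensor W TT a (pure_tensor W W b c))"
  by (rule bilinear_mapI) (simp_all add: bW bWT)

lemma assoc_inner_pure:
  "\<lbrakk>a \<in> carrier W; b \<in> carrier W; c \<in> carrier W\<rbrakk> \<Longrightarrow> assoc_inner c (pure_tensor W W a b) = pure_tensor W TT a (pure_tensor W W b c)"
  unfolding assoc_inner_def by (rule WW.tensor_lift_pure[OF WT.unital_tensor assoc_inner_bilinear])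

lemma assoc_inner_linear: "c \<in> carrier W \<Longrightarrow> assoc_inner c \<in> linear_maps TT (tensor W TT)"
  unfolding assoc_inner_def by (rule WW.tensor_lift_linear[OF WT.unital_tensor assoc_inner_bilinear])

lemma assoc_outer_bilinear: "bilinear_map TT W (tensor W TT) (\<lambda>t c. assoc_inner c t)"
proof (rule bilinear_mapI)
  fix t c c' assume t: "t \<in> carrier TT" and c: "c \<in> carrier W" "c' \<in> carrier W"
  show "assoc_inner (c \<oplus>\<^bsub>W\<^esub> c') t = assoc_inner c t \<oplus>\<^bsub>tensor W TT\<^esub> assoc_inner c' t"
    using t
  proof (induction rule: WW.tensor_induct)
    case (add s t)
    then show ?case
      using linear_mapsD[OF assoc_inner_linear] c by (simp add: WTT.a_ac)
  qed (use c in \<open>simp add: assoc_inner_pure bW bWT\<close>)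
next
  fix d t c assume t: "t \<in> carrier TT" and c: "c \<in> carrier W"
  show "assoc_inner (d \<odot>\<^bsub>W\<^esub> c) t = d \<odot>\<^bsub>tensor W TT\<^esub> assoc_inner c t"
    using t
  proof (induction rule: WW.tensor_induct)
    case (add s t)
    then show ?case
      using linear_mapsD[OF assoc_inner_linear] c by (simp add: mW mWTT)
  qed (use c in \<open>simp add: assoc_inner_pure bW bWT mW\<close>)
qed (use linear_mapsD[OF assoc_inner_linear] in \<open>auto\<close>)

lemma assoc_outer_mult:
  assumes s: "s \<in> carrier TT" and t: "t \<in> carrier TT" and c: "c \<in> carrier W" "d \<in> carrier W"
  shows "assoc_inner (c \<otimes>\<^bsub>W\<^esub> d) (s \<otimes>\<^bsub>TT\<^esub> t) = assoc_inner c s \<otimes>\<^bsub>tensor W TT\<^esub> assoc_inner d t"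
proof -
  note l = linear_mapsD[OF assoc_inner_linear]
  show ?thesis using s
  proof (induction rule: WW.tensor_induct)
    case (pure a b)
    show ?case using t
      by (induction rule: WW.tensor_induct)
        (use pure c in \<open>simp_all add: WW.pure_mult WT.pure_mult assoc_inner_pure WT.B.r_distr WTT.r_distr l\<close>)
  next
    case (add s s')
    then show ?case using t c by (simp add: WT.B.l_distr WTT.l_distr l)
  qed
qed

lemma tensor_assoc_eq: "tensor_assoc W = tensor_lift (tensor W TT) (\<lambda>t c. assoc_inner c t)"
  by (simp add: tensor_assoc_def assoc_inner_def)

lemmas Delta_id_bilinear = bilinear_comp[OF TW.bilinear_pure Delta_simps(1) linear_maps_id(2)]
lemmas id_Delta_bilinear = bilinear_comp[OF WT.bilinear_pure linear_maps_id(2) Delta_simps(1)]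

lemmas assoc_pure = TW.tensor_lift_pure[OF WT.unital_tensor assoc_outer_bilinear, folded tensor_assoc_eq]
lemmas assoc_linear = TW.tensor_lift_linear[OF WT.unital_tensor assoc_outer_bilinear, folded tensor_assoc_eq]
lemmas assoc_mult = TW.tensor_lift_mult[OF WT.unital_tensor assoc_outer_bilinear assoc_outer_mult, folded tensor_assoc_eq]

lemmas Di_pure = WW.tensor_lift_pure[OF TW.unital_tensor Delta_id_bilinear, folded tensor_map_def]
lemmas Di_linear = WW.tensor_lift_linear[OF TW.unital_tensor Delta_id_bilinear, folded tensor_map_def]
lemmas Di_mult = WW.tensor_lift_mult[OF TW.unital_tensor Delta_id_bilinear, folded tensor_map_def]
lemmas iD_pure = WW.tensor_lift_pure[OF WT.unital_tensor id_Delta_bilinear, folded tensor_map_def]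
lemmas iD_linear = WW.tensor_lift_linear[OF WT.unital_tensor id_Delta_bilinear, folded tensor_map_def]
lemmas iD_mult = WW.tensor_lift_mult[OF WT.unital_tensor id_Delta_bilinear, folded tensor_map_def]

text \<open>Both sides are composed of algebra homomorphisms, so they need only be compared on the
  generators.\<close>

lemma coassoc:
  assumes x: "x \<in> carrier W"
  shows "tensor_assoc W (tensor_map TT W \<Delta> id (\<Delta> x)) = tensor_map W TT id \<Delta> (\<Delta> x)"
  unfolding id_def
proof (rule hom_eqI[OF WT.unital_tensor
      linear_maps_comp[OF linear_maps_comp[OF Delta_simps(1) Di_linear] assoc_linear] _
      linear_maps_comp[OF Delta_simps(1) iD_linear] _ _ _ x])
  note dl = linear_mapsD[OF Di_linear] and il = linear_mapsD[OF iD_linear] and al = linear_mapsD[OF assoc_linear]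
    and nl = linear_mapsD[OF assoc_inner_linear]
  have dm: "tensor_map TT W \<Delta> (\<lambda>x. x) (s \<otimes>\<^bsub>TT\<^esub> t) = tensor_map TT W \<Delta> (\<lambda>x. x) s \<otimes>\<^bsub>tensor TT W\<^esub> tensor_map TT W \<Delta> (\<lambda>x. x) t"
    if "s \<in> carrier TT" "t \<in> carrier TT" for s t
    by (rule Di_mult[OF _ that]) (simp add: Delta_simps TW.pure_mult)
  have im: "tensor_map W TT (\<lambda>x. x) \<Delta> (s \<otimes>\<^bsub>TT\<^esub> t) = tensor_map W TT (\<lambda>x. x) \<Delta> s \<otimes>\<^bsub>tensor W TT\<^esub> tensor_map W TT (\<lambda>x. x) \<Delta> t"
    if "s \<in> carrier TT" "t \<in> carrier TT" for s t
    by (rule iD_mult[OF _ that]) (simp add: Delta_simps WT.pure_mult)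
  fix x y assume "x \<in> carrier W" "y \<in> carrier W"
  then show "tensor_assoc W (tensor_map TT W \<Delta> (\<lambda>x. x) (\<Delta> (x \<otimes>\<^bsub>W\<^esub> y))) =
      tensor_assoc W (tensor_map TT W \<Delta> (\<lambda>x. x) (\<Delta> x)) \<otimes>\<^bsub>tensor W TT\<^esub> tensor_assoc W (tensor_map TT W \<Delta> (\<lambda>x. x) (\<Delta> y))"
    "tensor_map W TT (\<lambda>x. x) \<Delta> (\<Delta> (x \<otimes>\<^bsub>W\<^esub> y)) = tensor_map W TT (\<lambda>x. x) \<Delta> (\<Delta> x) \<otimes>\<^bsub>tensor W TT\<^esub> tensor_map W TT (\<lambda>x. x) \<Delta> (\<Delta> y)"
    by (simp_all add: Delta_simps dm im dl assoc_mult)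
next
  note s = Di_pure assoc_pure iD_pure assoc_inner_pure
  show "tensor_assoc W (tensor_map TT W \<Delta> (\<lambda>x. x) (\<Delta> \<one>\<^bsub>W\<^esub>)) = tensor_map W TT (\<lambda>x. x) \<Delta> (\<Delta> \<one>\<^bsub>W\<^esub>)"
    by (simp add: Delta_one s)
  fix y
  note dl = linear_mapsD[OF Di_linear] and il = linear_mapsD[OF iD_linear] and al = linear_mapsD[OF assoc_linear]
    and nl = linear_mapsD[OF assoc_inner_linear]
  show "tensor_assoc W (tensor_map TT W \<Delta> (\<lambda>x. x) (\<Delta> (g y))) = tensor_map W TT (\<lambda>x. x) \<Delta> (\<Delta> (g y))"
    by (cases y) (simp_all add: Delta_gen Delta_xg s dl il al nl bW bWT bTW WTT.a_assoc)
qed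

lemma bialgebra: "bialgebra W \<Delta> \<epsilon>"
  unfolding bialgebra_def coalgebra_def
  using unital_W unital_algebraD(1)[OF unital_W] Delta_hom Delta_simps(1) eps_hom eps_simps(1) coassoc counit_laws
  by simp

section \<open>The weak antipode\<close>

lemma T_antihom: "T \<in> algebra_antihoms W W"
  using T unfolding is_antipode_map_def by blast

lemma T_linear: "T \<in> linear_maps W W" and T_one: "T \<one>\<^bsub>W\<^esub> = \<one>\<^bsub>W\<^esub>"
  and T_mult: "\<lbrakk>x \<in> carrier W; y \<in> carrier W\<rbrakk> \<Longrightarrow> T (x \<otimes>\<^bsub>W\<^esub> y) = T y \<otimes>\<^bsub>W\<^esub> T x"
  using T_antihom unfolding algebra_antihoms_def by auto

lemmas T_simps = linear_mapsD[OF T_linear] T_one T_mult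

lemma T_gen: "T (g J) = g J" "T (g (E i)) = \<ominus>\<^bsub>W\<^esub> (g (E i) \<otimes>\<^bsub>W\<^esub> g (Kbar i))"
  "T (g (F i)) = \<ominus>\<^bsub>W\<^esub> (g (K i) \<otimes>\<^bsub>W\<^esub> g (F i))" "T (g (K i)) = g (Kbar i)" "T (g (Kbar i)) = g (K i)"
  "T (xg i) = xg i" "T (yg i) = yg i"
  using T unfolding is_antipode_map_def xg_def yg_def by (simp_all add: T_one)

text \<open>A convolution is this map after \<open>\<Delta>\<close>; it avoids the intermediate tensor product of two maps.\<close>

definition fold_legs where
  "fold_legs u v t = tensor_lift W (\<lambda>a b. u a \<otimes>\<^bsub>W\<^esub> v b) t"

lemma mult_bilinear: "bilinear_map W W W (mult W)"
  by (rule bilinear_mapI) (simp_all add: W.l_distr W.r_distr unital_algebraD[OF unital_W])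

lemma fold_legs_bilinear:
  assumes "u \<in> linear_maps W W" "v \<in> linear_maps W W"
  shows "bilinear_map W W W (\<lambda>a b. u a \<otimes>\<^bsub>W\<^esub> v b)"
  by (rule bilinear_comp[OF mult_bilinear assms])

lemma fold_legs_linear:
  assumes "u \<in> linear_maps W W" "v \<in> linear_maps W W"
  shows "fold_legs u v \<in> linear_maps TT W"
  unfolding fold_legs_def by (rule WW.tensor_lift_linear[OF unital_W fold_legs_bilinear[OF assms]])

lemma fold_legs_pure:
  assumes "u \<in> linear_maps W W" "v \<in> linear_maps W W" "a \<in> carrier W" "b \<in> carrier W"
  shows "fold_legs u v (pure_tensor W W a b) = u a \<otimes>\<^bsub>W\<^esub> v b"
  unfolding fold_legs_def by (rule WW.tensor_lift_pure[OF unital_W fold_legs_bilinear[OF assms(1,2)] assms(3,4)])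

lemma convolution_eq:
  assumes u: "u \<in> linear_maps W W" and v: "v \<in> linear_maps W W" and x: "x \<in> carrier W"
  shows "convolution W \<Delta> u v x = fold_legs u v (\<Delta> x)"
proof -
  note b = bilinear_comp[OF WW.bilinear_pure u v]
  have l: "tensor_map W W u v \<in> linear_maps TT TT"
    unfolding tensor_map_def by (rule WW.tensor_lift_linear[OF WW.unital_tensor b])
  have "tensor_lift W (mult W) (tensor_map W W u v t) = fold_legs u v t" if "t \<in> carrier TT" for t
    by (rule WW.tensor_linear_eqI[OF linear_maps_comp[OF l WW.tensor_lift_linear[OF unital_W mult_bilinear]]
        fold_legs_linear[OF u v] _ that])
      (simp add: fold_legs_pure[OF u v] tensor_map_def WW.tensor_lift_pure[OF WW.unital_tensor b]
        WW.tensor_lift_pure[OF unital_W mult_bilinear] linear_mapsD[OF u] linear_mapsD[OF v])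
  then show ?thesis using x by (simp add: convolution_def Delta_simps)
qed

lemma convolution_linear:
  assumes u: "u \<in> linear_maps W W" and v: "v \<in> linear_maps W W"
  shows "convolution W \<Delta> u v \<in> linear_maps W W"
proof -
  have l: "(\<lambda>x. fold_legs u v (\<Delta> x)) \<in> linear_maps W W"
    by (rule linear_maps_comp[OF Delta_simps(1) fold_legs_linear[OF u v]])
  show ?thesis
    using linear_mapsD[OF l] unfolding linear_maps_def mem_Collect_eq Pi_iff
    by (simp add: convolution_eq[OF u v] mW)
qed

text \<open>If multiplying by a fixed \<open>d\<close> acts on pure tensors, after folding, as a linear map \<open>h\<close>, then it does so on
  all tensors, in particular on coproducts.\<close>

lemma fold_legs_step:
  assumes u: "u \<in> linear_maps W W" and v: "v \<in> linear_maps W W" and h: "h \<in> linear_maps W W"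
    and d: "d \<in> carrier TT" and t: "t \<in> carrier TT"
  shows fold_legs_step_left: "(\<And>a b. \<lbrakk>a \<in> carrier W; b \<in> carrier W\<rbrakk> \<Longrightarrow>
      fold_legs u v (d \<otimes>\<^bsub>TT\<^esub> pure_tensor W W a b) = h (u a \<otimes>\<^bsub>W\<^esub> v b)) \<Longrightarrow>
      fold_legs u v (d \<otimes>\<^bsub>TT\<^esub> t) = h (fold_legs u v t)"
    and fold_legs_step_right: "(\<And>a b. \<lbrakk>a \<in> carrier W; b \<in> carrier W\<rbrakk> \<Longrightarrow>
      fold_legs u v (pure_tensor W W a b \<otimes>\<^bsub>TT\<^esub> d) = h (u a \<otimes>\<^bsub>W\<^esub> v b)) \<Longrightarrow>
      fold_legs u v (t \<otimes>\<^bsub>TT\<^esub> d) = h (fold_legs u v t)"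
proof -
  note l = linear_mapsD[OF fold_legs_linear[OF u v]] and h' = linear_mapsD[OF h]
  { assume *: "\<And>a b. \<lbrakk>a \<in> carrier W; b \<in> carrier W\<rbrakk> \<Longrightarrow>
      fold_legs u v (d \<otimes>\<^bsub>TT\<^esub> pure_tensor W W a b) = h (u a \<otimes>\<^bsub>W\<^esub> v b)"
    show "fold_legs u v (d \<otimes>\<^bsub>TT\<^esub> t) = h (fold_legs u v t)"
      using t by (induction rule: WW.tensor_induct)
        (use d in \<open>simp_all add: * fold_legs_pure[OF u v] WT.B.r_distr l h'\<close>) }
  { assume *: "\<And>a b. \<lbrakk>a \<in> carrier W; b \<in> carrier W\<rbrakk> \<Longrightarrow>
      fold_legs u v (pure_tensor W W a b \<otimes>\<^bsub>TT\<^esub> d) = h (u a \<otimes>\<^bsub>W\<^esub> v b)"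
    show "fold_legs u v (t \<otimes>\<^bsub>TT\<^esub> d) = h (fold_legs u v t)"
      using t by (induction rule: WW.tensor_induct)
        (use d in \<open>simp_all add: * fold_legs_pure[OF u v] WT.B.l_distr l h'\<close>) }
qed

lemma emb_gen: "emb W (g y) = gW y" "emb W \<one>\<^bsub>W\<^esub> = eW"
  by (simp_all add: gW_def eW_def)

lemma emb_xg: "emb W (xg i) = xE i" "emb W (yg i) = yF i"
  by (simp_all add: xg_def yg_def xE_def yF_def emb_gen)

lemmas emb_W = emb_simps[OF unital_W]

lemma emb_T_gen: "emb W (T (g J)) = gW J" "emb W (T (g (E i))) = - (gen.zE i * gen.zL i)"
  "emb W (T (g (F i))) = - (gen.zK i * gen.zF i)" "emb W (T (g (K i))) = gen.zL i" "emb W (T (g (Kbar i))) = gen.zK i"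
  by (simp_all add: T_gen emb_W emb_gen)

lemma eq_if_emb_eq: "\<lbrakk>a \<in> carrier W; b \<in> carrier W; emb W a = emb W b\<rbrakk> \<Longrightarrow> a = b"
  by (metis value_at_emb[OF unital_W])

lemma emb_unit: "a \<in> carrier W \<Longrightarrow> eW * emb W a = emb W a" "a \<in> carrier W \<Longrightarrow> emb W a * eW = emb W a"
  by (simp_all add: eW_def flip: emb_W)

lemma J_central_emb:
  assumes "a \<in> carrier W"
  shows "gW J * emb W a = emb W a * gW J"
  using assms
proof (induction rule: weak_quantum_algebra_induct)
  case one
  show ?case by (simp add: emb_gen eW_gW)
next
  case (mult x y)
  have "gW J * (gW x * emb W y) = gW x * (gW J * emb W y)"
    by (simp only: mult.assoc[symmetric] gen.J_central[of x])
  then show ?case using mult by (simp add: emb_W emb_gen mult.assoc)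
qed (simp_all add: emb_W distrib_left distrib_right scale_simps)

text \<open>In a Hopf algebra these two would be \<open>x \<mapsto> \<epsilon> x 1\<close>. Here they are not scalar: for \<open>F i\<close> of type 1,
  the value of \<open>id * T\<close> is \<open>F i * (1 - J)\<close>.\<close>

definition id_conv_T where "id_conv_T = convolution W \<Delta> id T"
definition T_conv_id where "T_conv_id = convolution W \<Delta> T id"

lemma id_conv_T_linear: "id_conv_T \<in> linear_maps W W" and T_conv_id_linear: "T_conv_id \<in> linear_maps W W"
  unfolding id_conv_T_def T_conv_id_def by (rule convolution_linear[OF linear_maps_id(1) T_linear] convolution_linear[OF T_linear linear_maps_id(1)])+

lemma id_conv_T_eq: "x \<in> carrier W \<Longrightarrow> id_conv_T x = fold_legs id T (\<Delta> x)"
  and T_conv_id_eq: "x \<in> carrier W \<Longrightarrow> T_conv_id x = fold_legs T id (\<Delta> x)"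
  unfolding id_conv_T_def T_conv_id_def by (rule convolution_eq[OF linear_maps_id(1) T_linear] convolution_eq[OF T_linear linear_maps_id(1)], assumption)+

lemmas id_conv_T_simps = linear_mapsD[OF id_conv_T_linear]
lemmas T_conv_id_simps = linear_mapsD[OF T_conv_id_linear]

lemma sandwich_linear: "\<lbrakk>a \<in> carrier W; b \<in> carrier W\<rbrakk> \<Longrightarrow> (\<lambda>x. a \<otimes>\<^bsub>W\<^esub> x \<otimes>\<^bsub>W\<^esub> b) \<in> linear_maps W W"
  unfolding linear_maps_def by (simp add: W.l_distr W.r_distr unital_algebraD(3,4)[OF unital_W] mW)

lemma sandwich2_linear: "\<lbrakk>a \<in> carrier W; b \<in> carrier W; c \<in> carrier W; d \<in> carrier W\<rbrakk> \<Longrightarrow>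
  (\<lambda>x. a \<otimes>\<^bsub>W\<^esub> x \<otimes>\<^bsub>W\<^esub> b \<oplus>\<^bsub>W\<^esub> c \<otimes>\<^bsub>W\<^esub> x \<otimes>\<^bsub>W\<^esub> d) \<in> linear_maps W W"
  unfolding linear_maps_def by (simp add: W.l_distr W.r_distr unital_algebraD(3,4)[OF unital_W] mW W.a_ac)

lemma legs_id_T: "\<lbrakk>a \<in> carrier W; b \<in> carrier W\<rbrakk> \<Longrightarrow> fold_legs id T (pure_tensor W W a b) = a \<otimes>\<^bsub>W\<^esub> T b"
  by (simp add: fold_legs_pure[OF linear_maps_id(1) T_linear])
lemma legs_T_id: "\<lbrakk>a \<in> carrier W; b \<in> carrier W\<rbrakk> \<Longrightarrow> fold_legs T id (pure_tensor W W a b) = T a \<otimes>\<^bsub>W\<^esub> b"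
  by (simp add: fold_legs_pure[OF T_linear linear_maps_id(1)])

text \<open>Since \<open>T\<close> reverses products, a factor on the left of the argument ends up around the value.\<close>

lemma id_conv_T_grouplike:
  assumes u: "u \<in> carrier W" "\<Delta> u = pure_tensor W W u u" and y: "y \<in> carrier W"
  shows "id_conv_T (u \<otimes>\<^bsub>W\<^esub> y) = u \<otimes>\<^bsub>W\<^esub> id_conv_T y \<otimes>\<^bsub>W\<^esub> T u"
proof -
  have "fold_legs id T (pure_tensor W W u u \<otimes>\<^bsub>TT\<^esub> \<Delta> y) = u \<otimes>\<^bsub>W\<^esub> fold_legs id T (\<Delta> y) \<otimes>\<^bsub>W\<^esub> T u"
    by (rule fold_legs_step_left[OF linear_maps_id(1) T_linear sandwich_linear])
      (use u y in \<open>simp_all add: Delta_simps T_simps WW.pure_mult legs_id_T W.m_assoc\<close>)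
  then show ?thesis using u y by (simp add: id_conv_T_eq Delta_simps)
qed

lemma T_conv_id_grouplike:
  assumes u: "u \<in> carrier W" "\<Delta> u = pure_tensor W W u u" and y: "y \<in> carrier W"
  shows "T_conv_id (y \<otimes>\<^bsub>W\<^esub> u) = T u \<otimes>\<^bsub>W\<^esub> T_conv_id y \<otimes>\<^bsub>W\<^esub> u"
proof -
  have "fold_legs T id (\<Delta> y \<otimes>\<^bsub>TT\<^esub> pure_tensor W W u u) = T u \<otimes>\<^bsub>W\<^esub> fold_legs T id (\<Delta> y) \<otimes>\<^bsub>W\<^esub> u"
    by (rule fold_legs_step_right[OF T_linear linear_maps_id(1) sandwich_linear])
      (use u y in \<open>simp_all add: Delta_simps T_simps WW.pure_mult legs_T_id W.m_assoc\<close>)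
  then show ?thesis using u y by (simp add: T_conv_id_eq Delta_simps)
qed

lemma id_conv_T_two_terms:
  assumes u: "u \<in> carrier W" "u1 \<in> carrier W" "v1 \<in> carrier W" "u2 \<in> carrier W" "v2 \<in> carrier W"
    and d: "\<Delta> u = pure_tensor W W u1 v1 \<oplus>\<^bsub>TT\<^esub> pure_tensor W W u2 v2" and y: "y \<in> carrier W"
  shows "id_conv_T (u \<otimes>\<^bsub>W\<^esub> y) = u1 \<otimes>\<^bsub>W\<^esub> id_conv_T y \<otimes>\<^bsub>W\<^esub> T v1 \<oplus>\<^bsub>W\<^esub> u2 \<otimes>\<^bsub>W\<^esub> id_conv_T y \<otimes>\<^bsub>W\<^esub> T v2"
proof -
  note l = linear_mapsD[OF fold_legs_linear[OF linear_maps_id(1) T_linear]]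
  have "fold_legs id T ((pure_tensor W W u1 v1 \<oplus>\<^bsub>TT\<^esub> pure_tensor W W u2 v2) \<otimes>\<^bsub>TT\<^esub> \<Delta> y) =
      u1 \<otimes>\<^bsub>W\<^esub> fold_legs id T (\<Delta> y) \<otimes>\<^bsub>W\<^esub> T v1 \<oplus>\<^bsub>W\<^esub> u2 \<otimes>\<^bsub>W\<^esub> fold_legs id T (\<Delta> y) \<otimes>\<^bsub>W\<^esub> T v2"
    by (rule fold_legs_step_left[OF linear_maps_id(1) T_linear sandwich2_linear])
      (use u y in \<open>simp_all add: Delta_simps T_simps WW.pure_mult legs_id_T W.m_assoc WT.B.l_distr l\<close>)
  then show ?thesis using u y by (simp add: id_conv_T_eq Delta_simps d)
qed

lemma T_conv_id_two_terms:
  assumes u: "u \<in> carrier W" "u1 \<in> carrier W" "v1 \<in> carrier W" "u2 \<in> carrier W" "v2 \<in> carrier W"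
    and d: "\<Delta> u = pure_tensor W W u1 v1 \<oplus>\<^bsub>TT\<^esub> pure_tensor W W u2 v2" and y: "y \<in> carrier W"
  shows "T_conv_id (y \<otimes>\<^bsub>W\<^esub> u) = T u1 \<otimes>\<^bsub>W\<^esub> T_conv_id y \<otimes>\<^bsub>W\<^esub> v1 \<oplus>\<^bsub>W\<^esub> T u2 \<otimes>\<^bsub>W\<^esub> T_conv_id y \<otimes>\<^bsub>W\<^esub> v2"
proof -
  note l = linear_mapsD[OF fold_legs_linear[OF T_linear linear_maps_id(1)]]
  have "fold_legs T id (\<Delta> y \<otimes>\<^bsub>TT\<^esub> (pure_tensor W W u1 v1 \<oplus>\<^bsub>TT\<^esub> pure_tensor W W u2 v2)) =
      T u1 \<otimes>\<^bsub>W\<^esub> fold_legs T id (\<Delta> y) \<otimes>\<^bsub>W\<^esub> v1 \<oplus>\<^bsub>W\<^esub> T u2 \<otimes>\<^bsub>W\<^esub> fold_legs T id (\<Delta> y) \<otimes>\<^bsub>W\<^esub> v2"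
    by (rule fold_legs_step_right[OF T_linear linear_maps_id(1) sandwich2_linear])
      (use u y in \<open>simp_all add: Delta_simps T_simps WW.pure_mult legs_T_id W.m_assoc WT.B.r_distr l\<close>)
  then show ?thesis using u y by (simp add: T_conv_id_eq Delta_simps d)
qed

lemma id_conv_T_gen:
  assumes y: "y \<in> carrier W"
  shows "id_conv_T (g J \<otimes>\<^bsub>W\<^esub> y) = g J \<otimes>\<^bsub>W\<^esub> id_conv_T y \<otimes>\<^bsub>W\<^esub> T (g J)"
    "id_conv_T (g (K i) \<otimes>\<^bsub>W\<^esub> y) = g (K i) \<otimes>\<^bsub>W\<^esub> id_conv_T y \<otimes>\<^bsub>W\<^esub> T (g (K i))"
    "id_conv_T (g (Kbar i) \<otimes>\<^bsub>W\<^esub> y) = g (Kbar i) \<otimes>\<^bsub>W\<^esub> id_conv_T y \<otimes>\<^bsub>W\<^esub> T (g (Kbar i))"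
    "id_conv_T (xg i \<otimes>\<^bsub>W\<^esub> y) = xg i \<otimes>\<^bsub>W\<^esub> id_conv_T y \<otimes>\<^bsub>W\<^esub> T (xg i)"
    "id_conv_T (g (E i) \<otimes>\<^bsub>W\<^esub> y) = xg i \<otimes>\<^bsub>W\<^esub> id_conv_T y \<otimes>\<^bsub>W\<^esub> T (g (E i)) \<oplus>\<^bsub>W\<^esub> g (E i) \<otimes>\<^bsub>W\<^esub> id_conv_T y \<otimes>\<^bsub>W\<^esub> T (g (K i))"
    "id_conv_T (g (F i) \<otimes>\<^bsub>W\<^esub> y) = g (F i) \<otimes>\<^bsub>W\<^esub> id_conv_T y \<otimes>\<^bsub>W\<^esub> T (yg i) \<oplus>\<^bsub>W\<^esub> g (Kbar i) \<otimes>\<^bsub>W\<^esub> id_conv_T y \<otimes>\<^bsub>W\<^esub> T (g (F i))"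
  by (rule id_conv_T_grouplike id_conv_T_two_terms; simp add: Delta_gen Delta_xg y)+

lemma T_conv_id_gen:
  assumes y: "y \<in> carrier W"
  shows "T_conv_id (y \<otimes>\<^bsub>W\<^esub> g J) = T (g J) \<otimes>\<^bsub>W\<^esub> T_conv_id y \<otimes>\<^bsub>W\<^esub> g J"
    "T_conv_id (y \<otimes>\<^bsub>W\<^esub> g (K i)) = T (g (K i)) \<otimes>\<^bsub>W\<^esub> T_conv_id y \<otimes>\<^bsub>W\<^esub> g (K i)"
    "T_conv_id (y \<otimes>\<^bsub>W\<^esub> g (Kbar i)) = T (g (Kbar i)) \<otimes>\<^bsub>W\<^esub> T_conv_id y \<otimes>\<^bsub>W\<^esub> g (Kbar i)"
    "T_conv_id (y \<otimes>\<^bsub>W\<^esub> xg i) = T (xg i) \<otimes>\<^bsub>W\<^esub> T_conv_id y \<otimes>\<^bsub>W\<^esub> xg i"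
    "T_conv_id (y \<otimes>\<^bsub>W\<^esub> g (E i)) = T (xg i) \<otimes>\<^bsub>W\<^esub> T_conv_id y \<otimes>\<^bsub>W\<^esub> g (E i) \<oplus>\<^bsub>W\<^esub> T (g (E i)) \<otimes>\<^bsub>W\<^esub> T_conv_id y \<otimes>\<^bsub>W\<^esub> g (K i)"
    "T_conv_id (y \<otimes>\<^bsub>W\<^esub> g (F i)) = T (g (F i)) \<otimes>\<^bsub>W\<^esub> T_conv_id y \<otimes>\<^bsub>W\<^esub> yg i \<oplus>\<^bsub>W\<^esub> T (g (Kbar i)) \<otimes>\<^bsub>W\<^esub> T_conv_id y \<otimes>\<^bsub>W\<^esub> g (F i)"
  by (rule T_conv_id_grouplike T_conv_id_two_terms; simp add: Delta_gen Delta_xg y)+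

lemma id_conv_T_one: "id_conv_T \<one>\<^bsub>W\<^esub> = \<one>\<^bsub>W\<^esub>" and T_conv_id_one: "T_conv_id \<one>\<^bsub>W\<^esub> = \<one>\<^bsub>W\<^esub>"
  by (simp_all add: id_conv_T_eq T_conv_id_eq Delta_one legs_id_T legs_T_id T_one)

subsection \<open>The complement of J\<close>

text \<open>The unit is that of the ring of families; on elements of the algebra it acts as \<open>eW\<close>.\<close>

definition J_compl where "J_compl = 1 - gW J"

lemma J_compl_simps:
  "J_compl * gen.zK i = 0" "J_compl * gen.zL i = 0" "J_compl * gW y = gW y * J_compl" "gen.zL i * J_compl = 0" "gen.zK i * J_compl = 0" "gW J * J_compl = 0"
  "J_compl * yF i = yF i * J_compl" "J_compl * xE i = xE i * J_compl"
  by (simp_all add: J_compl_def left_diff_distrib right_diff_distrib gen.basic gen.JK gen.J_central[of y] xE_simps yF_simps flip: yF_simps(1)[of _ J] xE_simps(1)[of _ J])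

lemma J_compl_central_emb: "a \<in> carrier W \<Longrightarrow> J_compl * emb W a = emb W a * J_compl"
  by (simp add: J_compl_def left_diff_distrib right_diff_distrib J_central_emb)

lemma EF_commute_J_compl: "gen.zE i * (gen.zF j * J_compl) = gen.zF j * (gen.zE i * J_compl)"
proof -
  have "(gen.zE i * gen.zF j - gen.zF j * gen.zE i) * J_compl = 0"
    using gen.EF_commute_outside_J[of i j] by (simp add: J_compl_def right_diff_distrib)
  then show ?thesis by (simp add: left_diff_distrib mult.assoc)
qed

text \<open>The preceding rules in the ring of families, where the values of \<open>T\<close> on the generators are
  inserted.\<close>

lemma id_conv_T_typed:
  assumes y: "y \<in> carrier W"
  shows "emb W (id_conv_T (g J \<otimes>\<^bsub>W\<^esub> y)) = gW J * (emb W (id_conv_T y) * gW J)"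
    "emb W (id_conv_T (g (K i) \<otimes>\<^bsub>W\<^esub> y)) = gen.zK i * (emb W (id_conv_T y) * gen.zL i)"
    "emb W (id_conv_T (g (Kbar i) \<otimes>\<^bsub>W\<^esub> y)) = gen.zL i * (emb W (id_conv_T y) * gen.zK i)"
    "emb W (id_conv_T (xg i \<otimes>\<^bsub>W\<^esub> y)) = xE i * (emb W (id_conv_T y) * xE i)"
    "emb W (id_conv_T (g (E i) \<otimes>\<^bsub>W\<^esub> y)) = gen.zE i * (emb W (id_conv_T y) * gen.zL i) - xE i * (emb W (id_conv_T y) * (gen.zE i * gen.zL i))"
    "emb W (id_conv_T (g (F i) \<otimes>\<^bsub>W\<^esub> y)) = gen.zF i * (emb W (id_conv_T y) * yF i) - gen.zL i * (emb W (id_conv_T y) * (gen.zK i * gen.zF i))"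
  using y by (simp_all add: id_conv_T_gen emb_W emb_gen emb_xg emb_T_gen T_simps T_gen(6,7) id_conv_T_simps mult.assoc)

lemma T_conv_id_typed:
  assumes y: "y \<in> carrier W"
  shows "emb W (T_conv_id (y \<otimes>\<^bsub>W\<^esub> g J)) = gW J * (emb W (T_conv_id y) * gW J)"
    "emb W (T_conv_id (y \<otimes>\<^bsub>W\<^esub> g (K i))) = gen.zL i * (emb W (T_conv_id y) * gen.zK i)"
    "emb W (T_conv_id (y \<otimes>\<^bsub>W\<^esub> g (Kbar i))) = gen.zK i * (emb W (T_conv_id y) * gen.zL i)"
    "emb W (T_conv_id (y \<otimes>\<^bsub>W\<^esub> xg i)) = xE i * (emb W (T_conv_id y) * xE i)"
    "emb W (T_conv_id (y \<otimes>\<^bsub>W\<^esub> g (E i))) = xE i * (emb W (T_conv_id y) * gen.zE i) - gen.zE i * (gen.zL i * (emb W (T_conv_id y) * gen.zK i))"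
    "emb W (T_conv_id (y \<otimes>\<^bsub>W\<^esub> g (F i))) = gen.zK i * (emb W (T_conv_id y) * gen.zF i) - gen.zK i * (gen.zF i * (emb W (T_conv_id y) * yF i))"
  using y by (simp_all add: T_conv_id_gen emb_W emb_gen emb_xg emb_T_gen T_simps T_gen(6,7) T_conv_id_simps mult.assoc)

text \<open>On the complement of \<open>J\<close> all \<open>K i\<close> and \<open>Kbar i\<close> vanish. Of the rules for \<open>id * T\<close> only that for \<open>F j\<close>
  survives, and it multiplies by \<open>F j\<close>, which commutes with \<open>E k\<close> there.\<close>

lemma id_conv_T_commute_E:
  assumes "y \<in> carrier W"
  shows "emb W (id_conv_T y) * (gen.zE k * J_compl) = gen.zE k * (emb W (id_conv_T y) * J_compl)"
  using assms
proof (induction rule: weak_quantum_algebra_induct)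
  case one
  show ?case by (simp add: id_conv_T_one emb_gen flip: mult.assoc) (simp add: eW_gW)
next
  case (mult x y)
  have z: "gen.zL i * (gen.zE k * J_compl) = 0" "gen.zK i * (gen.zE k * J_compl) = 0" "gW J * (gen.zE k * J_compl) = 0"
    "gen.zK i * (gen.zF j * (gen.zE k * J_compl)) = 0" "gen.zK i * (gen.zF j * J_compl) = 0" for i j
  proof -
    have n: "gW y * J_compl = J_compl * gW y" "gW y * (J_compl * w) = J_compl * (gW y * w)" for y w
      by (simp_all only: mult.assoc[symmetric] J_compl_simps(3))
    have n0: "J_compl * (gen.zK i * w) = 0" "J_compl * (gen.zL i * w) = 0" "J_compl * (gW J * w) = 0" for i w
      by (simp_all add: J_compl_def left_diff_distrib gen.basic gen.JK flip: mult.assoc)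
    show "gen.zL i * (gen.zE k * J_compl) = 0" "gen.zK i * (gen.zE k * J_compl) = 0" "gW J * (gen.zE k * J_compl) = 0"
      "gen.zK i * (gen.zF j * (gen.zE k * J_compl)) = 0" "gen.zK i * (gen.zF j * J_compl) = 0" for i j
      by (simp_all add: n n0)
  qed
  show ?case
  proof (cases x)
    case (F j)
    have "emb W (id_conv_T y) * (yF j * (gen.zE k * J_compl)) = (emb W (id_conv_T y) * (gen.zE k * J_compl)) * yF j"
      by (simp only: mult.assoc J_compl_simps(7)) (simp only: mult.assoc[symmetric] yF_simps(1))
    also have "\<dots> = gen.zE k * (emb W (id_conv_T y) * (yF j * J_compl))"
      by (simp only: mult.IH mult.assoc J_compl_simps(7))
    finally have 1: "emb W (id_conv_T y) * (yF j * (gen.zE k * J_compl)) = gen.zE k * (emb W (id_conv_T y) * (yF j * J_compl))" .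
    have 2: "gen.zF j * (gen.zE k * (emb W (id_conv_T y) * (yF j * J_compl))) = gen.zE k * (gen.zF j * (emb W (id_conv_T y) * (yF j * J_compl)))"
    proof -
      have "emb W (id_conv_T y) * (yF j * J_compl) = J_compl * (emb W (id_conv_T y) * yF j)"
        using mult.hyps by (simp add: J_compl_central_emb J_compl_simps(7)[symmetric] id_conv_T_simps flip: mult.assoc)
      then show ?thesis using EF_commute_J_compl[of k j] by (simp flip: mult.assoc)
    qed
    show ?thesis unfolding F using mult.hyps
      by (simp add: id_conv_T_typed left_diff_distrib right_diff_distrib mult.assoc z 1 2)
  qed (use mult.hyps in \<open>simp_all add: id_conv_T_typed left_diff_distrib right_diff_distrib mult.assoc z J_compl_simps(4-6)\<close>)
qed (simp_all add: id_conv_T_simps emb_W distrib_left distrib_right scale_simps)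

text \<open>Words can also be built by attaching letters on the right.\<close>

lemma weak_quantum_algebra_induct_right [consumes 1, case_names one mult add smult]:
  assumes y: "y \<in> carrier W" and one: "P \<one>\<^bsub>W\<^esub>"
    and mult: "\<And>x y. \<lbrakk>y \<in> carrier W; P y\<rbrakk> \<Longrightarrow> P (y \<otimes>\<^bsub>W\<^esub> g x)"
    and add: "\<And>x y. \<lbrakk>x \<in> carrier W; y \<in> carrier W; P x; P y\<rbrakk> \<Longrightarrow> P (x \<oplus>\<^bsub>W\<^esub> y)"
    and smult: "\<And>c y. \<lbrakk>y \<in> carrier W; P y\<rbrakk> \<Longrightarrow> P (c \<odot>\<^bsub>W\<^esub> y)"
  shows "P y"
proof -
  have "\<forall>z\<in>carrier W. P z \<longrightarrow> P (z \<otimes>\<^bsub>W\<^esub> y)"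
    using y
  proof (induction rule: weak_quantum_algebra_induct)
    case (mult x y)
    then show ?case using assms(3) by (simp flip: W.m_assoc)
  qed (simp_all add: W.r_distr add smult unital_algebraD(4)[OF unital_W])
  then show ?thesis using one y by fastforce
qed

lemma left_mult_linear: "a \<in> carrier W \<Longrightarrow> (\<lambda>x. a \<otimes>\<^bsub>W\<^esub> x) \<in> linear_maps W W"
  unfolding linear_maps_def by (simp add: W.r_distr unital_algebraD(4)[OF unital_W] mW)

text \<open>By attaching generators on the left: convolving with \<open>id\<close> once more commutes with left multiplication by
  a generator \<open>g x\<close>. For a grouplike element the factors \<open>T u * u = J\<close> are absorbed.\<close>

lemma id_conv_T_convolution_id:
  assumes "y \<in> carrier W"
  shows "fold_legs id_conv_T (\<lambda>x. x) (\<Delta> y) = y"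
  using assms
proof (induction rule: weak_quantum_algebra_induct)
  note p = fold_legs_pure[OF id_conv_T_linear linear_maps_id(2)]
  note l = linear_mapsD[OF fold_legs_linear[OF id_conv_T_linear linear_maps_id(2)]]
  {
    case one
    show ?case by (simp add: Delta_one p id_conv_T_one)
  next
    case (add x y)
    then show ?case by (simp add: Delta_simps l)
  next
    case (smult c y)
    then show ?case by (simp add: Delta_simps l)
  next
    case (mult x y)
    have "fold_legs id_conv_T (\<lambda>x. x) (\<Delta> (g x) \<otimes>\<^bsub>TT\<^esub> pure_tensor W W a b) = g x \<otimes>\<^bsub>W\<^esub> (id_conv_T a \<otimes>\<^bsub>W\<^esub> b)"
      if ab: "a \<in> carrier W" "b \<in> carrier W" for a b
    proof (rule eq_if_emb_eq)
      let ?A = "emb W (id_conv_T a)" and ?B = "emb W b"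
      have JA: "gW J * (?A * w) = ?A * (gW J * w)" for w
        using J_central_emb[OF id_conv_T_simps(1)[OF ab(1)]] by (simp flip: mult.assoc)
      have LK: "gen.zL i * (gen.zK i * w) = gW J * w" "gen.zK i * (gen.zL i * w) = gW J * w" for i w
        by (simp_all add: gen.JK flip: mult.assoc)
      have KJ: "gen.zK i * (gW J * w) = gen.zK i * w" "gen.zL i * (gW J * w) = gen.zL i * w" "gW J * (gW J * w) = gW J * w" for i w
        by (simp_all add: gen.JK flip: mult.assoc)
      have eB: "eW * ?B = ?B" by (rule emb_unit[OF ab(2)])
      show "emb W (fold_legs id_conv_T (\<lambda>x. x) (\<Delta> (g x) \<otimes>\<^bsub>TT\<^esub> pure_tensor W W a b)) = emb W (g x \<otimes>\<^bsub>W\<^esub> (id_conv_T a \<otimes>\<^bsub>W\<^esub> b))"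
      proof (cases x)
        case (E i)
        have xE: "xE i * (gen.zE i * w) = gen.zE i * w" for w
          by (simp only: mult.assoc[symmetric] xE_simps(1,4))
        have c: "?A * (gen.zE i * (J_compl * w)) = gen.zE i * (?A * (J_compl * w))" for w
          using id_conv_T_commute_E[OF ab(1), of i] by (simp flip: mult.assoc)
        \<comment> \<open>The coproduct of \<open>E i\<close> contributes three terms, two of which combine to a multiple of \<open>1 - J\<close>;
        there \<open>E i\<close> moves to the left, and the part with \<open>J\<close> cancels the third term.\<close>
        have "xE i * (?A * (gen.zE i * ?B)) - xE i * (?A * (gen.zE i * (gW J * ?B))) = xE i * (?A * (gen.zE i * (J_compl * ?B)))"
          by (simp add: J_compl_def left_diff_distrib right_diff_distrib)
        also have "\<dots> = gen.zE i * (?A * ?B) - gen.zE i * (?A * (gW J * ?B))"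
          unfolding c xE by (simp add: J_compl_def left_diff_distrib right_diff_distrib)
        finally have "xE i * (?A * (gen.zE i * ?B)) + (gen.zE i * (?A * (gW J * ?B)) - xE i * (?A * (gen.zE i * (gW J * ?B)))) = gen.zE i * (?A * ?B)"
          by (simp add: algebra_simps)
        then show ?thesis unfolding E using ab
          by (simp add: Delta_gen WT.B.l_distr WW.pure_mult l p id_conv_T_simps emb_W emb_gen emb_xg id_conv_T_typed left_diff_distrib mult.assoc xE LK)
      next
        case (F i)
        have Fy: "gen.zF i * (yF i * w) = gen.zF i * w" for w
          by (simp add: yF_simps flip: mult.assoc)
        have FAy: "gen.zF i * (?A * (yF i * (yF i * ?B))) = gen.zF i * (?A * ?B)"
        proof (cases "\<kappa>' i")
          case True
          then show ?thesis by (simp add: yF_def eB)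
        next
          case False
          then have "gen.zF i * (gW J * w) = gen.zF i * w" for w
            by (simp add: gen.type2_J flip: mult.assoc)
          then show ?thesis using False by (simp add: yF_def KJ JA[symmetric])
        qed
        then show ?thesis unfolding F using ab
          by (simp add: Delta_gen WT.B.l_distr WW.pure_mult l p id_conv_T_simps emb_W emb_gen emb_xg id_conv_T_typed left_diff_distrib mult.assoc Fy)
      qed (use ab in \<open>simp_all add: Delta_gen WW.pure_mult p id_conv_T_simps emb_W emb_gen id_conv_T_typed mult.assoc LK KJ JA[symmetric]\<close>)
    qed (use ab in \<open>simp_all add: Delta_simps linear_mapsD(1)[OF fold_legs_linear[OF id_conv_T_linear linear_maps_id(2)]] id_conv_T_simps\<close>)
    then have "fold_legs id_conv_T (\<lambda>x. x) (\<Delta> (g x) \<otimes>\<^bsub>TT\<^esub> \<Delta> y) = g x \<otimes>\<^bsub>W\<^esub> fold_legs id_conv_T (\<lambda>x. x) (\<Delta> y)"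
      using mult.hyps by (intro fold_legs_step_left[OF id_conv_T_linear linear_maps_id(2) left_mult_linear]) (simp_all add: Delta_simps)
    then show ?case using mult by (simp add: Delta_simps)
  }
qed

text \<open>By attaching generators on the right. For \<open>E i\<close> and \<open>F i\<close> there are again three terms; two of them
  cancel because \<open>J\<close> is central.\<close>

lemma T_conv_id_convolution_T:
  assumes "y \<in> carrier W"
  shows "fold_legs T_conv_id T (\<Delta> y) = T y"
  using assms
proof (induction rule: weak_quantum_algebra_induct_right)
  note p = fold_legs_pure[OF T_conv_id_linear T_linear]
  note l = linear_mapsD[OF fold_legs_linear[OF T_conv_id_linear T_linear]]
  {
    case one
    show ?case by (simp add: Delta_one p T_conv_id_one T_one)
  next
    case (add x y)
    then show ?case by (simp add: Delta_simps l T_simps)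
  next
    case (smult c y)
    then show ?case by (simp add: Delta_simps l T_simps)
  next
    case (mult x y)
    have "fold_legs T_conv_id T (pure_tensor W W a b \<otimes>\<^bsub>TT\<^esub> \<Delta> (g x)) = T (g x) \<otimes>\<^bsub>W\<^esub> (T_conv_id a \<otimes>\<^bsub>W\<^esub> T b)"
      if ab: "a \<in> carrier W" "b \<in> carrier W" for a b
    proof (rule eq_if_emb_eq)
      let ?A = "emb W (T_conv_id a)" and ?B = "emb W (T b)"
      have JA: "gW J * (?A * w) = ?A * (gW J * w)" for w
        using J_central_emb[OF T_conv_id_simps(1)[OF ab(1)]] by (simp flip: mult.assoc)
      have LK: "gen.zL i * (gen.zK i * w) = gW J * w" "gen.zK i * (gen.zL i * w) = gW J * w" for i w
        by (simp_all add: gen.JK flip: mult.assoc)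
      have KJ: "gen.zK i * (gW J * w) = gen.zK i * w" "gen.zL i * (gW J * w) = gen.zL i * w" "gW J * (gW J * w) = gW J * w" for i w
        by (simp_all add: gen.JK flip: mult.assoc)
      have eB: "eW * ?B = ?B" by (rule emb_unit[OF T_simps(1)[OF ab(2)]])
      show "emb W (fold_legs T_conv_id T (pure_tensor W W a b \<otimes>\<^bsub>TT\<^esub> \<Delta> (g x))) = emb W (T (g x) \<otimes>\<^bsub>W\<^esub> (T_conv_id a \<otimes>\<^bsub>W\<^esub> T b))"
      proof (cases x)
        case (E i)
        have xE: "xE i * (gen.zE i * w) = gen.zE i * w" for w
          by (simp only: mult.assoc[symmetric] xE_simps(1,4))
        show ?thesis unfolding E using ab
          by (simp add: Delta_gen WT.B.r_distr WW.pure_mult l p T_conv_id_simps T_simps T_gen(6,7) emb_W emb_gen emb_xg emb_T_gen T_conv_id_typed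
              left_diff_distrib mult.assoc xE LK KJ JA[symmetric])
      next
        case (F i)
        have Fy: "gen.zF i * (yF i * w) = gen.zF i * w" for w
          by (simp add: yF_simps flip: mult.assoc)
        have FAy: "gen.zF i * (?A * (yF i * (yF i * ?B))) = gen.zF i * (?A * ?B)"
        proof (cases "\<kappa>' i")
          case True
          then show ?thesis by (simp add: yF_def eB)
        next
          case False
          then have "gen.zF i * (gW J * w) = gen.zF i * w" for w
            by (simp add: gen.type2_J flip: mult.assoc)
          then show ?thesis using False by (simp add: yF_def KJ JA[symmetric])
        qed
        then show ?thesis unfolding F using ab
          by (simp add: Delta_gen WT.B.r_distr WW.pure_mult l p T_conv_id_simps T_simps T_gen(6,7) emb_W emb_gen emb_xg emb_T_gen T_conv_id_typed
              left_diff_distrib mult.assoc Fy LK KJ JA[symmetric])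
      qed (use ab in \<open>simp_all add: Delta_gen WW.pure_mult p T_conv_id_simps T_simps emb_W emb_gen emb_T_gen T_conv_id_typed mult.assoc LK KJ JA[symmetric]\<close>)
    qed (use ab in \<open>simp_all add: Delta_simps linear_mapsD(1)[OF fold_legs_linear[OF T_conv_id_linear T_linear]] T_conv_id_simps T_simps\<close>)
    then have "fold_legs T_conv_id T (\<Delta> y \<otimes>\<^bsub>TT\<^esub> \<Delta> (g x)) = T (g x) \<otimes>\<^bsub>W\<^esub> fold_legs T_conv_id T (\<Delta> y)"
      using mult.hyps by (intro fold_legs_step_right[OF T_conv_id_linear T_linear left_mult_linear]) (simp_all add: Delta_simps T_simps)
    then show ?case using mult by (simp add: Delta_simps T_simps)
  }
qed

lemma weak_antipode: "weak_antipode W \<Delta> T"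
  unfolding weak_antipode_def id_conv_T_def[symmetric] T_conv_id_def[symmetric] unfolding id_def
  by (simp add: T_linear convolution_eq id_conv_T_linear T_conv_id_linear linear_maps_id id_conv_T_convolution_id T_conv_id_convolution_T)

text \<open>The element \<open>K i\<close> is grouplike, so an antipode would make it invertible on the right.\<close>

lemma not_hopf:
  assumes J: "g J \<noteq> \<one>\<^bsub>W\<^esub>"
  shows "\<not> hopf_algebra W \<Delta> \<epsilon>"
proof
  assume "hopf_algebra W \<Delta> \<epsilon>"
  then obtain S where S: "S \<in> linear_maps W W" "\<And>x. x \<in> carrier W \<Longrightarrow> convolution W \<Delta> id S x = \<epsilon> x \<odot>\<^bsub>W\<^esub> \<one>\<^bsub>W\<^esub>"
    unfolding hopf_algebra_def antipode_def by blast
  fix i :: 'n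
  have "g (K i) \<otimes>\<^bsub>W\<^esub> S (g (K i)) = \<one>\<^bsub>W\<^esub>"
    using S(2)[of "g (K i)"]
    by (simp add: convolution_eq[OF linear_maps_id(1) S(1)] Delta_gen fold_legs_pure[OF linear_maps_id(1) S(1)] eps_gen mW)
  moreover have "g J \<otimes>\<^bsub>W\<^esub> g (K i) = g (K i)"
    by (rule eq_if_emb_eq) (simp_all add: emb_W emb_gen gen.basic)
  ultimately have "g J = \<one>\<^bsub>W\<^esub>"
    by (metis W.m_assoc W.r_one generator_closed linear_mapsD(1)[OF S(1)])
  then show False using J by blast
qed

end

section \<open>Serre elements commute with the opposite generators\<close>

text \<open>Taking the commutator with \<open>e\<close> is a derivation that kills \<open>f\<close>, so it passes through every factor.\<close>

lemma q_serre_commutator: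
  fixes e f V :: "('k::field_char_0, 'a) family"
  assumes x: "x \<noteq> 0" and ef: "e * f = f * e"
  shows "e * q_serre x z m f V - q_serre x z m f V * e = q_serre x z m f (e * V - V * e)"
proof (induction m arbitrary: z V)
  case 0
  show ?case using x by simp
next
  case (Suc m)
  have ef': "e * (f * w) = f * (e * w)" for w using ef by (metis mult.assoc)
  have "e * (f * V - scale c (V * f)) - (f * V - scale c (V * f)) * e = f * (e * V - V * e) - scale c ((e * V - V * e) * f)" for c
    by (simp add: twist_simps ef ef')
  then show ?case unfolding q_serre_rec(1)[OF x] by (simp only: Suc.IH)
qed

text \<open>Stated for abstract \<open>e\<close>, \<open>u\<close>, \<open>h\<close>, \<open>h'\<close> because it is used in both directions, with \<open>u\<close> the \<open>F i\<close> and
  with \<open>u\<close> the \<open>E i\<close>. For \<open>k = i\<close> the defects of the factors sum to zero. For \<open>k = j\<close> the commutator is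
  the Serre element of \<open>u i\<close> on \<open>h j - h' j\<close>, and these two are annihilated by the two extreme
  factors.\<close>

lemma (in weak_quantum_data) q_serre_commute:
  fixes u e h h' :: "'n \<Rightarrow> ('k, 'b) family"
  assumes ij: "i \<noteq> j"
    and eu: "\<And>k l. e k * u l - u l * e k = (if k = l then h k - h' k else 0)"
    and hu: "\<And>k l. h k * u l = scale (inverse (qa l k)) (u l * h k)"
    and hu': "\<And>k l. h' k * u l = scale (qa l k) (u l * h' k)"
  shows "e k * q_serre (qi i) 1 (nat (1 - cartan \<alpha> i j)) (u i) (u j) = q_serre (qi i) 1 (nat (1 - cartan \<alpha> i j)) (u i) (u j) * e k"
proof -
  let ?m = "nat (1 - cartan \<alpha> i j)" and ?x = "qi i"
  note x = qi_nonzero[of i]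
  have xm: "?x ^ ?m * qa i j = ?x" by (rule qi_power_qa[OF ij])
  have qij: "qa i j \<noteq> 0" by (rule qa_nonzero)
  have xm': "?x * inverse (qa i j) = ?x ^ ?m" using xm qij by (simp add: field_simps)
  show ?thesis
  proof (cases "k = i")
    case True
    show ?thesis unfolding True
    proof (rule q_serre_derivation[OF x, where z = 1 and c = 0 and h = "h i" and h' = "h' i" and W = 0])
      show "e i * u i - u i * e i = h i - h' i" by (simp add: eu)
      show "h i * u i = scale ((inverse ?x)\<^sup>2) (u i * h i)" by (simp only: hu qa_diag power_inverse)
      show "h' i * u i = scale (?x\<^sup>2) (u i * h' i)" by (simp only: hu' qa_diag)
      show "scale (1 * ?x) (h i * u j) = scale (?x ^ ?m) (u j * h i)"
        by (simp only: hu qa_sym[of j i] scale_simps mult_1 xm')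
      show "scale (?x ^ ?m) (h' i * u j) = scale (1 * ?x) (u j * h' i)"
        by (simp only: hu' qa_sym[of j i] scale_simps mult_1 xm)
      show "e i * u j - u j * e i = scale 0 (0 * h i)" using ij by (simp add: eu)
      show "0 + exponent_defect ?x 1 ?m = 0" by (simp add: exponent_defect_zero[OF x])
    qed simp_all
  next
    case False
    have "e k * u i = u i * e k" using eu[of k i] False by simp
    then have 1: "e k * q_serre ?x 1 ?m (u i) (u j) - q_serre ?x 1 ?m (u i) (u j) * e k = q_serre ?x 1 ?m (u i) (e k * u j - u j * e k)"
      by (rule q_serre_commutator[OF x])
    have "q_serre ?x 1 ?m (u i) (e k * u j - u j * e k) = 0"
    proof (cases "k = j")
      case True
      obtain m' where m: "?m = Suc m'" using cartan_nonpos[OF ij] by (cases ?m) auto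
      have xm1: "?x ^ m' * qa i j = 1" using xm x by (simp add: m)
      then have xm2: "inverse (qa i j) = ?x ^ m'" using qij by (simp add: field_simps)
      have uh: "u i * h j = scale (qa i j) (h j * u i)" "u i * h' j = scale (inverse (qa i j)) (h' j * u i)"
        using qij by (simp_all add: hu[of j i] hu'[of j i] scale_simps)
      have "q_serre ?x 1 (Suc m') (u i) (h j) = 0"
        by (rule q_serre_eq_0_ascending[OF x]) (simp only: uh scale_simps xm1)
      moreover have "q_serre ?x 1 (Suc m') (u i) (h' j) = 0"
        by (rule q_serre_eq_0_descending[OF x]) (simp only: uh xm2 mult_1)
      moreover have "h j - h' j = h j + scale (- 1) (h' j)" by simp
      ultimately show ?thesis
        unfolding True eu m by (simp only: q_serre_add_right q_serre_scale_right if_True simp_thms) simp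
    qed (simp add: eu)
    then show ?thesis using 1 by simp
  qed
qed

section \<open>A Verma module\<close>

definition op_linear :: "(('b \<Rightarrow> 'k::field) \<Rightarrow> ('b \<Rightarrow> 'k)) \<Rightarrow> bool" where
  "op_linear A \<longleftrightarrow> (\<forall>c f h. A (\<lambda>w. c * f w + h w) = (\<lambda>w. c * A f w + A h w))"

lemma op_linearD:
  assumes "op_linear A"
  shows "A (\<lambda>w. c * f w + h w) = (\<lambda>w. c * A f w + A h w)" "A (\<lambda>w. f w + h w) = (\<lambda>w. A f w + A h w)"
    "A (\<lambda>w. 0) = (\<lambda>w. 0)" "A (\<lambda>w. c * f w) = (\<lambda>w. c * A f w)"
proof -
  have *: "A (\<lambda>w. c * f w + h w) = (\<lambda>w. c * A f w + A h w)" for c f h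
    using assms unfolding op_linear_def by blast
  show "A (\<lambda>w. c * f w + h w) = (\<lambda>w. c * A f w + A h w)" by (rule *)
  show "A (\<lambda>w. f w + h w) = (\<lambda>w. A f w + A h w)" using *[of 1 f h] by simp
  have "A (\<lambda>w. 0) = (\<lambda>w. - 1 * A (\<lambda>w. 0) w + A (\<lambda>w. 0) w)" using *[of "- 1" "\<lambda>w. 0" "\<lambda>w. 0"] by simp
  then show z: "A (\<lambda>w. 0) = (\<lambda>w. 0)" by simp
  show "A (\<lambda>w. c * f w) = (\<lambda>w. c * A f w)" using *[of c f "\<lambda>w. 0"] z by simp
qed

text \<open>The product is composition in reverse, so that a polynomial acts on functions from the right: this
  is the action on the dual of a left module.\<close>

definition operators :: "('k::field, ('b \<Rightarrow> 'k) \<Rightarrow> ('b \<Rightarrow> 'k)) module" where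
  "operators = \<lparr>carrier = {A. op_linear A}, mult = (\<lambda>A B f. B (A f)), one = (\<lambda>f. f),
     zero = (\<lambda>f w. 0), add = (\<lambda>A B f w. A f w + B f w), smult = (\<lambda>c A f w. c * A f w)\<rparr>"

lemma operators_simps [simp]:
  "A \<in> carrier operators \<longleftrightarrow> op_linear A" "A \<otimes>\<^bsub>operators\<^esub> B = (\<lambda>f. B (A f))" "\<one>\<^bsub>operators\<^esub> = (\<lambda>f. f)"
  "\<zero>\<^bsub>operators\<^esub> = (\<lambda>f w. 0)" "A \<oplus>\<^bsub>operators\<^esub> B = (\<lambda>f w. A f w + B f w)" "c \<odot>\<^bsub>operators\<^esub> A = (\<lambda>f w. c * A f w)"
  by (simp_all add: operators_def)

lemma unital_operators: "unital_algebra (operators :: ('k::field, ('b \<Rightarrow> 'k) \<Rightarrow> ('b \<Rightarrow> 'k)) module)"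
proof -
  have lin: "op_linear (\<lambda>f w. A f w + B f w)" "op_linear (\<lambda>f w. c * A f w)" "op_linear (\<lambda>f. B (A f))"
    if "op_linear A" "op_linear B" for c and A B :: "('b \<Rightarrow> 'k) \<Rightarrow> ('b \<Rightarrow> 'k)"
    using op_linearD[OF that(1)] op_linearD[OF that(2)] unfolding op_linear_def by (simp_all add: algebra_simps)
  have lin0: "op_linear (\<lambda>f w. 0 :: 'k)" "op_linear (\<lambda>f :: 'b \<Rightarrow> 'k. f)" unfolding op_linear_def by simp_all
  have ab: "abelian_group (operators :: ('k, ('b \<Rightarrow> 'k) \<Rightarrow> ('b \<Rightarrow> 'k)) module)"
  proof (rule abelian_groupI)
    fix A :: "('b \<Rightarrow> 'k) \<Rightarrow> ('b \<Rightarrow> 'k)" assume "A \<in> carrier operators"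
    then show "\<exists>B\<in>carrier operators. B \<oplus>\<^bsub>operators\<^esub> A = \<zero>\<^bsub>operators\<^esub>"
      using lin(2)[of A A "- 1"] by (intro bexI[of _ "\<lambda>f w. - 1 * A f w"]) simp_all
  qed (simp_all add: lin lin0 algebra_simps)
  have mon: "Group.monoid (operators :: ('k, ('b \<Rightarrow> 'k) \<Rightarrow> ('b \<Rightarrow> 'k)) module)"
    by (rule monoidI) (simp_all add: lin lin0)
  have "ring (operators :: ('k, ('b \<Rightarrow> 'k) \<Rightarrow> ('b \<Rightarrow> 'k)) module)"
    by (rule ringI[OF ab mon]) (simp_all add: op_linearD(2))
  moreover have "Module.module scalars (operators :: ('k, ('b \<Rightarrow> 'k) \<Rightarrow> ('b \<Rightarrow> 'k)) module)"
    by (rule module_scalarsI[OF ab]) (simp_all add: lin algebra_simps)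
  ultimately show ?thesis by (simp add: unital_algebra_def op_linearD(4))
qed

context weak_quantum_data
begin

text \<open>The eigenvalue of \<open>K i\<close> on the word \<open>F w\<close> applied to the vacuum of a Verma module. The value 2 on the
  vacuum is neither 1 nor its own inverse in characteristic 0. As it is not its own inverse,
  \<open>E i * F i\<close> and \<open>F i * E i\<close> differ on the vacuum; as it is not 1, the coefficients of \<open>K i\<close> and of
  the grouplike element \<open>xg i\<close> there are different.\<close>

fun weight :: "'n \<Rightarrow> 'n list \<Rightarrow> 'k" where
  "weight i [] = 2"
| "weight i (j # w) = inverse (qa j i) * weight i w"

lemma weight_nonzero: "weight i w \<noteq> 0"
  by (induction w) (simp_all add: qi_nonzero)

lemma qa_cancel: "inverse (qa i j) * (qa i j * z) = z" "qa i j * (inverse (qa i j) * z) = z"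
  by (metis qa_nonzero left_inverse mult.assoc mult_1) (metis qa_nonzero right_inverse mult.assoc mult_1)

definition EF_scale :: "'n \<Rightarrow> 'k" where "EF_scale i = 1 / (qi i - inverse (qi i))"

text \<open>The scalar by which \<open>E i * F i - F i * E i\<close> acts on the word \<open>w\<close>.\<close>

definition EF_weight :: "'n \<Rightarrow> 'n list \<Rightarrow> 'k" where "EF_weight i w = EF_scale i * (weight i w - inverse (weight i w))"

lemma EF_scale_nonzero: "EF_scale i \<noteq> 0"
proof
  assume "EF_scale i = 0"
  then have "qi i = inverse (qi i)" by (simp add: EF_scale_def)
  then have "qi i * qi i = 1" using qi_nonzero[of i] by (metis right_inverse)
  then have "(qi i - 1) * (qi i + 1) = 0" by (simp add: algebra_simps)
  then show False using q_root_cond[of i] by (auto simp: eq_neg_iff_add_eq_0)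
qed

text \<open>The Verma module has the words as a basis, and \<open>F i\<close> prepends a letter. The operators are the
  transposes of its generators on all functions on the words. In this way no quotient has to be formed: the
  module that satisfies the Serre relations is the submodule that the vacuum functional generates.\<close>

definition opF :: "'n \<Rightarrow> ('n list \<Rightarrow> 'k) \<Rightarrow> ('n list \<Rightarrow> 'k)" where "opF i f = (\<lambda>w. f (i # w))"
definition opK :: "'n \<Rightarrow> ('n list \<Rightarrow> 'k) \<Rightarrow> ('n list \<Rightarrow> 'k)" where "opK i f = (\<lambda>w. weight i w * f w)"
definition opL :: "'n \<Rightarrow> ('n list \<Rightarrow> 'k) \<Rightarrow> ('n list \<Rightarrow> 'k)" where "opL i f = (\<lambda>w. inverse (weight i w) * f w)"

text \<open>The transpose of the rule \<open>E i (F j w) = F j (E i w) + \<delta> i j (K i - Kbar i) w / (q i - q i\<^sup>-\<^sup>1)\<close>, with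
  \<open>E i\<close> zero on the empty word.\<close>

primrec opE' :: "'n \<Rightarrow> 'n list \<Rightarrow> ('n list \<Rightarrow> 'k) \<Rightarrow> 'k" where
  "opE' i [] f = 0"
| "opE' i (j # w) f = opE' i w (opF j f) + (if i = j then EF_weight i w * f w else 0)"

definition opE :: "'n \<Rightarrow> ('n list \<Rightarrow> 'k) \<Rightarrow> ('n list \<Rightarrow> 'k)" where "opE i f = (\<lambda>w. opE' i w f)"

lemma op_linear_ops: "op_linear (opF i)" "op_linear (opK i)" "op_linear (opL i)" "op_linear (opE i)"
proof -
  show "op_linear (opF i)" "op_linear (opK i)" "op_linear (opL i)"
    by (simp_all add: op_linear_def opF_def opK_def opL_def algebra_simps)
  have "opE' i w (\<lambda>w. c * f w + h w) = c * opE' i w f + opE' i w h" for w c f h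
    by (induction w arbitrary: f h) (simp_all add: opF_def algebra_simps)
  then show "op_linear (opE i)" by (simp add: op_linear_def opE_def)
qed

text \<open>Since \<open>E i\<close> removes a letter \<open>i\<close>, it changes a multiplicative weight by the factor of that letter.\<close>

lemma opE_weight:
  assumes m: "\<And>l w. \<mu> (l # w) = m l * \<mu> w" "m i \<noteq> 0"
  shows "opE i (\<lambda>w. \<mu> w * f w) = (\<lambda>w. inverse (m i) * \<mu> w * opE i f w)"
proof -
  have sc: "opE' i w (\<lambda>w. c * f w) = c * opE' i w f" for w c f
    using op_linearD(4)[OF op_linear_ops(4)[of i], of c f] by (simp add: opE_def fun_eq_iff)
  have "opE' i w (\<lambda>w. \<mu> w * f w) = inverse (m i) * \<mu> w * opE' i w f" for w
  proof (induction w arbitrary: f)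
    case (Cons l w)
    have "opF l (\<lambda>w. \<mu> w * f w) = (\<lambda>w. m l * (\<mu> w * opF l f w))" by (simp add: opF_def m mult.assoc)
    then show ?case using m(2) by (auto simp: sc Cons m(1) field_simps)
  qed simp
  then show ?thesis by (simp add: opE_def)
qed

lemma opE_opK: "opE i (opK j f) = (\<lambda>w. qa i j * opK j (opE i f) w)"
  using opE_weight[of "weight j" "\<lambda>l. inverse (qa l j)" i f] qa_nonzero[of i j] by (simp add: opK_def mult.assoc)

lemma opE_opL: "opL j (opE i f) = (\<lambda>w. qa i j * opE i (opL j f) w)"
  using opE_weight[of "\<lambda>w. inverse (weight j w)" "\<lambda>l. qa l j" i f] qa_nonzero[of i j]
  by (simp add: opL_def fun_eq_iff)

lemma opF_opK: "opF i (opK j f) = (\<lambda>w. inverse (qa i j) * opK j (opF i f) w)"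
  by (simp add: opF_def opK_def mult.assoc)

lemma opF_opL: "opL j (opF i f) = (\<lambda>w. inverse (qa i j) * opF i (opL j f) w)"
  by (simp add: opF_def opL_def mult.assoc qa_cancel)

lemma opF_opE: "opF j (opE i f) = (\<lambda>w. opE i (opF j f) w + (if i = j then EF_scale i * (opK i f w - opL i f w) else 0))"
  by (auto simp: opF_def opE_def opK_def opL_def EF_weight_def algebra_simps)

fun verma :: "'n gen \<Rightarrow> ('n list \<Rightarrow> 'k) \<Rightarrow> ('n list \<Rightarrow> 'k)" where
  "verma (E i) = opE i" | "verma (F i) = opF i" | "verma (K i) = opK i" | "verma (Kbar i) = opL i" | "verma J = (\<lambda>f. f)"

lemma verma_linear: "op_linear (verma y)"
  by (cases y) (simp_all add: op_linear_ops, simp add: op_linear_def)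

definition rho :: "'n gen \<Rightarrow> ('k, ('n list \<Rightarrow> 'k) \<Rightarrow> ('n list \<Rightarrow> 'k)) family" where
  "rho y = emb operators (verma y)"

lemma rho_equations:
  "rho (K i) * rho (Kbar i) = rho J" "rho (K i) * rho (Kbar j) = rho (Kbar j) * rho (K i)" "rho (K i) * rho (K j) = rho (K j) * rho (K i)"
  "rho (Kbar i) * rho (Kbar j) = rho (Kbar j) * rho (Kbar i)" "rho J * rho y = rho y" "rho y * rho J = rho y"
  "rho (K j) * rho (E i) = scale (qa i j) (rho (E i) * rho (K j))"
  "rho (E i) * rho (Kbar j) = scale (qa i j) (rho (Kbar j) * rho (E i))"
  "rho (K j) * rho (F i) = scale (inverse (qa i j)) (rho (F i) * rho (K j))"
  "rho (F i) * rho (Kbar j) = scale (inverse (qa i j)) (rho (Kbar j) * rho (F i))"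
  "rho (E i) * rho (F j) - rho (F j) * rho (E i) = (if i = j then scale (EF_scale i) (rho (K i) - rho (Kbar i)) else 0)"
proof -
  note e = emb_simps[OF unital_operators]
  have mult: "rho y * rho z = emb operators (\<lambda>f. verma z (verma y f))" for y z
    using e(3)[of "verma y" "verma z"] by (simp add: rho_def verma_linear)
  have comp_lin: "op_linear (\<lambda>f. verma z (verma y f))" for y z
    using verma_linear[of y] verma_linear[of z] unfolding op_linear_def by simp
  have sc: "scale c (rho y * rho z) = emb operators (\<lambda>f w. c * verma z (verma y f) w)" for c y z
    using e(5)[of "\<lambda>f. verma z (verma y f)" c] by (simp add: mult comp_lin)
  have eqI: "emb operators A = emb operators B" if "\<And>f. A f = B f" for A B :: "('n list \<Rightarrow> 'k) \<Rightarrow> ('n list \<Rightarrow> 'k)"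
    using that by (metis ext)
  show "rho (K i) * rho (Kbar i) = rho J" unfolding mult unfolding rho_def
    by (rule eqI) (simp add: opK_def opL_def weight_nonzero flip: mult.assoc)
  show "rho (K i) * rho (Kbar j) = rho (Kbar j) * rho (K i)" "rho (K i) * rho (K j) = rho (K j) * rho (K i)"
    "rho (Kbar i) * rho (Kbar j) = rho (Kbar j) * rho (Kbar i)" "rho J * rho y = rho y" "rho y * rho J = rho y"
    unfolding mult unfolding rho_def by (rule eqI; simp add: opK_def opL_def mult.left_commute)+
  show "rho (K j) * rho (E i) = scale (qa i j) (rho (E i) * rho (K j))" unfolding sc unfolding mult
    by (rule eqI) (simp only: verma.simps opE_opK)
  show "rho (E i) * rho (Kbar j) = scale (qa i j) (rho (Kbar j) * rho (E i))" unfolding sc unfolding mult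
    by (rule eqI) (simp only: verma.simps opE_opL)
  show "rho (K j) * rho (F i) = scale (inverse (qa i j)) (rho (F i) * rho (K j))" unfolding sc unfolding mult
    by (rule eqI) (simp only: verma.simps opF_opK)
  show "rho (F i) * rho (Kbar j) = scale (inverse (qa i j)) (rho (Kbar j) * rho (F i))" unfolding sc unfolding mult
    by (rule eqI) (simp only: verma.simps opF_opL)
  have "rho (E i) * rho (F j) = rho (F j) * rho (E i) + (if i = j then scale (EF_scale i) (rho (K i) - rho (Kbar i)) else 0)"
  proof (cases "i = j")
    case True
    have kl: "scale (EF_scale i) (rho (K i) - rho (Kbar i)) = emb operators (\<lambda>f w. EF_scale i * opK i f w + (- EF_scale i) * opL i f w)"
    proof -
      have "scale (EF_scale i) (rho (K i) - rho (Kbar i)) = scale (EF_scale i) (rho (K i)) + scale (- EF_scale i) (rho (Kbar i))"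
        by (simp add: scale.scale_right_diff_distrib)
      also have "\<dots> = emb operators (\<lambda>f w. EF_scale i * opK i f w) + emb operators (\<lambda>f w. (- EF_scale i) * opL i f w)"
        using e(5)[of "opK i" "EF_scale i"] e(5)[of "opL i" "- EF_scale i"] by (simp add: rho_def op_linear_ops)
      also have "\<dots> = emb operators (\<lambda>f w. EF_scale i * opK i f w + (- EF_scale i) * opL i f w)"
        using e(2)[of "\<lambda>f w. EF_scale i * opK i f w" "\<lambda>f w. (- EF_scale i) * opL i f w"]
        by (simp add: op_linear_def opK_def opL_def algebra_simps)
      finally show ?thesis .
    qed
    have lin2: "op_linear (\<lambda>f w. EF_scale i * opK i f w + (- EF_scale i) * opL i f w)"
      by (simp add: op_linear_def opK_def opL_def algebra_simps)
    have "rho (F j) * rho (E i) + emb operators (\<lambda>f w. EF_scale i * opK i f w + (- EF_scale i) * opL i f w) =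
      emb operators (\<lambda>f w. opE i (opF j f) w + (EF_scale i * opK i f w + (- EF_scale i) * opL i f w))"
      using e(2)[of "\<lambda>f. opE i (opF j f)" "\<lambda>f w. EF_scale i * opK i f w + (- EF_scale i) * opL i f w"] comp_lin[of "E i" "F j"] lin2
      by (simp add: mult)
    moreover have "rho (E i) * rho (F j) = emb operators (\<lambda>f w. opE i (opF j f) w + (EF_scale i * opK i f w + (- EF_scale i) * opL i f w))"
      unfolding mult by (rule eqI) (simp add: opF_opE True right_diff_distrib)
    ultimately show ?thesis using True kl by simp
  next
    case False
    then have "rho (E i) * rho (F j) = rho (F j) * rho (E i)"
      unfolding mult by (intro eqI) (simp add: opF_opE)
    then show ?thesis using False by simp
  qed
  then show "rho (E i) * rho (F j) - rho (F j) * rho (E i) = (if i = j then scale (EF_scale i) (rho (K i) - rho (Kbar i)) else 0)"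
    by simp
qed

lemma rho_twist:
  "rho (Kbar j) * rho (E i) = scale (inverse (qa i j)) (rho (E i) * rho (Kbar j))"
  "rho (Kbar j) * rho (F i) = scale (qa i j) (rho (F i) * rho (Kbar j))"
  using qa_nonzero[of i j] by (simp_all add: rho_equations(8,10) scale_simps)

abbreviation serreE where "serreE i j \<equiv> q_serre (qi i) 1 (nat (1 - cartan \<alpha> i j)) (rho (E i)) (rho (E j))"
abbreviation serreF where "serreF i j \<equiv> q_serre (qi i) 1 (nat (1 - cartan \<alpha> i j)) (rho (F i)) (rho (F j))"

lemma serreF_commute:
  assumes ij: "i \<noteq> j" shows "rho (E k) * serreF i j = serreF i j * rho (E k)"
  by (rule q_serre_commute[OF ij, where h = "\<lambda>k. scale (EF_scale k) (rho (K k))" and h' = "\<lambda>k. scale (EF_scale k) (rho (Kbar k))" and u = "\<lambda>i. rho (F i)" and e = "\<lambda>i. rho (E i)"])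
    (simp_all add: rho_equations(11) scale.scale_right_diff_distrib scale_simps rho_twist rho_equations(9) mult.commute)

lemma serreE_commute:
  assumes ij: "i \<noteq> j" shows "rho (F k) * serreE i j = serreE i j * rho (F k)"
proof (rule q_serre_commute[OF ij, where h = "\<lambda>k. scale (EF_scale k) (rho (Kbar k))" and h' = "\<lambda>k. scale (EF_scale k) (rho (K k))" and u = "\<lambda>i. rho (E i)" and e = "\<lambda>i. rho (F i)"])
  fix k l
  have "rho (F k) * rho (E l) - rho (E l) * rho (F k) = - (rho (E l) * rho (F k) - rho (F k) * rho (E l))" by simp
  also have "\<dots> = (if k = l then scale (EF_scale k) (rho (Kbar k)) - scale (EF_scale k) (rho (K k)) else 0)"
    unfolding rho_equations(11) by (simp add: scale.scale_right_diff_distrib)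
  finally show "rho (F k) * rho (E l) - rho (E l) * rho (F k) = (if k = l then scale (EF_scale k) (rho (Kbar k)) - scale (EF_scale k) (rho (K k)) else 0)" .
qed (simp_all add: scale_simps rho_twist rho_equations(7) mult.commute)

abbreviation act where "act a f \<equiv> value_at operators a f"

lemma act_simps: "act (a * b) f = act b (act a f)" "act (a + b) f = (\<lambda>w. act a f w + act b f w)"
  "act (scale c a) f = (\<lambda>w. c * act a f w)" "act 0 f = (\<lambda>w. 0)" "act 1 f = f" "act (rho y) f = verma y f"
  "act (a - b) f = (\<lambda>w. act a f w - act b f w)" "act (- a) f = (\<lambda>w. - act a f w)"
proof -
  note v = value_at_simps[OF unital_operators]
  show "act (a * b) f = act b (act a f)" "act (a + b) f = (\<lambda>w. act a f w + act b f w)"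
    "act (scale c a) f = (\<lambda>w. c * act a f w)" "act 0 f = (\<lambda>w. 0)" "act 1 f = f" for a b
    by (simp_all add: v)
  then have "(\<lambda>w. act (a - b) f w + act b f w) = act (a - b + b) f" for a b by metis
  then show d: "act (a - b) f = (\<lambda>w. act a f w - act b f w)" for a b by (simp add: fun_eq_iff algebra_simps)
  show "act (- a) f = (\<lambda>w. - act a f w)" using d[of 0 a] \<open>act 0 f = (\<lambda>w. 0)\<close> by simp
  show "act (rho y) f = verma y f"
    unfolding rho_def by (subst value_at_emb[OF unital_operators]) (simp_all add: verma_linear)
qed

lemma act_linear: "op_linear (act a)"
  using value_at_closed[OF unital_operators, of a] by simp

text \<open>A Serre element in the \<open>E i\<close> commutes with all \<open>F k\<close>, which generate every word from the empty one,
  and at the empty word all \<open>E i\<close> are zero.\<close>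

lemma serreE_zero:
  assumes ij: "i \<noteq> j" shows "serreE i j = 0"
proof -
  have nil: "act (q_serre (qi i) z m (rho (E i)) v) f [] = 0" if "\<And>f. act v f [] = 0" for z m v f
    using that
  proof (induction m arbitrary: z v f)
    case 0
    then show ?case using qi_nonzero by simp
  next
    case (Suc m)
    show ?case unfolding q_serre_rec(1)[OF qi_nonzero]
      by (rule Suc.IH) (simp add: act_simps Suc.prems opE_def)
  qed
  have "act (serreE i j) f w = 0" for f w
  proof (induction w arbitrary: f)
    case Nil
    show ?case by (rule nil) (simp add: act_simps opE_def)
  next
    case (Cons k w)
    have "act (serreE i j) f (k # w) = act (serreE i j * rho (F k)) f w" by (simp add: act_simps opF_def)
    also have "\<dots> = act (serreE i j) (opF k f) w"
      unfolding serreE_commute[OF ij, symmetric] by (simp add: act_simps)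
    finally show ?case using Cons by simp
  qed
  then have "value_at operators (serreE i j) = \<zero>\<^bsub>operators\<^esub>" by (simp add: fun_eq_iff)
  moreover define eo where "eo = emb (operators :: ('k, ('n list \<Rightarrow> 'k) \<Rightarrow> ('n list \<Rightarrow> 'k)) module) \<one>\<^bsub>operators\<^esub>"
  \<comment> \<open>outside \<open>operators\<close> the family is zero, so its value there suffices\<close>
  have "eo * serreE i j = serreE i j"
  proof -
    have e: "eo * rho y = rho y" for y
      using rho_equations(5)[of y] by (simp add: rho_def eo_def)
    have e1: "eo * q_serre (qi i) z m (rho (E i)) v = q_serre (qi i) z m (rho (E i)) v"
      if "eo * v = v" for z m v
      using that
    proof (induction m arbitrary: z v)
      case 0
      then show ?case using qi_nonzero by simp
    next
      case (Suc m)
      show ?case unfolding q_serre_rec(1)[OF qi_nonzero]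
        by (rule Suc.IH) (simp add: right_diff_distrib scale_simps e Suc.prems flip: mult.assoc)
    qed
    show ?thesis by (rule e1[OF e])
  qed
  then show ?thesis
    using emb_value_at(1)[OF unital_operators, of "serreE i j"] emb_zero[OF unital_operators] calculation
    unfolding eo_def by metis
qed

definition vacuum :: "'n list \<Rightarrow> 'k" where "vacuum w = (if w = [] then 1 else 0)"

text \<open>The functionals obtained from the vacuum functional by the \<open>E i\<close>. By the commutation rules they form
  a submodule, and unlike the space of all functions it satisfies the Serre relations for the \<open>F i\<close>.\<close>

inductive_set vacuum_module :: "('n list \<Rightarrow> 'k) set" where
  vac: "vacuum \<in> vacuum_module"
| raise: "f \<in> vacuum_module \<Longrightarrow> opE i f \<in> vacuum_module"
| comb: "f \<in> vacuum_module \<Longrightarrow> h \<in> vacuum_module \<Longrightarrow> (\<lambda>w. c * f w + h w) \<in> vacuum_module"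

lemma vacuum_module_zero: "(\<lambda>w. 0) \<in> vacuum_module"
  using vacuum_module.comb[OF vacuum_module.vac vacuum_module.vac, of "- 1"] by simp

lemma vacuum_module_scale: "f \<in> vacuum_module \<Longrightarrow> (\<lambda>w. c * f w) \<in> vacuum_module"
  using vacuum_module.comb[OF _ vacuum_module_zero, of f c] by simp

lemma vacuum_module_KL: "f \<in> vacuum_module \<Longrightarrow> opK j f \<in> vacuum_module \<and> opL j f \<in> vacuum_module"
proof (induction rule: vacuum_module.induct)
  case vac
  have "opK j vacuum = (\<lambda>w. 2 * vacuum w)" "opL j vacuum = (\<lambda>w. inverse 2 * vacuum w)"
    by (auto simp: opK_def opL_def vacuum_def)
  then show ?case using vacuum_module_scale[OF vacuum_module.vac] by metis
next
  case (raise f i)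
  have "opK j (opE i f) = (\<lambda>w. inverse (qa i j) * opE i (opK j f) w)"
    by (simp add: opE_opK qa_cancel)
  then show ?case unfolding opE_opL using raise.IH by (simp add: vacuum_module_scale vacuum_module.raise)
next
  case (comb f h c)
  then show ?case
    using op_linearD(1)[OF op_linear_ops(2)[of j]] op_linearD(1)[OF op_linear_ops(3)[of j]] by (simp add: vacuum_module.comb)
qed

lemma vacuum_module_F: "f \<in> vacuum_module \<Longrightarrow> opF k f \<in> vacuum_module"
proof (induction rule: vacuum_module.induct)
  case vac
  have "opF k vacuum = (\<lambda>w. 0)" by (simp add: opF_def vacuum_def)
  then show ?case using vacuum_module_zero by simp
next
  case (raise f i)
  show ?case
  proof (cases "i = k")
    case True
    have "opF k (opE i f) = (\<lambda>w. EF_scale i * opK i f w + ((- EF_scale i) * opL i f w + opE i (opF k f) w))"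
      by (simp add: opF_opE True algebra_simps)
    then show ?thesis using vacuum_module_KL[OF raise.hyps, of i] vacuum_module.raise[OF raise.IH, of i]
      by (simp only:) (intro vacuum_module.comb, auto)
  next
    case False
    then have "opF k (opE i f) = opE i (opF k f)" by (simp add: opF_opE)
    then show ?thesis using vacuum_module.raise[OF raise.IH] by simp
  qed
next
  case (comb f h c)
  then show ?case using op_linearD(1)[OF op_linear_ops(1)[of k]] by (simp add: vacuum_module.comb)
qed

lemma vacuum_module_act: "f \<in> vacuum_module \<Longrightarrow> act (ev rho u) f \<in> vacuum_module"
proof -
  have word: "f \<in> vacuum_module \<Longrightarrow> act (prod_list (map rho w)) f \<in> vacuum_module" for w f
  proof (induction w arbitrary: f)
    case (Cons y w)
    have "verma y f \<in> vacuum_module"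
      using Cons.prems vacuum_module_F vacuum_module_KL vacuum_module.raise by (cases y) auto
    then show ?case using Cons.IH by (simp add: act_simps)
  qed (simp add: act_simps)
  have "Poly_Mapping.keys u \<subseteq> UNIV" by simp
  then show "f \<in> vacuum_module \<Longrightarrow> act (ev rho u) f \<in> vacuum_module"
  proof (induction rule: poly_mapping_single_induct)
    case (add u v)
    then show ?case using vacuum_module.comb[of "act (ev rho u) f" "act (ev rho v) f" 1] by (simp add: ev_simps act_simps)
  qed (simp_all add: ev_simps act_simps vacuum_module_zero vacuum_module_scale word)
qed

text \<open>A Serre element in the \<open>F i\<close> kills the vacuum functional, since all \<open>F k\<close> do, and commutes with the \<open>E k\<close>
  by which the others arise.\<close>

lemma serreF_kills:
  assumes ij: "i \<noteq> j" and f: "f \<in> vacuum_module"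
  shows "act (serreF i j) f = (\<lambda>w. 0)"
  using f
proof (induction rule: vacuum_module.induct)
  case vac
  have F0: "opF k vacuum = (\<lambda>w. 0)" for k by (simp add: opF_def vacuum_def)
  have "act (q_serre (qi i) z m (rho (F i)) v) vacuum = (\<lambda>w. 0)" if "act v vacuum = (\<lambda>w. 0)" for z m v
    using that
  proof (induction m arbitrary: z v)
    case 0
    then show ?case using qi_nonzero by simp
  next
    case (Suc m)
    show ?case unfolding q_serre_rec(1)[OF qi_nonzero]
      by (rule Suc.IH) (simp add: act_simps Suc.prems F0 op_linearD(3)[OF act_linear] op_linearD(3)[OF op_linear_ops(1)])
  qed
  then show ?case by (simp add: act_simps F0)
next
  case (raise f k)
  have "act (serreF i j) (opE k f) = act (rho (E k) * serreF i j) f" by (simp add: act_simps)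
  also have "\<dots> = opE k (act (serreF i j) f)" unfolding serreF_commute[OF ij] by (simp add: act_simps)
  finally show ?case by (simp add: raise.IH op_linearD(3)[OF op_linear_ops(4)])
next
  case (comb f h c)
  then show ?case by (simp add: op_linearD(1)[OF act_linear])
qed

lemma ideal_kills:
  assumes u: "u \<in> relation_ideal \<alpha> q \<kappa> \<kappa>'" and f: "f \<in> vacuum_module"
  shows "act (ev rho u) f = (\<lambda>w. 0)"
proof -
  have "ideal {u. \<forall>f\<in>vacuum_module. act (ev rho u) f = (\<lambda>w. 0)} free_algebra"
  proof (rule free_idealI)
    fix u :: "'n gen list \<Rightarrow>\<^sub>0 'k" assume "u \<in> {u. \<forall>f\<in>vacuum_module. act (ev rho u) f = (\<lambda>w. 0)}"
    then show "- u \<in> {u. \<forall>f\<in>vacuum_module. act (ev rho u) f = (\<lambda>w. 0)}"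
      using ev_simps(3)[of rho 0 u] by (simp add: ev_simps act_simps)
  qed (simp_all add: ev_simps act_simps vacuum_module_act op_linearD(3)[OF act_linear])
  moreover have "relators \<alpha> q \<kappa> \<kappa>' \<subseteq> {u. \<forall>f\<in>vacuum_module. act (ev rho u) f = (\<lambda>w. 0)}"
  proof -
    have z: "a = b \<Longrightarrow> act (a - b) f = (\<lambda>w. 0)" for a b :: "('k, ('n list \<Rightarrow> 'k) \<Rightarrow> ('n list \<Rightarrow> 'k)) family" and f
      by (simp add: act_simps)
    have KEL: "rho (K j) * (rho (E i) * rho (Kbar j)) = scale (qa i j) (rho (E i))"
      "rho (K j) * (rho (F i) * rho (Kbar j)) = scale (inverse (qa i j)) (rho (F i))" for i j
      by (simp_all only: mult.assoc[symmetric] rho_equations(7,9) scale_simps(5)) (simp_all only: mult.assoc rho_equations(1,6))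
    have EF: "rho (E i) * rho (F j) = rho (F j) * rho (E i)" if "i \<noteq> j" for i j
      using rho_equations(11)[of i j] that by simp
    have EF2: "rho (E i) * rho (F i) - rho (F i) * rho (E i) - (scale (EF_scale i) (rho (K i)) - scale (EF_scale i) (rho (Kbar i))) = 0" for i
      using rho_equations(11)[of i i] by (simp add: scale.scale_right_diff_distrib)
    have ev2: "prod_list (map rho [y]) = rho y" "prod_list (map rho [y, z]) = rho y * rho z" "prod_list (map rho [y, z, t]) = rho y * (rho z * rho t)" for y z t
      by simp_all
    have "\<forall>r\<in>relators \<alpha> q \<kappa> \<kappa>'. \<forall>f\<in>vacuum_module. act (ev rho r) f = (\<lambda>w. 0)"
      unfolding relators_def ball_Un ball_image_collect qa_minus EF_scale_def[symmetric] ev_simps(3,4) ev_serre ev2 scale_simps(4) EF2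
      by (intro conjI allI impI ballI z;
          (rule rho_equations(1)[symmetric] rho_equations(2-10) KEL act_simps(4) | erule EF | erule (1) serreF_kills |
            simp add: serreE_zero act_simps(4)))
    then show ?thesis by blast
  qed
  ultimately show ?thesis using u f relation_ideal_minimal by blast
qed

text \<open>The coefficients of the vacuum functional after the action. Any representative may be chosen since the
  relation ideal annihilates this functional.\<close>

definition coefficient :: "'n list \<Rightarrow> ('n gen list \<Rightarrow>\<^sub>0 'k) set \<Rightarrow> 'k" where
  "coefficient w y = act (ev rho (SOME u. u \<in> y)) vacuum w"

lemma coefficient_coset:
  "coefficient w (coset (relation_ideal \<alpha> q \<kappa> \<kappa>') free_algebra u) = act (ev rho u) vacuum w"
proof -
  let ?I = "relation_ideal \<alpha> q \<kappa> \<kappa>'"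
  interpret I: ideal ?I free_algebra by (rule relation_ideal)
  have "u \<in> coset ?I free_algebra u" by (rule I.a_rcos_self) simp
  then have "(SOME v. v \<in> coset ?I free_algebra u) \<in> coset ?I free_algebra u" by (rule someI)
  then obtain h where h: "h \<in> ?I" "(SOME v. v \<in> coset ?I free_algebra u) = h + u"
    by (auto simp: a_r_coset_def')
  show ?thesis unfolding coefficient_def h(2)
    by (simp add: ev_simps act_simps ideal_kills[OF h(1) vacuum_module.vac])
qed

lemma coefficient_linear: "coefficient w \<in> linear_maps W field_algebra"
proof -
  note s = weak_quantum_algebra_simps[where \<alpha> = \<alpha> and q = q and \<kappa> = \<kappa> and \<kappa>' = \<kappa>']
  have c: "\<exists>u. x = coset (relation_ideal \<alpha> q \<kappa> \<kappa>') free_algebra u" if "x \<in> carrier W" for x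
    using that unfolding s(1) by blast
  show ?thesis
    unfolding linear_maps_def
    by (auto dest!: c simp: s(4,6) coefficient_coset ev_simps act_simps field_algebra_def)
qed

lemma coefficient_gen: "coefficient w (g y) = verma y vacuum w" "coefficient w \<one>\<^bsub>W\<^esub> = vacuum w"
  unfolding generator_def weak_quantum_algebra_simps(2) coefficient_coset
  by (simp_all add: ev_simps act_simps scale_simps)

lemma coefficient_gen_mult: "coefficient w (g y \<otimes>\<^bsub>W\<^esub> g z) = verma z (verma y vacuum) w"
  unfolding generator_def
  by (subst weak_quantum_algebra_simps(5))
    (simp_all add: monoid_algebra_mult_simps coefficient_coset ev_simps act_simps scale_simps)

text \<open>On the vacuum, \<open>E i * F i - F i * E i\<close> has the coefficient \<open>(2 - 2\<^sup>-\<^sup>1) / (q i - q i\<^sup>-\<^sup>1)\<close>.\<close>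

lemma not_commutative: "\<not> commutative W"
proof
  fix i :: 'n
  assume "commutative W"
  then have "g (E i) \<otimes>\<^bsub>W\<^esub> g (F i) = g (F i) \<otimes>\<^bsub>W\<^esub> g (E i)" unfolding commutative_def by simp
  then have "coefficient [] (g (E i) \<otimes>\<^bsub>W\<^esub> g (F i)) = coefficient [] (g (F i) \<otimes>\<^bsub>W\<^esub> g (E i))" by simp
  then have "EF_scale i * (2 - inverse 2) = 0"
    by (simp add: coefficient_gen_mult opF_def opE_def vacuum_def EF_weight_def)
  then show False using EF_scale_nonzero[of i] by simp
qed

text \<open>As relators have no constant term, all generators may be sent to 0.\<close>

lemma J_neq_one: "g J \<noteq> \<one>\<^bsub>W\<^esub>"
proof
  assume J: "g J = \<one>\<^bsub>W\<^esub>"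
  have "weak_relations \<alpha> q \<kappa> \<kappa>' (\<lambda>_. 0 :: ('k, 'k) family)" unfolding weak_relations_def by simp
  from universal_property[OF unital_field_algebra this] obtain \<eta> where
    e: "\<eta> \<in> algebra_homs W field_algebra" "\<And>x. \<eta> (g x) = value_at field_algebra (0 :: ('k, 'k) family)" by blast
  have "\<eta> (g J) = 0" using e(2) value_at_zero[OF unital_field_algebra] by (simp add: field_algebra_def)
  moreover have "\<eta> \<one>\<^bsub>W\<^esub> = 1" using algebra_homsD(6)[OF e(1)] by (simp add: field_algebra_def)
  ultimately show False using J by simp
qed

end

context weak_hopf_data
begin

text \<open>The product of the coefficients at the empty word and at the word \<open>[i]\<close> takes the value \<open>c\<close> on
  \<open>xg i \<otimes> E i + E i \<otimes> K i\<close> and \<open>2 c\<close> on its flip, where \<open>c\<close> is the nonzero coefficient of \<open>E i\<close> at \<open>[i]\<close>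
  and 2 the coefficient of \<open>K i\<close> at the empty word.\<close>

lemma not_cocommutative: "\<not> cocommutative W \<Delta>"
proof
  fix i :: 'n
  assume coc: "cocommutative W \<Delta>"
  let ?\<beta> = "\<lambda>a b. coefficient [] a * coefficient [i] b"
  note l1 = linear_mapsD[OF coefficient_linear[of "[]"], simplified]
    and l2 = linear_mapsD[OF coefficient_linear[of "[i]"], simplified]
  have b: "bilinear_map W W field_algebra ?\<beta>"
    by (rule bilinear_mapI) (simp_all add: l1 l2 algebra_simps)
  have fb: "bilinear_map W W TT (\<lambda>a b. pure_tensor W W b a)"
    by (rule bilinear_mapI) (simp_all add: bW)
  note p = WW.tensor_lift_pure[OF unital_field_algebra b]
  note l = linear_mapsD[OF WW.tensor_lift_linear[OF unital_field_algebra b], simplified]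
  have fl: "tensor_flip W \<in> linear_maps TT TT"
    unfolding tensor_flip_def by (rule WW.tensor_lift_linear[OF WW.unital_tensor fb])
  have fp: "tensor_flip W (pure_tensor W W a b) = pure_tensor W W b a" if "a \<in> carrier W" "b \<in> carrier W" for a b
    unfolding tensor_flip_def by (rule WW.tensor_lift_pure[OF WW.unital_tensor fb that])
  have x: "coefficient w (xg i) = vacuum w" for w
    by (simp add: xg_def coefficient_gen)
  have "tensor_flip W (\<Delta> (g (E i))) = \<Delta> (g (E i))" using coc unfolding cocommutative_def by simp
  then have "tensor_lift field_algebra ?\<beta> (tensor_flip W (\<Delta> (g (E i)))) = tensor_lift field_algebra ?\<beta> (\<Delta> (g (E i)))" by simp
  then have "2 * (EF_scale i * (2 - inverse 2)) = EF_scale i * (2 - inverse 2)"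
    by (simp add: Delta_gen linear_mapsD[OF fl] fp l p x coefficient_gen opE_def opK_def opF_def vacuum_def EF_weight_def)
  then show False using EF_scale_nonzero[of i] by simp
qed

end

section \<open>The weak quantum algebra is a weak Hopf algebra\<close>

theorem theorem3p1:
  fixes R :: "'v::euclidean_space set"
    and \<alpha> :: "'n::finite \<Rightarrow> 'v"
    and q :: "'k::field_char_0"
    and \<kappa> \<kappa>' :: "'n \<Rightarrow> bool"
  assumes "irreducible_root_system R"
    and "simple_roots R \<alpha>"
    and "\<forall>\<beta>\<in>short_roots R. \<beta> \<bullet> \<beta> = 2"
    and "\<forall>i. q_root \<alpha> q i \<noteq> 0 \<and> q_root \<alpha> q i \<noteq> 1 \<and> q_root \<alpha> q i \<noteq> - 1"
  defines "\<ww> \<equiv> weak_quantum_algebra \<alpha> q \<kappa> \<kappa>'"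
    and "g \<equiv> generator \<alpha> q \<kappa> \<kappa>'"
  shows "(\<exists>\<Delta> \<epsilon> T. is_comultiplication \<ww> g \<kappa> \<kappa>' \<Delta> \<and> is_counit \<ww> g \<epsilon> \<and> is_antipode_map \<ww> g T) \<and>
    (\<forall>\<Delta> \<epsilon> T. is_comultiplication \<ww> g \<kappa> \<kappa>' \<Delta> \<and> is_counit \<ww> g \<epsilon> \<and> is_antipode_map \<ww> g T \<longrightarrow>
       weak_hopf_algebra \<ww> \<Delta> \<epsilon> \<and> weak_antipode \<ww> \<Delta> T \<and>
       \<not> commutative \<ww> \<and> \<not> cocommutative \<ww> \<Delta> \<and> \<not> hopf_algebra \<ww> \<Delta> \<epsilon>)"
proof -
  interpret weak_quantum_data R \<alpha> q \<kappa> \<kappa>'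
    by (intro weak_quantum_data.intro simple_root_data.intro weak_quantum_data_axioms.intro assms(1-3))
      (use assms(4) in blast)
  show ?thesis
    unfolding \<ww>_def g_def
  proof (intro conjI allI impI)
    show "\<exists>\<Delta> \<epsilon> T. is_comultiplication W (generator \<alpha> q \<kappa> \<kappa>') \<kappa> \<kappa>' \<Delta> \<and> is_counit W (generator \<alpha> q \<kappa> \<kappa>') \<epsilon> \<and> is_antipode_map W (generator \<alpha> q \<kappa> \<kappa>') T"
      using ex_comultiplication ex_counit ex_antipode_map by blast
  next
    fix \<Delta> \<epsilon> T
    assume a: "is_comultiplication W (generator \<alpha> q \<kappa> \<kappa>') \<kappa> \<kappa>' \<Delta> \<and> is_counit W (generator \<alpha> q \<kappa> \<kappa>') \<epsilon> \<and> is_antipode_map W (generator \<alpha> q \<kappa> \<kappa>') T"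
    then interpret H: weak_hopf_data R \<alpha> q \<kappa> \<kappa>' \<Delta> \<epsilon> T
      by unfold_locales auto
    show "weak_antipode W \<Delta> T" by (rule H.weak_antipode)
    then show "weak_hopf_algebra W \<Delta> \<epsilon>"
      unfolding weak_hopf_algebra_def using H.bialgebra by blast
    show "\<not> commutative W" by (rule not_commutative)
    show "\<not> cocommutative W \<Delta>" by (rule H.not_cocommutative)
    show "\<not> hopf_algebra W \<Delta> \<epsilon>" by (rule H.not_hopf[OF J_neq_one])
  qed
qed

end
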